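(* Let $A$ be a Dedekind domain or a field with field of fractions $K$, let $R$ be an $A$-algebra and $P$ an $R$-module such that $(A,R,P)$ satisfies the standard hypotheses. Suppose that $R_K$ is semisimple. If, for each residue field $F$ of $A$, the $R_F$-module $P_F$ has the double centraliser property, then the $R$-module $P$ has the double centraliser property. In particular, if $G$ is a finite group and $X$ is a finite $G$-set then the permutation module $\mathbb Z X$ for $\mathbb Z G$ has the double centraliser property provided that for each prime $p$ the permutation module $\mathbb F_pX$ for $\mathbb F_pG$ has the double centraliser property.
   Context: All modules are left modules; $A$-algebras are associative, unital, not necessarily commutative. A residue field of $A$ is $A/\mathfrak m$ with $\mathfrak m$ a maximal ideal. For an $A$-algebra $B$, $R_B=B\otimes_A R$ and $P_B=B\otimes_A P$. The double centraliser ring $\mathrm{DEnd}_R(P)$ is the ring of additive maps $\sigma:P\to P$ with $\sigma\circ\alpha=\alpha\circ\sigma$ for all $\alpha\in\mathrm{End}_R(P)$. $P$ has the double centraliser property if the natural map $\nu:R\to\mathrm{DEnd}_R(P)$, $\nu(r)(p)=rp$, is surjective. Standard hypotheses for $(A,R,P)$: (i) $R$ and $P$ are free of finite rank over $A$; (ii) $\mathrm{End}_R(P)$ is free of finite rank over $A$; (iii) for every $A$-algebra $B$ the natural map $\Psi_B:B^{\mathrm{op}}\otimes_A\mathrm{End}_R(P)\to\mathrm{End}_{R_B}(P_B)$, $\Psi_B(b\otimes\alpha)(b'\otimes p)=b'b\otimes\alpha(p)$, is an isomorphism. *)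

theory Defs
  imports "HOL-Algebra.Free_Abelian_Groups" "HOL-Algebra.IntRing" "HOL-Algebra.Group_Action"
    "HOL-Algebra.Ring_Divisibility"
begin

section \<open>Algebras and left modules\<close>

text \<open>
  The library's \<open>module\<close> and \<open>algebra\<close> require a commutative ring of scalars, respectively a
  commutative algebra, so left modules over arbitrary rings and associative (not necessarily
  commutative) algebras are introduced here on the same record type. The fields \<open>mult\<close> and \<open>one\<close>
  are irrelevant for a record that is used only as a module. The library's \<open>submodule\<close> does not
  require commutative scalars and is used unchanged.
\<close>

locale left_module = R?: ring R + M?: abelian_group M
  for R :: "('a, 'e) ring_scheme" (structure)
    and M :: "('a, 'b, 'c) module_scheme" (structure) +
  assumes smult_closed [simp, intro]:
      "\<lbrakk>r \<in> carrier R; x \<in> carrier M\<rbrakk> \<Longrightarrow> r \<odot>\<^bsub>M\<^esub> x \<in> carrier M"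
    and smult_l_distr:
      "\<lbrakk>r \<in> carrier R; s \<in> carrier R; x \<in> carrier M\<rbrakk> \<Longrightarrow>
      (r \<oplus> s) \<odot>\<^bsub>M\<^esub> x = r \<odot>\<^bsub>M\<^esub> x \<oplus>\<^bsub>M\<^esub> s \<odot>\<^bsub>M\<^esub> x"
    and smult_r_distr:
      "\<lbrakk>r \<in> carrier R; x \<in> carrier M; y \<in> carrier M\<rbrakk> \<Longrightarrow>
      r \<odot>\<^bsub>M\<^esub> (x \<oplus>\<^bsub>M\<^esub> y) = r \<odot>\<^bsub>M\<^esub> x \<oplus>\<^bsub>M\<^esub> r \<odot>\<^bsub>M\<^esub> y"
    and smult_assoc1:
      "\<lbrakk>r \<in> carrier R; s \<in> carrier R; x \<in> carrier M\<rbrakk> \<Longrightarrow>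
      (r \<otimes> s) \<odot>\<^bsub>M\<^esub> x = r \<odot>\<^bsub>M\<^esub> (s \<odot>\<^bsub>M\<^esub> x)"
    and smult_one [simp]:
      "x \<in> carrier M \<Longrightarrow> \<one> \<odot>\<^bsub>M\<^esub> x = x"

locale assoc_algebra = module + ring M +
  assumes smult_assoc2:
      "\<lbrakk>a \<in> carrier R; x \<in> carrier M; y \<in> carrier M\<rbrakk> \<Longrightarrow>
      (a \<odot>\<^bsub>M\<^esub> x) \<otimes>\<^bsub>M\<^esub> y = a \<odot>\<^bsub>M\<^esub> (x \<otimes>\<^bsub>M\<^esub> y)"
    and smult_assoc3:
      "\<lbrakk>a \<in> carrier R; x \<in> carrier M; y \<in> carrier M\<rbrakk> \<Longrightarrow>
      x \<otimes>\<^bsub>M\<^esub> (a \<odot>\<^bsub>M\<^esub> y) = a \<odot>\<^bsub>M\<^esub> (x \<otimes>\<^bsub>M\<^esub> y)"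

text \<open>For an \<open>A\<close>-algebra \<open>R\<close>, an \<open>R\<close>-module \<open>P\<close> is an \<open>A\<close>-module through \<open>a \<mapsto> a\<cdot>1\<^sub>R\<close>.\<close>

definition restrict_scalars ::
  "('a, 'r, 'c) module_scheme \<Rightarrow> ('r, 'p, 'd) module_scheme \<Rightarrow> ('a, 'p) module" where
  "restrict_scalars R P =
    \<lparr>carrier = carrier P, monoid.mult = undefined, one = undefined, zero = \<zero>\<^bsub>P\<^esub>,
     add = add P, smult = (\<lambda>a p. (a \<odot>\<^bsub>R\<^esub> \<one>\<^bsub>R\<^esub>) \<odot>\<^bsub>P\<^esub> p)\<rparr>"

definition free_of_finite_rank ::
  "('a, 'c) ring_scheme \<Rightarrow> ('a, 'm, 'd) module_scheme \<Rightarrow> bool" where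
  "free_of_finite_rank A M \<longleftrightarrow>
    (\<exists>S. finite S \<and> S \<subseteq> carrier M \<and>
      (\<forall>x\<in>carrier M. \<exists>!c. c \<in> S \<rightarrow>\<^sub>E carrier A \<and> x = (\<Oplus>\<^bsub>M\<^esub>s\<in>S. c s \<odot>\<^bsub>M\<^esub> s)))"

definition op_algebra :: "('a, 'b) module \<Rightarrow> ('a, 'b) module" where
  "op_algebra B = B\<lparr>monoid.mult := (\<lambda>x y. y \<otimes>\<^bsub>B\<^esub> x)\<rparr>"


section \<open>Endomorphism rings and the double centraliser property\<close>

text \<open>As in \<open>BijGroup\<close>, maps are extensional so that each map has exactly one representative.\<close>

definition additive_End :: "('r, 'p, 'c) module_scheme \<Rightarrow> ('p \<Rightarrow> 'p) ring" where
  "additive_End P =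
    \<lparr>carrier = {f \<in> carrier P \<rightarrow>\<^sub>E carrier P.
       \<forall>x\<in>carrier P. \<forall>y\<in>carrier P. f (x \<oplus>\<^bsub>P\<^esub> y) = f x \<oplus>\<^bsub>P\<^esub> f y},
     monoid.mult = compose (carrier P), one = (\<lambda>x\<in>carrier P. x), zero = (\<lambda>x\<in>carrier P. \<zero>\<^bsub>P\<^esub>),
     add = (\<lambda>f g. \<lambda>x\<in>carrier P. f x \<oplus>\<^bsub>P\<^esub> g x)\<rparr>"

definition End_ring :: "('r, 'c) ring_scheme \<Rightarrow> ('r, 'p, 'd) module_scheme \<Rightarrow> ('p \<Rightarrow> 'p) ring" where
  "End_ring R P = (additive_End P)
    \<lparr>carrier := {f \<in> carrier (additive_End P).
       \<forall>r\<in>carrier R. \<forall>x\<in>carrier P. f (r \<odot>\<^bsub>P\<^esub> x) = r \<odot>\<^bsub>P\<^esub> f x}\<rparr>"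

definition DEnd_ring :: "('r, 'c) ring_scheme \<Rightarrow> ('r, 'p, 'd) module_scheme \<Rightarrow> ('p \<Rightarrow> 'p) ring" where
  "DEnd_ring R P = (additive_End P)
    \<lparr>carrier := {\<sigma> \<in> carrier (additive_End P).
       \<forall>\<alpha>\<in>carrier (End_ring R P). compose (carrier P) \<sigma> \<alpha> = compose (carrier P) \<alpha> \<sigma>}\<rparr>"

definition homothety :: "('r, 'p, 'd) module_scheme \<Rightarrow> 'r \<Rightarrow> 'p \<Rightarrow> 'p" where
  "homothety P r = (\<lambda>x\<in>carrier P. r \<odot>\<^bsub>P\<^esub> x)"

definition double_centraliser_property ::
  "('r, 'c) ring_scheme \<Rightarrow> ('r, 'p, 'd) module_scheme \<Rightarrow> bool" where
  "double_centraliser_property R P \<longleftrightarrow> homothety P ` carrier R = carrier (DEnd_ring R P)"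

definition End_algebra ::
  "('a, 'r, 'c) module_scheme \<Rightarrow> ('r, 'p, 'd) module_scheme \<Rightarrow> ('a, 'p \<Rightarrow> 'p) module" where
  "End_algebra R P = ring.extend (End_ring R P)
    (module.fields (\<lambda>a f. \<lambda>x\<in>carrier P. a \<odot>\<^bsub>restrict_scalars R P\<^esub> f x))"


section \<open>Tensor products over a commutative ring\<close>

text \<open>
  The tensor product of the \<open>A\<close>-modules \<open>M\<close> and \<open>N\<close> is the free abelian group on
  \<open>carrier M \<times> carrier N\<close> modulo the subgroup generated by the usual bilinearity relations;
  its elements are cosets of that subgroup.
\<close>

definition tensor_free :: "('a, 'm, 'c) module_scheme \<Rightarrow> ('a, 'n, 'd) module_scheme \<Rightarrow>
    ('m \<times> 'n \<Rightarrow>\<^sub>0 int) monoid" where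
  "tensor_free M N = free_Abelian_group (carrier M \<times> carrier N)"

definition tensor_null :: "('a, 'e) ring_scheme \<Rightarrow> ('a, 'm, 'c) module_scheme \<Rightarrow>
    ('a, 'n, 'd) module_scheme \<Rightarrow> ('m \<times> 'n \<Rightarrow>\<^sub>0 int) set" where
  "tensor_null A M N = generate (tensor_free M N)
    ({frag_of (x \<oplus>\<^bsub>M\<^esub> x', y) - frag_of (x, y) - frag_of (x', y) | x x' y.
        x \<in> carrier M \<and> x' \<in> carrier M \<and> y \<in> carrier N} \<union>
     {frag_of (x, y \<oplus>\<^bsub>N\<^esub> y') - frag_of (x, y) - frag_of (x, y') | x y y'.
        x \<in> carrier M \<and> y \<in> carrier N \<and> y' \<in> carrier N} \<union>
     {frag_of (a \<odot>\<^bsub>M\<^esub> x, y) - frag_of (x, a \<odot>\<^bsub>N\<^esub> y) | a x y.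
        a \<in> carrier A \<and> x \<in> carrier M \<and> y \<in> carrier N})"

definition tensor_class :: "('a, 'e) ring_scheme \<Rightarrow> ('a, 'm, 'c) module_scheme \<Rightarrow>
    ('a, 'n, 'd) module_scheme \<Rightarrow> ('m \<times> 'n \<Rightarrow>\<^sub>0 int) \<Rightarrow> ('m \<times> 'n \<Rightarrow>\<^sub>0 int) set" where
  "tensor_class A M N u = tensor_null A M N #>\<^bsub>tensor_free M N\<^esub> u"

text \<open>
  For \<open>A\<close>-bilinear maps \<open>f : M\<^sub>1 \<times> M\<^sub>2 \<rightarrow> M\<close> and \<open>g : N\<^sub>1 \<times> N\<^sub>2 \<rightarrow> N\<close>, this is the biadditive map
  \<open>(M\<^sub>1 \<otimes> N\<^sub>1) \<times> (M\<^sub>2 \<otimes> N\<^sub>2) \<rightarrow> M \<otimes> N\<close> with \<open>(x \<otimes> y, x' \<otimes> y') \<mapsto> f x x' \<otimes> g y y'\<close>. It is computed on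
  representatives; bilinearity makes all classes in the union coincide.
\<close>

definition tensor_bimap :: "('a, 'e) ring_scheme \<Rightarrow> ('a, 'm, 'c) module_scheme \<Rightarrow>
    ('a, 'n, 'd) module_scheme \<Rightarrow> ('m1 \<Rightarrow> 'm2 \<Rightarrow> 'm) \<Rightarrow> ('n1 \<Rightarrow> 'n2 \<Rightarrow> 'n) \<Rightarrow>
    ('m1 \<times> 'n1 \<Rightarrow>\<^sub>0 int) set \<Rightarrow> ('m2 \<times> 'n2 \<Rightarrow>\<^sub>0 int) set \<Rightarrow> ('m \<times> 'n \<Rightarrow>\<^sub>0 int) set" where
  "tensor_bimap A M N f g X Y = (\<Union>u\<in>X. \<Union>v\<in>Y. tensor_class A M N
     (frag_extend (\<lambda>(x, y). frag_extend (\<lambda>(x', y'). frag_of (f x x', g y y')) v) u))"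

definition tensor_ring :: "('a, 'e) ring_scheme \<Rightarrow> ('a, 'b, 'c) module_scheme \<Rightarrow>
    ('a, 'r, 'd) module_scheme \<Rightarrow> ('b \<times> 'r \<Rightarrow>\<^sub>0 int) set ring" where
  "tensor_ring A B R =
    \<lparr>carrier = carrier (tensor_free B R Mod tensor_null A B R),
     monoid.mult = tensor_bimap A B R (monoid.mult B) (monoid.mult R),
     one = tensor_class A B R (frag_of (\<one>\<^bsub>B\<^esub>, \<one>\<^bsub>R\<^esub>)),
     zero = \<one>\<^bsub>tensor_free B R Mod tensor_null A B R\<^esub>,
     add = monoid.mult (tensor_free B R Mod tensor_null A B R)\<rparr>"

text \<open>\<open>P\<^sub>B = B \<otimes>\<^sub>A P\<close> as a module over \<open>R\<^sub>B = B \<otimes>\<^sub>A R\<close> (that is, \<open>tensor_ring A B R\<close>):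
  \<open>(b \<otimes> r)(b' \<otimes> p) = bb' \<otimes> rp\<close>.\<close>

definition base_change_module :: "('a, 'e) ring_scheme \<Rightarrow> ('a, 'b, 'c) module_scheme \<Rightarrow>
    ('a, 'r, 'd) module_scheme \<Rightarrow> ('r, 'p, 'f) module_scheme \<Rightarrow>
    (('b \<times> 'r \<Rightarrow>\<^sub>0 int) set, ('b \<times> 'p \<Rightarrow>\<^sub>0 int) set) module" where
  "base_change_module A B R P = 
    (let Q = restrict_scalars R P; T = tensor_free B Q Mod tensor_null A B Q in
    \<lparr>carrier = carrier T, monoid.mult = undefined, one = undefined, zero = \<one>\<^bsub>T\<^esub>, add = monoid.mult T,
     smult = tensor_bimap A B Q (monoid.mult B) (smult P)\<rparr>)"


section \<open>The standard hypotheses\<close>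

text \<open>The natural map \<open>\<Psi>\<^sub>B\<close>, determined by \<open>\<Psi>\<^sub>B (b \<otimes> \<alpha>) (b' \<otimes> p) = b'b \<otimes> \<alpha> p\<close>.\<close>

definition Psi :: "('a, 'e) ring_scheme \<Rightarrow> ('a, 'b) module \<Rightarrow> ('a, 'r, 'd) module_scheme \<Rightarrow>
    ('r, 'p, 'f) module_scheme \<Rightarrow> ('b \<times> ('p \<Rightarrow> 'p) \<Rightarrow>\<^sub>0 int) set \<Rightarrow>
    ('b \<times> 'p \<Rightarrow>\<^sub>0 int) set \<Rightarrow> ('b \<times> 'p \<Rightarrow>\<^sub>0 int) set" where
  "Psi A B R P X = (\<lambda>Y\<in>carrier (base_change_module A B R P).
     tensor_bimap A B (restrict_scalars R P) (\<lambda>b b'. b' \<otimes>\<^bsub>B\<^esub> b) (\<lambda>\<alpha> p. \<alpha> p) X Y)"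

text \<open>
  HOL cannot quantify over types inside a proposition, so ``for every \<open>A\<close>-algebra \<open>B\<close>'' ranges over
  all algebras whose elements are drawn from the type \<open>'b\<close> given as the first argument. A hypothesis
  at one particular \<open>'b\<close> is implied by the same hypothesis for all algebras, so a theorem
  assuming it only at one \<open>'b\<close> is at least as strong as the unrestricted one. For \<open>A\<close> with
  elements of type \<open>'a\<close>, the type \<open>('a \<times> 'a) set\<close> accommodates isomorphic copies of \<open>A\<close>, of its
  residue fields, of its fraction field and, if \<open>A\<close> is infinite, of every \<open>A\<close>-algebra whose
  cardinality is at most that of the power set of \<open>A\<close>.
\<close>

definition standard_hypotheses ::
  "'b itself \<Rightarrow> ('a, 'e) ring_scheme \<Rightarrow> ('a, 'r, 'd) module_scheme \<Rightarrow> ('r, 'p, 'f) module_scheme \<Rightarrow> bool"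
where
  "standard_hypotheses (_ :: 'b itself) A R P \<longleftrightarrow>
    free_of_finite_rank A R \<and>
    free_of_finite_rank A (restrict_scalars R P) \<and>
    free_of_finite_rank A (End_algebra R P) \<and>
    (\<forall>B :: ('a, 'b) module. assoc_algebra A B \<longrightarrow>
      Psi A B R P \<in> ring_iso (tensor_ring A (op_algebra B) (End_algebra R P))
        (End_ring (tensor_ring A B R) (base_change_module A B R P)))"


section \<open>Fraction fields, residue fields, Dedekind domains\<close>

definition fraction :: "('a, 'e) ring_scheme \<Rightarrow> 'a \<Rightarrow> 'a \<Rightarrow> ('a \<times> 'a) set" where
  "fraction A a b =
    {(c, d). c \<in> carrier A \<and> d \<in> carrier A - {\<zero>\<^bsub>A\<^esub>} \<and> a \<otimes>\<^bsub>A\<^esub> d = c \<otimes>\<^bsub>A\<^esub> b}"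

text \<open>The operations are computed on representatives; all classes in each union coincide.\<close>

definition fraction_field :: "('a, 'e) ring_scheme \<Rightarrow> ('a, ('a \<times> 'a) set) module" where
  "fraction_field A =
    \<lparr>carrier = {fraction A a b | a b. a \<in> carrier A \<and> b \<in> carrier A - {\<zero>\<^bsub>A\<^esub>}},
     monoid.mult = (\<lambda>X Y. \<Union>(a, b)\<in>X. \<Union>(c, d)\<in>Y. fraction A (a \<otimes>\<^bsub>A\<^esub> c) (b \<otimes>\<^bsub>A\<^esub> d)),
     one = fraction A \<one>\<^bsub>A\<^esub> \<one>\<^bsub>A\<^esub>,
     zero = fraction A \<zero>\<^bsub>A\<^esub> \<one>\<^bsub>A\<^esub>,
     add = (\<lambda>X Y. \<Union>(a, b)\<in>X. \<Union>(c, d)\<in>Y.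
       fraction A (a \<otimes>\<^bsub>A\<^esub> d \<oplus>\<^bsub>A\<^esub> c \<otimes>\<^bsub>A\<^esub> b) (b \<otimes>\<^bsub>A\<^esub> d)),
     smult = (\<lambda>a X. \<Union>(c, d)\<in>X. fraction A (a \<otimes>\<^bsub>A\<^esub> c) d)\<rparr>"

definition residue_algebra :: "('a, 'e) ring_scheme \<Rightarrow> 'a set \<Rightarrow> ('a, 'a set) module" where
  "residue_algebra A \<mm> = ring.extend (A Quot \<mm>)
    (module.fields (\<lambda>a X. (\<mm> +>\<^bsub>A\<^esub> a) \<otimes>\<^bsub>A Quot \<mm>\<^esub> X))"

definition integrally_closed :: "('a, 'e) ring_scheme \<Rightarrow> bool" where
  "integrally_closed A \<longleftrightarrow> (let K = fraction_field A in
    \<forall>x\<in>carrier K.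
      (\<exists>(n::nat) c. c \<in> {..<n} \<rightarrow> carrier A \<and>
         x [^]\<^bsub>K\<^esub> n \<oplus>\<^bsub>K\<^esub> (\<Oplus>\<^bsub>K\<^esub>i\<in>{..<n}. c i \<odot>\<^bsub>K\<^esub> (x [^]\<^bsub>K\<^esub> i)) = \<zero>\<^bsub>K\<^esub>) \<longrightarrow>
      (\<exists>a\<in>carrier A. x = a \<odot>\<^bsub>K\<^esub> \<one>\<^bsub>K\<^esub>))"

text \<open>Fields satisfy these conditions and are not excluded.\<close>

definition dedekind_domain :: "('a, 'e) ring_scheme \<Rightarrow> bool" where
  "dedekind_domain A \<longleftrightarrow> noetherian_domain A \<and> integrally_closed A \<and>
    (\<forall>I. primeideal I A \<and> I \<noteq> {\<zero>\<^bsub>A\<^esub>} \<longrightarrow> maximalideal I A)"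


section \<open>Semisimple rings\<close>

definition simple_submodule ::
  "'m set \<Rightarrow> ('r, 'c) ring_scheme \<Rightarrow> ('r, 'm, 'd) module_scheme \<Rightarrow> bool" where
  "simple_submodule N R M \<longleftrightarrow> submodule N R M \<and> N \<noteq> {\<zero>\<^bsub>M\<^esub>} \<and>
    (\<forall>L. submodule L R M \<and> L \<subseteq> N \<longrightarrow> L = {\<zero>\<^bsub>M\<^esub>} \<or> L = N)"

text \<open>\<open>M\<close> is the internal direct sum of a family of simple submodules.\<close>

definition semisimple_module ::
  "('r, 'c) ring_scheme \<Rightarrow> ('r, 'm, 'd) module_scheme \<Rightarrow> bool" where
  "semisimple_module R M \<longleftrightarrow>
    (\<exists>\<S>. (\<forall>N\<in>\<S>. simple_submodule N R M) \<and>
      (\<forall>x\<in>carrier M. \<exists>!f. f \<in> (\<Pi>\<^sub>E N\<in>\<S>. N) \<and> finite {N \<in> \<S>. f N \<noteq> \<zero>\<^bsub>M\<^esub>} \<and>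
        x = (\<Oplus>\<^bsub>M\<^esub>N\<in>{N \<in> \<S>. f N \<noteq> \<zero>\<^bsub>M\<^esub>}. f N)))"

definition regular_module :: "'r ring \<Rightarrow> ('r, 'r) module" where
  "regular_module R = ring.extend R (module.fields (monoid.mult R))"

definition semisimple_ring :: "'r ring \<Rightarrow> bool" where
  "semisimple_ring R \<longleftrightarrow> semisimple_module R (regular_module R)"


section \<open>Group rings and permutation modules\<close>

text \<open>
  For finite \<open>G\<close>, an element of \<open>kG\<close> is its coefficient function \<open>G \<rightarrow> k\<close>, and for a finite \<open>G\<close>-set
  \<open>X\<close> an element of \<open>kX\<close> is its coefficient function \<open>X \<rightarrow> k\<close>; the basis element \<open>x\<close> is sent by \<open>g\<close>
  to \<open>\<phi> g x\<close>, so the coefficient of \<open>x\<close> in \<open>g\<cdot>u\<close> is the coefficient of \<open>g\<inverse>\<cdot>x\<close> in \<open>u\<close>.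
\<close>

definition group_ring :: "('k, 'e) ring_scheme \<Rightarrow> ('g, 'c) monoid_scheme \<Rightarrow> ('k, 'g \<Rightarrow> 'k) module" where
  "group_ring k G =
    \<lparr>carrier = carrier G \<rightarrow>\<^sub>E carrier k,
     monoid.mult = (\<lambda>u v. \<lambda>g\<in>carrier G. \<Oplus>\<^bsub>k\<^esub>h\<in>carrier G. u h \<otimes>\<^bsub>k\<^esub> v (inv\<^bsub>G\<^esub> h \<otimes>\<^bsub>G\<^esub> g)),
     one = (\<lambda>g\<in>carrier G. if g = \<one>\<^bsub>G\<^esub> then \<one>\<^bsub>k\<^esub> else \<zero>\<^bsub>k\<^esub>),
     zero = (\<lambda>g\<in>carrier G. \<zero>\<^bsub>k\<^esub>),
     add = (\<lambda>u v. \<lambda>g\<in>carrier G. u g \<oplus>\<^bsub>k\<^esub> v g),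
     smult = (\<lambda>a u. \<lambda>g\<in>carrier G. a \<otimes>\<^bsub>k\<^esub> u g)\<rparr>"

definition permutation_module :: "('k, 'e) ring_scheme \<Rightarrow> ('g, 'c) monoid_scheme \<Rightarrow> 'x set \<Rightarrow>
    ('g \<Rightarrow> 'x \<Rightarrow> 'x) \<Rightarrow> ('g \<Rightarrow> 'k, 'x \<Rightarrow> 'k) module" where
  "permutation_module k G X \<phi> =
    \<lparr>carrier = X \<rightarrow>\<^sub>E carrier k, monoid.mult = undefined, one = undefined,
     zero = (\<lambda>x\<in>X. \<zero>\<^bsub>k\<^esub>),
     add = (\<lambda>u v. \<lambda>x\<in>X. u x \<oplus>\<^bsub>k\<^esub> v x),
     smult = (\<lambda>r u. \<lambda>x\<in>X. \<Oplus>\<^bsub>k\<^esub>g\<in>carrier G. r g \<otimes>\<^bsub>k\<^esub> u (\<phi> (inv\<^bsub>G\<^esub> g) x))\<rparr>"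

end

theory Submission
  imports Defs
begin

text \<open>
  Let \<open>D\<close> be the double centraliser ring and \<open>\<nu> : R \<rightarrow> D\<close> the natural map. Semisimplicity of \<open>R\<^sub>K\<close> provides
  a nonzero \<open>a \<in> A\<close> with \<open>a D \<subseteq> \<nu>(R)\<close> (a density argument with denominators), so
  \<open>J = {a. a D \<subseteq> \<nu>(R)}\<close> is a nonzero ideal. If it is proper, some \<open>\<mm> = (J : b)\<close> is prime, hence maximal. Since
  endomorphisms of \<open>P\<^sub>F\<close> lift to \<open>P\<close> through \<open>\<Psi>\<close>, each \<open>\<sigma> \<in> D\<close> induces an element of the double centraliser
  of \<open>P\<^sub>F\<close> for \<open>F = A/\<mm>\<close>, so \<open>\<sigma> - \<nu>(r)\<close> maps \<open>P\<close> to \<open>\<mm>P\<close> for some \<open>r\<close>. Choose \<open>c \<in> \<mm>\<inverse>\<close> and \<open>x \<in> \<mm>\<close> with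
  \<open>y = c x \<notin> \<mm>\<close>. Then \<open>\<sigma>' = c (\<sigma> - \<nu>(r)) \<in> D\<close> and \<open>b y (\<sigma> - \<nu>(r)) = b x \<sigma>' \<in> \<nu>(R)\<close> because \<open>b x \<in> J\<close>. Thus
  \<open>b y \<in> J\<close>, that is, \<open>y \<in> \<mm>\<close>, a contradiction.

  For \<open>\<int>X\<close> the elements of \<open>D\<close> are the integer matrices commuting with all \<open>G\<close>-invariant ones. There the
  denominator comes from orthogonal projection onto the span of the permutation matrices, endomorphisms
  of \<open>F\<^sub>pX\<close> lift because their matrices are \<open>G\<close>-invariant, and the primes of the denominator are removed
  one at a time.
\<close>

text \<open>Double centralisers need not commute with base change, so \<open>D\<close> is never
  compared as a whole with a double centraliser over K or over A / \<mm>. All that is used is a map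
  from \<open>D\<close> to the double centraliser of P_F. It exists because surjectivity of
  \<open>Psi\<close> makes every endomorphism of P_F a reduction, so that commuting with
  endomorphisms of P is enough. P_K is not formed either: linear algebra over K is carried out
  inside R and P with denominators, and left ideals of K \<otimes> R are replaced by their
  contractions to R. The multiplier \<open>a\<close> has to work for all of \<open>D\<close> at
  once, so it is taken from a projection that is built before any \<sigma> is chosen. Since \<mm>
  need not be principal, division by a uniformiser is replaced by multiplication with a fraction
  that carries \<mm> into A but not into \<mm>. The statement on permutation modules is proved
  directly with integer matrices. This avoids verifying the standard hypotheses for the module and
  identifying a tensor product with the permutation module modulo p; positivity of sums of squares
  takes the place of semisimplicity of the rational group ring.\<close>

section \<open>Noetherian and Dedekind domains\<close>

text \<open>A colon ideal \<open>(J : b)\<close> that is maximal among those avoiding the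
  multiplicative set \<open>T\<close> is prime. With \<open>T = {1}\<close> this gives an associated
  prime of the quotient by \<open>J\<close>; with \<open>T\<close> the complement of a maximal ideal
  the prime stays inside that ideal. Both choices occur later.\<close>

lemma (in noetherian_domain) prime_colon_ideal:
  assumes J: "ideal J R" and T: "T \<subseteq> carrier R" "\<one> \<in> T" "\<And>s t. \<lbrakk>s \<in> T; t \<in> T\<rbrakk> \<Longrightarrow> s \<otimes> t \<in> T"
    and disj: "J \<inter> T = {}"
  obtains b where "b \<in> carrier R" "primeideal {c \<in> carrier R. c \<otimes> b \<in> J} R"
    "{c \<in> carrier R. c \<otimes> b \<in> J} \<inter> T = {}"
proof -
  interpret J: ideal J R by fact
  define Q where "Q b = {c \<in> carrier R. c \<otimes> b \<in> J}" for b
  have id: "ideal (Q b) R" if "b \<in> carrier R" for b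
  proof (rule idealI)
    show "subgroup (Q b) (add_monoid R)"
      using that by (intro add.subgroupI) (auto simp: Q_def l_distr l_minus)
      show r: "ring R" ..
    fix a x assume "a \<in> Q b" "x \<in> carrier R"
    then show "x \<otimes> a \<in> Q b" "a \<otimes> x \<in> Q b"
      using that by (auto simp: Q_def m_assoc J.I_l_closed m_comm[of a x])
  qed
  let ?F = "{Q b | b. b \<in> carrier R \<and> Q b \<inter> T = {}}"
  have "\<exists>M\<in>?F. \<forall>X\<in>?F. M \<subseteq> X \<longrightarrow> X = M"
  proof (rule subset_Zorn_nonempty)
    have "Q \<one> = J" using J.a_subset by (auto simp: Q_def)
    then show "?F \<noteq> {}" using disj by blast
    fix C assume C: "C \<noteq> {}" "subset.chain ?F C"
    have "subset.chain {I. ideal I R} C"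
      using C(2) id unfolding subset_chain_def by blast
    then have "\<Union>C \<in> C" using ideal_chain_is_trivial[OF C(1)] by blast
    then show "\<Union>C \<in> ?F" using C(2) unfolding subset_chain_def by blast
  qed
  then obtain M where M: "M \<in> ?F" "\<forall>X\<in>?F. M \<subseteq> X \<longrightarrow> X = M" by (rule bexE)
  then obtain b where b: "b \<in> carrier R" "Q b \<inter> T = {}" and Mb: "M = Q b" by auto
  have max: "Q c = Q b" if "c \<in> carrier R" "Q c \<inter> T = {}" "Q b \<subseteq> Q c" for c
    using M(2)[rule_format, of "Q c"] that unfolding Mb by auto
  \<comment> \<open>\<open>(J : u b)\<close> contains \<open>(J : b)\<close> and also
    \<open>v\<close>, so it is strictly larger and by maximality must meet \<open>T\<close>.\<close>
  have up: "\<exists>t \<in> T. t \<otimes> (u \<otimes> b) \<in> J" if u: "u \<in> carrier R" and v: "v \<in> carrier R" "v \<notin> Q b" "v \<otimes> (u \<otimes> b) \<in> J" for u v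
  proof (rule ccontr)
    assume neg: "\<not> ?thesis"
    then have "Q (u \<otimes> b) \<inter> T = {}" by (auto simp: Q_def)
    moreover have "Q b \<subseteq> Q (u \<otimes> b)"
    proof
      fix x assume "x \<in> Q b"
      then have "x \<in> carrier R" "u \<otimes> (x \<otimes> b) \<in> J" using u J.I_l_closed by (simp_all add: Q_def)
      then show "x \<in> Q (u \<otimes> b)" using u b by (simp add: Q_def m_lcomm)
    qed
    ultimately have "Q (u \<otimes> b) = Q b" using max u b by simp
    then show False using v by (auto simp: Q_def)
  qed
  have "primeideal (Q b) R"
  proof (rule primeidealI)
    show "ideal (Q b) R" using id b by simp
    show "cring R" ..
    show "carrier R \<noteq> Q b" using b(2) T by auto
    fix u v assume uv: "u \<in> carrier R" "v \<in> carrier R" "u \<otimes> v \<in> Q b"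
    show "u \<in> Q b \<or> v \<in> Q b"
    \<comment> \<open>Maximality is used twice. First \<open>v\<close> yields \<open>t\<close> in
      \<open>T\<close> with \<open>t u b\<close> in \<open>J\<close>; then \<open>u\<close>, which
      now multiplies \<open>t b\<close> into \<open>J\<close>, yields \<open>t'\<close>. The product
      \<open>t' t\<close> lies both in \<open>T\<close> and in the colon ideal.\<close>
    proof (rule ccontr)
      assume n: "\<not> ?thesis"
      have "v \<otimes> (u \<otimes> b) \<in> J" using uv b by (simp add: Q_def m_assoc m_lcomm)
      then obtain t where t: "t \<in> T" "t \<otimes> (u \<otimes> b) \<in> J" using up[of u v] uv n by blast
      have tR: "t \<in> carrier R" using t T by auto
      have "u \<otimes> (t \<otimes> b) \<in> J" using t uv b tR by (simp add: m_lcomm)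
      then obtain t' where t': "t' \<in> T" "t' \<otimes> (t \<otimes> b) \<in> J" using up[of t u] uv n tR by blast
      have "t' \<otimes> t \<in> Q b" using t' T(1) tR b by (auto simp: Q_def m_assoc)
      then show False using b(2) T(3)[OF t'(1) t(1)] by blast
    qed
  qed
  then show ?thesis using that b by (simp add: Q_def)
qed

text \<open>Operations on fractions are unions over all representatives; once the class is known not
  to depend on them, the union collapses.\<close>

lemma UN_pair_const:
  assumes "(a, b) \<in> X" "(c, d) \<in> Y"
    and "\<And>a b c d. \<lbrakk>(a, b) \<in> X; (c, d) \<in> Y\<rbrakk> \<Longrightarrow> F a b c d = Z"
  shows "(\<Union>(a, b)\<in>X. \<Union>(c, d)\<in>Y. F a b c d) = Z"
  using assms by fastforce

lemma UN_pair_const1: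
  assumes "(a, b) \<in> X" and "\<And>a b. (a, b) \<in> X \<Longrightarrow> F a b = Z"
  shows "(\<Union>(a, b)\<in>X. F a b) = Z"
  using assms by fastforce

section \<open>The field of fractions of a domain\<close>

context domain
begin

abbreviation Frac where "Frac \<equiv> fraction_field R"

lemma fraction_eq_iff:
  assumes "a \<in> carrier R" "b \<in> carrier R - {\<zero>}" "c \<in> carrier R" "d \<in> carrier R - {\<zero>}"
  shows "fraction R a b = fraction R c d \<longleftrightarrow> a \<otimes> d = c \<otimes> b"
proof
  assume "fraction R a b = fraction R c d"
  moreover have "(c, d) \<in> fraction R c d" using assms by (simp add: fraction_def)
  ultimately have "(c, d) \<in> fraction R a b" by simp
  then show "a \<otimes> d = c \<otimes> b" by (simp add: fraction_def)
next
  have *: "fraction R a b \<subseteq> fraction R c d"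
    if h: "a \<in> carrier R" "b \<in> carrier R - {\<zero>}" "c \<in> carrier R" "d \<in> carrier R - {\<zero>}" "a \<otimes> d = c \<otimes> b" for a b c d
  proof
    fix z assume "z \<in> fraction R a b"
    then obtain e f where z: "z = (e, f)" "e \<in> carrier R" "f \<in> carrier R - {\<zero>}" "a \<otimes> f = e \<otimes> b"
      by (auto simp: fraction_def)
    \<comment> \<open>Transitivity of cross-multiplication: both sides are compared after
      multiplication by \<open>b\<close>, which is cancelled at the end.\<close>
    have "b \<otimes> (c \<otimes> f) = (c \<otimes> b) \<otimes> f" using h z by (simp add: m_ac)
    also have "\<dots> = (a \<otimes> d) \<otimes> f" using h(5) by simp
    also have "\<dots> = (a \<otimes> f) \<otimes> d" using h(1-4) z(2,3) by (simp add: m_ac)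
    also have "\<dots> = (e \<otimes> b) \<otimes> d" using z(4) by simp
    also have "\<dots> = b \<otimes> (e \<otimes> d)" using h(1-4) z(2,3) by (simp add: m_ac)
    finally have "c \<otimes> f = e \<otimes> d" using h z by (subst (asm) m_lcancel) auto
    then show "z \<in> fraction R c d" using z by (simp add: fraction_def)
  qed
  assume "a \<otimes> d = c \<otimes> b"
  then show "fraction R a b = fraction R c d" using *[of a b c d] *[of c d a b] assms by auto
qed

lemma fraction_eqI:
  assumes "a \<in> carrier R" "b \<in> carrier R" "b \<noteq> \<zero>" "c \<in> carrier R" "d \<in> carrier R" "d \<noteq> \<zero>" "a \<otimes> d = c \<otimes> b"
  shows "fraction R a b = fraction R c d"
  using assms fraction_eq_iff by auto

lemma fraction_mem: "(c, d) \<in> fraction R a b \<Longrightarrow> c \<in> carrier R \<and> d \<in> carrier R - {\<zero>} \<and> a \<otimes> d = c \<otimes> b"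
  by (simp add: fraction_def)

lemma fraction_self: "\<lbrakk>a \<in> carrier R; b \<in> carrier R - {\<zero>}\<rbrakk> \<Longrightarrow> (a, b) \<in> fraction R a b"
  by (simp add: fraction_def)

lemma nz_mult: "\<lbrakk>b \<in> carrier R - {\<zero>}; d \<in> carrier R - {\<zero>}\<rbrakk> \<Longrightarrow> b \<otimes> d \<in> carrier R - {\<zero>}"
  using integral by auto

lemma fraction_mult:
  assumes "a \<in> carrier R" "b \<in> carrier R - {\<zero>}" "c \<in> carrier R" "d \<in> carrier R - {\<zero>}"
  shows "fraction R a b \<otimes>\<^bsub>Frac\<^esub> fraction R c d = fraction R (a \<otimes> c) (b \<otimes> d)"
proof -
  have *: "fraction R (a' \<otimes> c') (b' \<otimes> d') = fraction R (a \<otimes> c) (b \<otimes> d)"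
    if "(a', b') \<in> fraction R a b" "(c', d') \<in> fraction R c d" for a' b' c' d'
  proof -
    note h = fraction_mem[OF that(1)] fraction_mem[OF that(2)]
    have "(a' \<otimes> c') \<otimes> (b \<otimes> d) = (a' \<otimes> b) \<otimes> (c' \<otimes> d)" using assms h[THEN conjunct1] h[THEN conjunct2, THEN conjunct1] by (simp add: m_ac)
    also have "\<dots> = (a \<otimes> b') \<otimes> (c \<otimes> d')" using h by simp
    also have "\<dots> = (a \<otimes> c) \<otimes> (b' \<otimes> d')" using assms h[THEN conjunct1] h[THEN conjunct2, THEN conjunct1] by (simp add: m_ac)
    finally show ?thesis using h assms by (intro fraction_eqI) (simp_all add: integral_iff)
  qed
  show ?thesis
    unfolding fraction_field_def ring_record_simps monoid.simps
    by (rule UN_pair_const[OF fraction_self[OF assms(1,2)] fraction_self[OF assms(3,4)] *])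
qed

lemma fraction_add:
  assumes "a \<in> carrier R" "b \<in> carrier R - {\<zero>}" "c \<in> carrier R" "d \<in> carrier R - {\<zero>}"
  shows "fraction R a b \<oplus>\<^bsub>Frac\<^esub> fraction R c d = fraction R (a \<otimes> d \<oplus> c \<otimes> b) (b \<otimes> d)"
proof -
  have *: "fraction R (a' \<otimes> d' \<oplus> c' \<otimes> b') (b' \<otimes> d') = fraction R (a \<otimes> d \<oplus> c \<otimes> b) (b \<otimes> d)"
    if "(a', b') \<in> fraction R a b" "(c', d') \<in> fraction R c d" for a' b' c' d'
  proof -
    note h = fraction_mem[OF that(1)] fraction_mem[OF that(2)]
    have "(a' \<otimes> d' \<oplus> c' \<otimes> b') \<otimes> (b \<otimes> d) = (a' \<otimes> b) \<otimes> (d \<otimes> d') \<oplus> (c' \<otimes> d) \<otimes> (b \<otimes> b')"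
      using assms h[THEN conjunct1] h[THEN conjunct2, THEN conjunct1] by (simp add: m_ac l_distr r_distr)
    also have "\<dots> = (a \<otimes> b') \<otimes> (d \<otimes> d') \<oplus> (c \<otimes> d') \<otimes> (b \<otimes> b')" using h by simp
    also have "\<dots> = (a \<otimes> d \<oplus> c \<otimes> b) \<otimes> (b' \<otimes> d')" using assms h[THEN conjunct1] h[THEN conjunct2, THEN conjunct1] by (simp add: m_ac l_distr r_distr)
    finally show ?thesis using h assms by (intro fraction_eqI) (simp_all add: integral_iff)
  qed
  show ?thesis
    unfolding fraction_field_def ring_record_simps monoid.simps
    by (rule UN_pair_const[OF fraction_self[OF assms(1,2)] fraction_self[OF assms(3,4)] *])
qed

lemma fraction_smult:
  assumes "a \<in> carrier R" "b \<in> carrier R - {\<zero>}" "c \<in> carrier R"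
  shows "c \<odot>\<^bsub>Frac\<^esub> fraction R a b = fraction R (c \<otimes> a) b"
proof -
  have *: "fraction R (c \<otimes> a') b' = fraction R (c \<otimes> a) b" if "(a', b') \<in> fraction R a b" for a' b'
  proof (rule fraction_eqI)
    note h = fraction_mem[OF that]
    have "(c \<otimes> a') \<otimes> b = c \<otimes> (a' \<otimes> b)" using assms h[THEN conjunct1] h[THEN conjunct2, THEN conjunct1] by (simp add: m_assoc)
    also have "\<dots> = c \<otimes> (a \<otimes> b')" using h by simp
    also have "\<dots> = (c \<otimes> a) \<otimes> b'" using assms h[THEN conjunct1] h[THEN conjunct2, THEN conjunct1] by (simp add: m_assoc)
    finally show "(c \<otimes> a') \<otimes> b = (c \<otimes> a) \<otimes> b'" .
  qed (use fraction_mem[OF that] assms in auto)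
  have "(\<Union>(a', b')\<in>fraction R a b. fraction R (c \<otimes> a') b') = fraction R (c \<otimes> a) b"
    by (rule UN_pair_const1[OF fraction_self[OF assms(1,2)] *])
  then show ?thesis by (simp add: fraction_field_def)
qed

lemma fraction_closed: "\<lbrakk>a \<in> carrier R; b \<in> carrier R - {\<zero>}\<rbrakk> \<Longrightarrow> fraction R a b \<in> carrier Frac"
  by (auto simp: fraction_field_def)

lemma fraction_carrierE:
  assumes "x \<in> carrier Frac"
  obtains a b where "a \<in> carrier R" "b \<in> carrier R" "b \<noteq> \<zero>" "x = fraction R a b"
  using assms by (auto simp: fraction_field_def)

lemma fraction_zero: "\<zero>\<^bsub>Frac\<^esub> = fraction R \<zero> \<one>" and fraction_one: "\<one>\<^bsub>Frac\<^esub> = fraction R \<one> \<one>"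
  by (simp_all add: fraction_field_def)

lemma cring_fraction_field: "cring Frac"
proof (rule cringI)
  note simps = fraction_add fraction_mult fraction_zero fraction_one fraction_closed nz_mult integral_iff
  show "abelian_group Frac"
  proof (rule abelian_groupI)
    fix x y assume "x \<in> carrier Frac" "y \<in> carrier Frac"
    then obtain a b c d where x: "a \<in> carrier R" "b \<in> carrier R" "b \<noteq> \<zero>" "x = fraction R a b"
      and y: "c \<in> carrier R" "d \<in> carrier R" "d \<noteq> \<zero>" "y = fraction R c d"
      by (metis fraction_carrierE)
    show "x \<oplus>\<^bsub>Frac\<^esub> y \<in> carrier Frac" using x y by (simp add: simps)
    show "x \<oplus>\<^bsub>Frac\<^esub> y = y \<oplus>\<^bsub>Frac\<^esub> x" using x y by (simp add: simps m_comm a_comm)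
    show "\<zero>\<^bsub>Frac\<^esub> \<oplus>\<^bsub>Frac\<^esub> x = x" using x by (simp add: simps)
    show "\<exists>y\<in>carrier Frac. y \<oplus>\<^bsub>Frac\<^esub> x = \<zero>\<^bsub>Frac\<^esub>"
    proof
      show "fraction R (\<ominus> a) b \<in> carrier Frac" using x by (simp add: simps)
      show "fraction R (\<ominus> a) b \<oplus>\<^bsub>Frac\<^esub> x = \<zero>\<^bsub>Frac\<^esub>"
        using x by (simp add: simps l_minus l_neg) (rule fraction_eqI, simp_all add: integral_iff)
    qed
    fix z assume "z \<in> carrier Frac"
    then obtain e f where z: "e \<in> carrier R" "f \<in> carrier R" "f \<noteq> \<zero>" "z = fraction R e f"
      by (rule fraction_carrierE)
    have "(a \<otimes> d \<oplus> c \<otimes> b) \<otimes> f \<oplus> e \<otimes> (b \<otimes> d) = a \<otimes> (d \<otimes> f) \<oplus> (c \<otimes> f \<oplus> e \<otimes> d) \<otimes> b"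
      using x(1,2) y(1,2) z(1,2) by (simp add: l_distr r_distr m_ac a_ac)
    then show "(x \<oplus>\<^bsub>Frac\<^esub> y) \<oplus>\<^bsub>Frac\<^esub> z = x \<oplus>\<^bsub>Frac\<^esub> (y \<oplus>\<^bsub>Frac\<^esub> z)"
      using x y z by (simp add: simps m_assoc)
  qed (simp add: fraction_zero fraction_closed)
  show "Group.comm_monoid Frac"
  proof (rule comm_monoidI)
    fix x y assume "x \<in> carrier Frac" "y \<in> carrier Frac"
    then obtain a b c d where x: "a \<in> carrier R" "b \<in> carrier R" "b \<noteq> \<zero>" "x = fraction R a b"
      and y: "c \<in> carrier R" "d \<in> carrier R" "d \<noteq> \<zero>" "y = fraction R c d"
      by (metis fraction_carrierE)
    show "x \<otimes>\<^bsub>Frac\<^esub> y \<in> carrier Frac" using x y by (simp add: simps)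
    show "x \<otimes>\<^bsub>Frac\<^esub> y = y \<otimes>\<^bsub>Frac\<^esub> x" using x y by (simp add: simps m_comm)
    show "\<one>\<^bsub>Frac\<^esub> \<otimes>\<^bsub>Frac\<^esub> x = x" using x by (simp add: simps)
    fix z assume "z \<in> carrier Frac"
    then obtain e f where z: "e \<in> carrier R" "f \<in> carrier R" "f \<noteq> \<zero>" "z = fraction R e f"
      by (rule fraction_carrierE)
    show "(x \<otimes>\<^bsub>Frac\<^esub> y) \<otimes>\<^bsub>Frac\<^esub> z = x \<otimes>\<^bsub>Frac\<^esub> (y \<otimes>\<^bsub>Frac\<^esub> z)"
      using x y z by (simp add: simps m_assoc)
  qed (simp add: fraction_one fraction_closed)
  fix x y z assume "x \<in> carrier Frac" "y \<in> carrier Frac" "z \<in> carrier Frac"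
  then obtain a b c d e f where x: "a \<in> carrier R" "b \<in> carrier R" "b \<noteq> \<zero>" "x = fraction R a b"
    and y: "c \<in> carrier R" "d \<in> carrier R" "d \<noteq> \<zero>" "y = fraction R c d"
    and z: "e \<in> carrier R" "f \<in> carrier R" "f \<noteq> \<zero>" "z = fraction R e f"
    by (metis fraction_carrierE)
  \<comment> \<open>The two sides carry the denominators \<open>b d f\<close> and
    \<open>b f (d f)\<close>, so distributivity holds for the classes of the fractions and not for
    the numerators.\<close>
  have "fraction R ((a \<otimes> d \<oplus> c \<otimes> b) \<otimes> e) (b \<otimes> d \<otimes> f)
      = fraction R (a \<otimes> e \<otimes> (d \<otimes> f) \<oplus> c \<otimes> e \<otimes> (b \<otimes> f)) (b \<otimes> f \<otimes> (d \<otimes> f))"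
  proof (rule fraction_eqI)
    show "(a \<otimes> d \<oplus> c \<otimes> b) \<otimes> e \<otimes> (b \<otimes> f \<otimes> (d \<otimes> f)) = (a \<otimes> e \<otimes> (d \<otimes> f) \<oplus> c \<otimes> e \<otimes> (b \<otimes> f)) \<otimes> (b \<otimes> d \<otimes> f)"
      using x(1,2) y(1,2) z(1,2) by (simp add: l_distr r_distr m_ac)
  qed (use x y z in \<open>simp_all add: integral_iff\<close>)
  then show "(x \<oplus>\<^bsub>Frac\<^esub> y) \<otimes>\<^bsub>Frac\<^esub> z = x \<otimes>\<^bsub>Frac\<^esub> z \<oplus>\<^bsub>Frac\<^esub> y \<otimes>\<^bsub>Frac\<^esub> z"
    using x y z by (simp add: simps)
qed

lemma module_fraction_field: "module R Frac"
proof (rule moduleI)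
  interpret K: cring Frac by (rule cring_fraction_field)
  show "abelian_group Frac" ..
  show "cring R" ..
  note simps = fraction_add fraction_smult fraction_one fraction_closed integral_iff
  show "\<one> \<odot>\<^bsub>Frac\<^esub> x = x" if "x \<in> carrier Frac" for x
    using that by (auto elim!: fraction_carrierE simp: simps)
  fix r s x y assume r: "r \<in> carrier R" and "x \<in> carrier Frac"
  then obtain a b where x: "a \<in> carrier R" "b \<in> carrier R" "b \<noteq> \<zero>" "x = fraction R a b"
    by (metis fraction_carrierE)
  show "r \<odot>\<^bsub>Frac\<^esub> x \<in> carrier Frac" using r x by (simp add: simps)
  { assume s: "s \<in> carrier R"
    show "r \<otimes> s \<odot>\<^bsub>Frac\<^esub> x = r \<odot>\<^bsub>Frac\<^esub> (s \<odot>\<^bsub>Frac\<^esub> x)" using r s x by (simp add: simps m_assoc)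
    have "fraction R ((r \<oplus> s) \<otimes> a) b = fraction R (r \<otimes> a \<otimes> b \<oplus> s \<otimes> a \<otimes> b) (b \<otimes> b)"
    proof (rule fraction_eqI)
      show "(r \<oplus> s) \<otimes> a \<otimes> (b \<otimes> b) = (r \<otimes> a \<otimes> b \<oplus> s \<otimes> a \<otimes> b) \<otimes> b"
        using r s x(1,2) by (simp add: l_distr r_distr m_ac)
    qed (use r s x in \<open>simp_all add: integral_iff\<close>)
    then show "(r \<oplus> s) \<odot>\<^bsub>Frac\<^esub> x = r \<odot>\<^bsub>Frac\<^esub> x \<oplus>\<^bsub>Frac\<^esub> s \<odot>\<^bsub>Frac\<^esub> x"
      using r s x by (simp add: simps) }
  assume "y \<in> carrier Frac"
  then obtain c d where y: "c \<in> carrier R" "d \<in> carrier R" "d \<noteq> \<zero>" "y = fraction R c d"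
    by (rule fraction_carrierE)
  have "r \<otimes> (a \<otimes> d \<oplus> c \<otimes> b) = r \<otimes> a \<otimes> d \<oplus> r \<otimes> c \<otimes> b"
    using r x y by (simp add: r_distr m_assoc)
  then show "r \<odot>\<^bsub>Frac\<^esub> (x \<oplus>\<^bsub>Frac\<^esub> y) = r \<odot>\<^bsub>Frac\<^esub> x \<oplus>\<^bsub>Frac\<^esub> r \<odot>\<^bsub>Frac\<^esub> y"
    using r x y by (simp add: simps)
qed

text \<open>The general rule for addition produces the denominator \<open>a\<close> squared;
  cancelling one factor allows whole sums to be taken over the denominator \<open>a\<close>, as the
  integral equation of b/a requires.\<close>

lemma fraction_add_same:
  assumes "x \<in> carrier R" "y \<in> carrier R" "a \<in> carrier R" "a \<noteq> \<zero>"
  shows "fraction R x a \<oplus>\<^bsub>Frac\<^esub> fraction R y a = fraction R (x \<oplus> y) a"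
proof -
  have "fraction R (x \<otimes> a \<oplus> y \<otimes> a) (a \<otimes> a) = fraction R (x \<oplus> y) a"
  proof (rule fraction_eqI)
    show "(x \<otimes> a \<oplus> y \<otimes> a) \<otimes> a = (x \<oplus> y) \<otimes> (a \<otimes> a)" using assms by (simp add: l_distr m_assoc)
  qed (use assms in \<open>simp_all add: integral_iff\<close>)
  then show ?thesis using assms by (simp add: fraction_add)
qed

lemma fraction_finsum:
  assumes "finite I" "f \<in> I \<rightarrow> carrier R" "a \<in> carrier R" "a \<noteq> \<zero>"
  shows "(\<Oplus>\<^bsub>Frac\<^esub>i\<in>I. fraction R (f i) a) = fraction R (\<Oplus>i\<in>I. f i) a"
  using assms(1,2)
proof (induction I)
  interpret K: cring Frac by (rule cring_fraction_field)
  case empty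
  then show ?case using assms by (simp add: fraction_zero) (rule fraction_eqI, simp_all)
next
  interpret K: cring Frac by (rule cring_fraction_field)
  case (insert i I)
  have "(\<lambda>i. fraction R (f i) a) \<in> I \<rightarrow> carrier Frac" "fraction R (f i) a \<in> carrier Frac"
    using insert assms by (auto intro!: fraction_closed)
  then show ?case using insert assms by (simp add: fraction_add_same)
qed

text \<open>The ideal generated by the first \<open>n\<close> terms of \<open>z\<close>. The
  coefficient functions live on \<open>{..<n}\<close> because membership is to supply the
  coefficients of an integral equation in the shape that \<open>integrally_closed\<close>
  uses.\<close>

lemma finite_combinations_ideal:
  assumes z: "\<And>i. i < (n::nat) \<Longrightarrow> z i \<in> carrier R"
  shows "ideal {\<Oplus>i\<in>{..<n}. c i \<otimes> z i | c. c \<in> {..<n} \<rightarrow> carrier R} R" (is "ideal ?I R")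
proof -
  have sm: "x \<otimes> u \<in> ?I" if "u \<in> ?I" and x: "x \<in> carrier R" for u x
  proof -
    obtain c where c: "c \<in> {..<n} \<rightarrow> carrier R" "u = (\<Oplus>i\<in>{..<n}. c i \<otimes> z i)" using \<open>u \<in> ?I\<close> by blast
    have "x \<otimes> u = (\<Oplus>i\<in>{..<n}. (x \<otimes> c i) \<otimes> z i)"
      unfolding c(2) using c(1) z x
      by (subst finsum_rdistr) (auto simp: Pi_iff m_assoc intro!: finsum_cong')
    then show ?thesis using c x by (auto intro!: exI[of _ "\<lambda>i. x \<otimes> c i"])
  qed
  have sub: "?I \<subseteq> carrier R" using z by (auto intro!: finsum_closed)
  show ?thesis
  proof (rule idealI)
    show "subgroup ?I (add_monoid R)"
    proof (rule add.subgroupI)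
      show "?I \<noteq> {}" by blast
      fix u assume u: "u \<in> ?I"
      have "u \<in> carrier R" using u sub by blast
      then have "\<ominus> u = (\<ominus> \<one>) \<otimes> u" by (simp add: l_minus)
      then show "\<ominus> u \<in> ?I" using sm[OF u, of "\<ominus> \<one>"] by simp
      fix v assume v: "v \<in> ?I"
      obtain c d where c: "c \<in> {..<n} \<rightarrow> carrier R" "u = (\<Oplus>i\<in>{..<n}. c i \<otimes> z i)"
        and d: "d \<in> {..<n} \<rightarrow> carrier R" "v = (\<Oplus>i\<in>{..<n}. d i \<otimes> z i)" using u v by blast
      have "u \<oplus> v = (\<Oplus>i\<in>{..<n}. c i \<otimes> z i \<oplus> d i \<otimes> z i)"
        unfolding c(2) d(2) using c(1) d(1) z by (subst finsum_addf) auto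
      also have "\<dots> = (\<Oplus>i\<in>{..<n}. (c i \<oplus> d i) \<otimes> z i)"
        using c(1) d(1) z by (intro finsum_cong') (auto simp: Pi_iff l_distr)
      finally show "u \<oplus> v \<in> ?I"
        using c(1) d(1) by (auto intro!: exI[of _ "\<lambda>i. c i \<oplus> d i"])
    qed (use sub in simp)
    show "ring R" ..
    fix u x assume u: "u \<in> ?I" and x: "x \<in> carrier R"
    show "x \<otimes> u \<in> ?I" using sm[OF u x] .
    moreover have "u \<in> carrier R" using u sub by blast
    ultimately show "u \<otimes> x \<in> ?I" using x m_comm by simp
  qed
qed

end

text \<open>The ideals generated by initial segments of \<open>z\<close> form a chain, whose union
  is one of them, say the one of length \<open>n\<close>; this ideal already contains the next term
  \<open>z n\<close>.\<close>

lemma (in noetherian_domain) stationary_sequence: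
  assumes z: "\<And>i::nat. z i \<in> carrier R"
  obtains n c where "c \<in> {..<n} \<rightarrow> carrier R" "z n = (\<Oplus>i\<in>{..<n}. c i \<otimes> z i)"
proof -
  define I where "I n = {\<Oplus>i\<in>{..<n}. c i \<otimes> z i | c. c \<in> {..<n} \<rightarrow> carrier R}" for n
  have id: "ideal (I n) R" for n unfolding I_def by (rule finite_combinations_ideal) (rule z)
  have step: "I n \<subseteq> I (Suc n)" for n
  proof
    fix u assume "u \<in> I n"
    then obtain c where c: "c \<in> {..<n} \<rightarrow> carrier R" "u = (\<Oplus>i\<in>{..<n}. c i \<otimes> z i)" by (auto simp: I_def)
    define d where "d i = (if i < n then c i else \<zero>)" for i
    have "(\<Oplus>i\<in>{..<Suc n}. d i \<otimes> z i) = (\<Oplus>i\<in>{..<n}. d i \<otimes> z i)"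
      using c z by (simp add: lessThan_Suc) (simp add: d_def Pi_iff)
    also have "\<dots> = u" unfolding c(2) by (rule finsum_cong') (use c z in \<open>auto simp: d_def\<close>)
    finally show "u \<in> I (Suc n)" using c unfolding I_def by (auto simp: d_def intro!: exI[of _ d])
  qed
  have mono: "I m \<subseteq> I n" if "m \<le> n" for m n using that step by (rule lift_Suc_mono_le[rotated])
  have mem: "z n \<in> I (Suc n)" for n
  proof -
    define d where "d i = (if i < n then \<zero> else \<one>)" for i
    have "(\<Oplus>i\<in>{..<Suc n}. d i \<otimes> z i) = z n \<oplus> (\<Oplus>i\<in>{..<n}. d i \<otimes> z i)"
      using z by (simp add: lessThan_Suc) (simp add: d_def Pi_iff)
    also have "(\<Oplus>i\<in>{..<n}. d i \<otimes> z i) = \<zero>" using z by (intro add.finprod_one_eqI) (auto simp: d_def)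
    finally show ?thesis using z unfolding I_def by (auto simp: d_def intro!: exI[of _ d])
  qed
  have "subset.chain {I. ideal I R} (range I)"
    using id mono by (auto simp: subset_chain_def) (metis nat_le_linear subsetD)
  then have "\<Union>(range I) \<in> range I" using ideal_chain_is_trivial[of "range I"] by blast
  then obtain n where "\<Union>(range I) = I n" by blast
  then have "z n \<in> I n" using mem[of n] by blast
  then show ?thesis using that unfolding I_def by blast
qed

text \<open>
  A maximal element among the ideals \<open>(aR : b)\<close> avoiding the complement of \<open>\<mm>\<close> is \<open>\<mm>\<close> itself, which
  gives \<open>(b/a)\<mm> \<subseteq> R\<close>. If moreover \<open>(b/a)\<mm> \<subseteq> \<mm>\<close>, then the ideals generated by
  \<open>a, a(b/a), \<dots>, a(b/a)\<^sup>n\<close> become stationary, so \<open>b/a\<close> is integral, hence lies in \<open>R\<close>.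
\<close>

lemma (in noetherian_domain) maximal_ideal_invertible:
  assumes ic: "integrally_closed R"
    and dim1: "\<And>I. \<lbrakk>primeideal I R; I \<noteq> {\<zero>}\<rbrakk> \<Longrightarrow> maximalideal I R"
    and max: "maximalideal \<mm> R" and nz: "\<mm> \<noteq> {\<zero>}"
  obtains a b x y where "a \<in> carrier R" "a \<noteq> \<zero>" "b \<in> carrier R" "x \<in> \<mm>" "y \<in> carrier R" "y \<notin> \<mm>"
    "b \<otimes> x = a \<otimes> y" "\<And>z. z \<in> \<mm> \<Longrightarrow> \<exists>w\<in>carrier R. b \<otimes> z = a \<otimes> w"
proof -
  interpret m: maximalideal \<mm> R by fact
  interpret mp: primeideal \<mm> R by (rule maximalideal_prime) (rule max)
  obtain a where a: "a \<in> \<mm>" "a \<noteq> \<zero>" using nz m.zero_closed by blast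
  have aR: "a \<in> carrier R" using a m.a_subset by blast
  have one: "\<one> \<notin> \<mm>" using m.one_imp_carrier m.I_notcarr by blast
  have aPIdl: "PIdl a \<subseteq> \<mm>" using a m.I_l_closed by (auto simp: cgenideal_def)
  \<comment> \<open>Avoiding the complement of \<mm> keeps the colon ideal inside \<mm>. It contains
    \<open>a\<close>, so it is a nonzero prime, hence maximal, hence equal to \<mm>.\<close>
  obtain b where b: "b \<in> carrier R" and pr: "primeideal {c \<in> carrier R. c \<otimes> b \<in> PIdl a} R"
    and dj: "{c \<in> carrier R. c \<otimes> b \<in> PIdl a} \<inter> (carrier R - \<mm>) = {}"
  proof (rule prime_colon_ideal[of "PIdl a" "carrier R - \<mm>"])
    show "ideal (PIdl a) R" by (rule cgenideal_ideal[OF aR])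
    show "s \<otimes> t \<in> carrier R - \<mm>" if "s \<in> carrier R - \<mm>" "t \<in> carrier R - \<mm>" for s t
      using that mp.I_prime by auto
  qed (use one aPIdl in auto)
  define Q where "Q = {c \<in> carrier R. c \<otimes> b \<in> PIdl a}"
  have "a \<in> Q" using aR b m_comm[OF aR b] by (auto simp: Q_def cgenideal_def)
  then have "Q \<noteq> {\<zero>}" using a by blast
  with pr[folded Q_def] have Qmax: "maximalideal Q R" by (rule dim1)
  have "Q \<subseteq> \<mm>" using dj unfolding Q_def by blast
  then have Qm: "Q = \<mm>" using maximalideal.I_maximal[OF Qmax m.is_ideal] m.a_subset m.I_notcarr by blast
  have div: "\<exists>w\<in>carrier R. b \<otimes> z = a \<otimes> w" if "z \<in> \<mm>" for z
  proof -
    have "z \<in> Q" using that Qm by simp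
    then obtain w where w: "w \<in> carrier R" "z \<otimes> b = w \<otimes> a" unfolding Q_def cgenideal_def by blast
    then have "b \<otimes> z = a \<otimes> w" using b aR that m.a_subset m_comm[of b z] m_comm[of a w] by auto
    with w(1) show ?thesis by blast
  qed
  show ?thesis
  proof (cases "\<exists>x\<in>\<mm>. \<exists>y\<in>carrier R. y \<notin> \<mm> \<and> b \<otimes> x = a \<otimes> y")
    case True
    then obtain x y where xy: "x \<in> \<mm>" "y \<in> carrier R" "y \<notin> \<mm>" "b \<otimes> x = a \<otimes> y" by (elim bexE conjE)
    show ?thesis by (rule that[OF aR a(2) b xy div])
  next
    case False
    \<comment> \<open>In this case multiplication by b/a maps \<mm> into itself; \<open>f\<close>
      realises it as a function on ring elements.\<close>
    have "\<forall>z\<in>\<mm>. \<exists>w. w \<in> \<mm> \<and> b \<otimes> z = a \<otimes> w"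
    proof
      fix z assume z: "z \<in> \<mm>"
      then obtain w where "w \<in> carrier R" "b \<otimes> z = a \<otimes> w" using div[OF z] by (elim bexE)
      moreover have "w \<in> \<mm>"
      proof (rule ccontr)
        assume "w \<notin> \<mm>"
        then have "\<exists>x\<in>\<mm>. \<exists>y\<in>carrier R. y \<notin> \<mm> \<and> b \<otimes> x = a \<otimes> y"
          using z calculation by (intro bexI[of _ z] bexI[of _ w]) simp_all
        with False show False by (rule notE)
      qed
      ultimately show "\<exists>w. w \<in> \<mm> \<and> b \<otimes> z = a \<otimes> w" by (intro exI[of _ w]) simp
    qed
    from bchoice[OF this] obtain f where "\<forall>z\<in>\<mm>. f z \<in> \<mm> \<and> b \<otimes> z = a \<otimes> f z" by (rule exE)
    then have f: "\<And>z. z \<in> \<mm> \<Longrightarrow> f z \<in> \<mm>" "\<And>z. z \<in> \<mm> \<Longrightarrow> b \<otimes> z = a \<otimes> f z" by simp_all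
    \<comment> \<open>\<open>z i\<close> is \<open>a\<close> times the i-th power of b/a. Starting
      from \<open>a\<close> makes each power equal to \<open>z i\<close> over the common denominator
      \<open>a\<close>, so a linear relation among the \<open>z i\<close> is one among the
      powers.\<close>
    define z where "z i = (f ^^ i) a" for i
    have zm: "z i \<in> \<mm>" for i by (induction i) (use a f in \<open>auto simp: z_def\<close>)
    have zR: "z i \<in> carrier R" for i using zm m.a_subset by blast
    have zS: "b \<otimes> z i = a \<otimes> z (Suc i)" for i using f(2)[OF zm[of i]] by (simp add: z_def)
    obtain n c where c: "c \<in> {..<n} \<rightarrow> carrier R" "z n = (\<Oplus>i\<in>{..<n}. c i \<otimes> z i)"
      by (rule stationary_sequence[of z, OF zR])
    interpret K: cring Frac by (rule cring_fraction_field)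
    define k where "k = fraction R b a"
    have kK: "k \<in> carrier Frac" using b aR a by (simp add: k_def fraction_closed)
    have kpow: "k [^]\<^bsub>Frac\<^esub> i = fraction R (z i) a" for i
    proof (induction i)
      case 0
      have "fraction R \<one> \<one> = fraction R a a" using aR a by (intro fraction_eqI) simp_all
      then show ?case by (simp add: fraction_one z_def)
    next
      case (Suc i)
      have "fraction R (z i \<otimes> b) (a \<otimes> a) = fraction R (z (Suc i)) a"
      proof (rule fraction_eqI)
        have "z i \<otimes> b \<otimes> a = a \<otimes> z (Suc i) \<otimes> a" using zS[of i] zR b by (simp add: m_comm)
        then show "z i \<otimes> b \<otimes> a = z (Suc i) \<otimes> (a \<otimes> a)" using zR[of "Suc i"] aR by (simp add: m_ac)
      qed (use zR b aR a in \<open>auto simp: integral_iff\<close>)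
      then show ?case using Suc zR b aR a by (simp add: k_def fraction_mult)
    qed
    have trm: "(\<ominus> c i) \<odot>\<^bsub>Frac\<^esub> (k [^]\<^bsub>Frac\<^esub> i) = fraction R (\<ominus> (c i \<otimes> z i)) a" if "i < n" for i
      using c zR aR a that by (simp add: kpow fraction_smult Pi_iff l_minus)
    have fs: "(\<Oplus>\<^bsub>Frac\<^esub>i\<in>{..<n}. (\<ominus> c i) \<odot>\<^bsub>Frac\<^esub> (k [^]\<^bsub>Frac\<^esub> i)) = fraction R (\<Oplus>i\<in>{..<n}. \<ominus> (c i \<otimes> z i)) a"
    proof -
      have "(\<Oplus>\<^bsub>Frac\<^esub>i\<in>{..<n}. (\<ominus> c i) \<odot>\<^bsub>Frac\<^esub> (k [^]\<^bsub>Frac\<^esub> i)) = (\<Oplus>\<^bsub>Frac\<^esub>i\<in>{..<n}. fraction R (\<ominus> (c i \<otimes> z i)) a)"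
        by (rule K.finsum_cong') (use c zR aR a trm in \<open>auto simp: Pi_iff intro!: fraction_closed\<close>)
      also have "\<dots> = fraction R (\<Oplus>i\<in>{..<n}. \<ominus> (c i \<otimes> z i)) a"
        by (rule fraction_finsum) (use c zR aR a in \<open>auto simp: Pi_iff\<close>)
      finally show ?thesis .
    qed
    have "z n \<oplus> (\<Oplus>i\<in>{..<n}. \<ominus> (c i \<otimes> z i)) = (\<Oplus>i\<in>{..<n}. c i \<otimes> z i \<oplus> \<ominus> (c i \<otimes> z i))"
      unfolding c(2) by (subst finsum_addf) (use c zR in \<open>auto simp: Pi_iff\<close>)
    also have "\<dots> = \<zero>" by (rule add.finprod_one_eqI) (use c zR in \<open>auto simp: Pi_iff r_neg\<close>)
    finally have sum0: "z n \<oplus> (\<Oplus>i\<in>{..<n}. \<ominus> (c i \<otimes> z i)) = \<zero>" .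
    have "k [^]\<^bsub>Frac\<^esub> n \<oplus>\<^bsub>Frac\<^esub> (\<Oplus>\<^bsub>Frac\<^esub>i\<in>{..<n}. (\<ominus> c i) \<odot>\<^bsub>Frac\<^esub> (k [^]\<^bsub>Frac\<^esub> i)) = fraction R \<zero> a"
      unfolding fs unfolding kpow
      by (subst fraction_add_same) (use c zR aR a sum0 in \<open>auto simp: Pi_iff intro!: finsum_closed\<close>)
    also have "\<dots> = \<zero>\<^bsub>Frac\<^esub>" using aR a by (simp add: fraction_zero) (rule fraction_eqI, simp_all)
    finally have "\<exists>(n::nat) c. c \<in> {..<n} \<rightarrow> carrier R \<and>
        k [^]\<^bsub>Frac\<^esub> n \<oplus>\<^bsub>Frac\<^esub> (\<Oplus>\<^bsub>Frac\<^esub>i\<in>{..<n}. c i \<odot>\<^bsub>Frac\<^esub> (k [^]\<^bsub>Frac\<^esub> i)) = \<zero>\<^bsub>Frac\<^esub>"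
      using c(1) by (intro exI[of _ n] exI[of _ "\<lambda>i. \<ominus> c i"]) (auto simp: Pi_iff)
    \<comment> \<open>Being integral, b/a lies in the ring, so \<open>a\<close> divides
      \<open>b\<close>. Then one belongs to the colon ideal, which is \<mm>.\<close>
    then obtain d where d: "d \<in> carrier R" "k = d \<odot>\<^bsub>Frac\<^esub> \<one>\<^bsub>Frac\<^esub>"
      using ic kK unfolding integrally_closed_def Let_def by blast
    then have "fraction R b a = fraction R d \<one>" by (simp add: k_def fraction_one fraction_smult)
    then have "b = d \<otimes> a" using b d(1) aR a by (subst (asm) fraction_eq_iff) auto
    then have "\<one> \<in> Q" using b d(1) aR by (auto simp: Q_def cgenideal_def)
    then show ?thesis using one Qm by blast
  qed
qed

section \<open>Tensor products\<close>

text \<open>Linearity in the map rather than in the formal sum. It makes \<open>ext\<close> additive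
  in its second argument, which occurs inside the map being extended.\<close>

lemma frag_extend_fun_diff:
  "frag_extend (\<lambda>x. f x - g x) c = frag_extend f c - frag_extend g c"
  using subset_UNIV by (induction c rule: frag_induction) (auto simp: frag_extend_diff)

lemma frag_extend_fun_add:
  "frag_extend (\<lambda>x. f x + g x) c = frag_extend f c + frag_extend g c"
  using subset_UNIV by (induction c rule: frag_induction) (auto simp: frag_extend_diff)

locale tensor_product = M: module A M + N: module A N
  for A :: "('a, 'e) ring_scheme" and M :: "('a, 'm, 'c) module_scheme" and N :: "('a, 'n, 'd) module_scheme"
begin

abbreviation tfree where "tfree \<equiv> tensor_free M N"
abbreviation null where "null \<equiv> tensor_null A M N"
abbreviation T where "T \<equiv> tfree Mod null"
abbreviation cls where "cls \<equiv> tensor_class A M N"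
definition supp where "supp u \<longleftrightarrow> Poly_Mapping.keys u \<subseteq> carrier M \<times> carrier N"

definition pure where "pure x y = cls (frag_of (x, y))"

text \<open>Names the relations that generate \<open>tensor_null\<close>, so that claims about the
  null subgroup can be proved by cases on their three kinds.\<close>

definition gens where "gens =
    {frag_of (x \<oplus>\<^bsub>M\<^esub> x', y) - frag_of (x, y) - frag_of (x', y) | x x' y.
        x \<in> carrier M \<and> x' \<in> carrier M \<and> y \<in> carrier N} \<union>
     {frag_of (x, y \<oplus>\<^bsub>N\<^esub> y') - frag_of (x, y) - frag_of (x, y') | x y y'.
        x \<in> carrier M \<and> y \<in> carrier N \<and> y' \<in> carrier N} \<union>
     {frag_of (a \<odot>\<^bsub>M\<^esub> x, y) - frag_of (x, a \<odot>\<^bsub>N\<^esub> y) | a x y.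
        a \<in> carrier A \<and> x \<in> carrier M \<and> y \<in> carrier N}"

lemma null_eq: "null = generate tfree gens"
  by (simp add: tensor_null_def gens_def)

lemma carrier_tfree [simp]: "u \<in> carrier tfree \<longleftrightarrow> supp u"
  by (simp add: tensor_free_def supp_def)

lemma mult_tfree [simp]: "u \<otimes>\<^bsub>tfree\<^esub> v = u + v"
  by (simp add: tensor_free_def)

lemma one_tfree [simp]: "\<one>\<^bsub>tfree\<^esub> = 0"
  by (simp add: tensor_free_def)

lemma comm_group_tfree: "comm_group tfree"
  unfolding tensor_free_def by (rule abelian_free_Abelian_group)

sublocale tfree: comm_group tfree by (rule comm_group_tfree)

lemma supp_zero [simp]: "supp 0"
  by (simp add: supp_def)

lemma supp_add [simp]: "\<lbrakk>supp u; supp v\<rbrakk> \<Longrightarrow> supp (u + v)"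
  using keys_add[of u v] unfolding supp_def by blast

lemma supp_diff [simp]: "\<lbrakk>supp u; supp v\<rbrakk> \<Longrightarrow> supp (u - v)"
  using keys_diff[of u v] unfolding supp_def by blast

lemma supp_minus [simp]: "supp (- u) \<longleftrightarrow> supp u"
  by (simp add: supp_def)

lemma supp_frag_of [simp]: "supp (frag_of (x, y)) \<longleftrightarrow> x \<in> carrier M \<and> y \<in> carrier N"
  by (simp add: supp_def)

lemma supp_induct [consumes 1, case_names zero one diff]:
  assumes "supp u" and "P 0" and "\<And>x y. \<lbrakk>x \<in> carrier M; y \<in> carrier N\<rbrakk> \<Longrightarrow> P (frag_of (x, y))"
    and "\<And>u v. \<lbrakk>supp u; supp v; P u; P v\<rbrakk> \<Longrightarrow> P (u - v)"
  shows "P u"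
  using assms(1) unfolding supp_def
  by (induction u rule: free_Abelian_group_induct) (use assms in \<open>auto simp: supp_def\<close>)

lemma gens_left: "\<lbrakk>x \<in> carrier M; x' \<in> carrier M; y \<in> carrier N\<rbrakk>
    \<Longrightarrow> frag_of (x \<oplus>\<^bsub>M\<^esub> x', y) - frag_of (x, y) - frag_of (x', y) \<in> gens"
  unfolding gens_def by blast

lemma gens_right: "\<lbrakk>x \<in> carrier M; y \<in> carrier N; y' \<in> carrier N\<rbrakk>
    \<Longrightarrow> frag_of (x, y \<oplus>\<^bsub>N\<^esub> y') - frag_of (x, y) - frag_of (x, y') \<in> gens"
  unfolding gens_def by blast

lemma gens_smult: "\<lbrakk>a \<in> carrier A; x \<in> carrier M; y \<in> carrier N\<rbrakk>
    \<Longrightarrow> frag_of (a \<odot>\<^bsub>M\<^esub> x, y) - frag_of (x, a \<odot>\<^bsub>N\<^esub> y) \<in> gens"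
  unfolding gens_def by blast

lemma gens_cases [consumes 1, case_names left right smult]:
  assumes "u \<in> gens"
  obtains x x' y where "u = frag_of (x \<oplus>\<^bsub>M\<^esub> x', y) - frag_of (x, y) - frag_of (x', y)"
      "x \<in> carrier M" "x' \<in> carrier M" "y \<in> carrier N"
    | x y y' where "u = frag_of (x, y \<oplus>\<^bsub>N\<^esub> y') - frag_of (x, y) - frag_of (x, y')"
      "x \<in> carrier M" "y \<in> carrier N" "y' \<in> carrier N"
    | a x y where "u = frag_of (a \<odot>\<^bsub>M\<^esub> x, y) - frag_of (x, a \<odot>\<^bsub>N\<^esub> y)"
      "a \<in> carrier A" "x \<in> carrier M" "y \<in> carrier N"
  using assms unfolding gens_def by blast

lemma supp_gens: "u \<in> gens \<Longrightarrow> supp u"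
  by (erule gens_cases) simp_all

lemma null_subgroup: "subgroup null tfree"
  unfolding null_eq by (rule tfree.generate_is_subgroup) (use supp_gens in auto)

lemma null_normal: "null \<lhd> tfree"
  using tfree.subgroup_imp_normal[OF null_subgroup] .

lemma null_supp: "u \<in> null \<Longrightarrow> supp u"
  using subgroup.subset[OF null_subgroup] carrier_tfree by blast

lemma null_zero: "0 \<in> null"
  using subgroup.one_closed[OF null_subgroup] by simp

lemma null_add: "\<lbrakk>u \<in> null; v \<in> null\<rbrakk> \<Longrightarrow> u + v \<in> null"
  using subgroup.m_closed[OF null_subgroup] by simp

lemma inv_tfree: "supp u \<Longrightarrow> inv\<^bsub>tfree\<^esub> u = - u"
  by (simp add: tensor_free_def supp_def)

lemma null_minus: "u \<in> null \<Longrightarrow> - u \<in> null"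
  using subgroup.m_inv_closed[OF null_subgroup, of u] null_supp[of u] by (simp add: inv_tfree)

lemma null_diff: "\<lbrakk>u \<in> null; v \<in> null\<rbrakk> \<Longrightarrow> u - v \<in> null"
  using null_add[OF _ null_minus, of u v] by simp

lemma gens_null: "u \<in> gens \<Longrightarrow> u \<in> null"
  unfolding null_eq by (rule generate.incl)

lemma null_induct:
  assumes "u \<in> null" "P 0" "\<And>u. u \<in> gens \<Longrightarrow> P u" "\<And>u. P u \<Longrightarrow> P (- u)" "\<And>u v. \<lbrakk>P u; P v\<rbrakk> \<Longrightarrow> P (u + v)"
  shows "P u"
  using assms(1) unfolding null_eq
proof (induction rule: generate.induct)
  case (inv h)
  then show ?case using assms(3,4) supp_gens by (simp add: inv_tfree)
qed (use assms in auto)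

sublocale T: comm_group T
  using tfree.abelian_FactGroup[OF null_subgroup] .

lemma cls_closed [simp]: "supp u \<Longrightarrow> cls u \<in> carrier T"
  by (auto simp: tensor_class_def carrier_FactGroup)

lemma T_cases:
  assumes "X \<in> carrier T" obtains u where "supp u" "X = cls u"
  using assms by (auto simp: tensor_class_def carrier_FactGroup)

lemma cls_add: "\<lbrakk>supp u; supp v\<rbrakk> \<Longrightarrow> cls (u + v) = cls u \<otimes>\<^bsub>T\<^esub> cls v"
  using normal.rcos_sum[OF null_normal, of u v] by (simp add: tensor_class_def)

lemma cls_zero: "cls 0 = \<one>\<^bsub>T\<^esub>"
  using tfree.coset_mult_one[of null] subgroup.subset[OF null_subgroup] by (simp add: tensor_class_def)

lemma cls_minus: "supp u \<Longrightarrow> cls (- u) = inv\<^bsub>T\<^esub> (cls u)"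
  using cls_add[of "- u" u] by (intro T.inv_equality[symmetric]) (simp_all add: cls_zero del: mult_FactGroup one_FactGroup)

lemma cls_eq_iff: "\<lbrakk>supp u; supp v\<rbrakk> \<Longrightarrow> cls u = cls v \<longleftrightarrow> u - v \<in> null"
proof
  assume uv: "supp u" "supp v"
  { assume "cls u = cls v"
    then have "u \<in> null #>\<^bsub>tfree\<^esub> v"
      using tfree.rcos_self[of u null] uv null_subgroup by (simp add: tensor_class_def)
    then show "u - v \<in> null" by (auto simp: r_coset_def) }
  assume "u - v \<in> null"
  then have "u \<in> null #>\<^bsub>tfree\<^esub> v" by (auto simp: r_coset_def intro!: bexI[of _ "u - v"])
  then show "cls u = cls v"
    using tfree.repr_independence[of u null v] uv null_subgroup by (simp add: tensor_class_def)
qed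

lemma cls_memD: "w \<in> cls u \<Longrightarrow> w - u \<in> null"
  by (auto simp: tensor_class_def r_coset_def)

lemma cls_self: "supp u \<Longrightarrow> u \<in> cls u"
  using tfree.rcos_self[of u null] null_subgroup by (simp add: tensor_class_def)

lemma pure_closed [simp]: "\<lbrakk>x \<in> carrier M; y \<in> carrier N\<rbrakk> \<Longrightarrow> pure x y \<in> carrier T"
  by (simp add: pure_def)

lemma pure_add_right:
  assumes "x \<in> carrier M" "y \<in> carrier N" "y' \<in> carrier N"
  shows "pure x (y \<oplus>\<^bsub>N\<^esub> y') = pure x y \<otimes>\<^bsub>T\<^esub> pure x y'"
proof -
  have "cls (frag_of (x, y \<oplus>\<^bsub>N\<^esub> y')) = cls (frag_of (x, y) + frag_of (x, y'))"
    using assms gens_null[OF gens_right[OF assms]] by (subst cls_eq_iff) (simp_all add: diff_diff_eq)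
  then show ?thesis using assms by (simp add: pure_def cls_add)
qed

lemma pure_balanced:
  assumes "a \<in> carrier A" "x \<in> carrier M" "y \<in> carrier N"
  shows "pure (a \<odot>\<^bsub>M\<^esub> x) y = pure x (a \<odot>\<^bsub>N\<^esub> y)"
  unfolding pure_def using assms gens_null[OF gens_smult[OF assms]] by (subst cls_eq_iff) simp_all

text \<open>Pure tensors generate the group; one clause for differences covers sums and inverses
  together.\<close>

lemma T_induct:
  assumes "X \<in> carrier T" and "P \<one>\<^bsub>T\<^esub>" and "\<And>x y. \<lbrakk>x \<in> carrier M; y \<in> carrier N\<rbrakk> \<Longrightarrow> P (pure x y)"
    and diff: "\<And>X Y. \<lbrakk>X \<in> carrier T; Y \<in> carrier T; P X; P Y\<rbrakk> \<Longrightarrow> P (X \<otimes>\<^bsub>T\<^esub> inv\<^bsub>T\<^esub> Y)"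
  shows "P X"
proof -
  obtain u where u: "supp u" "X = cls u" using assms(1) by (rule T_cases)
  have "P (cls u)" using u(1)
  proof (induction u rule: supp_induct)
    case zero show ?case using assms(2) by (simp add: cls_zero)
  next
    case (diff u v)
    have "cls (u - v) = cls u \<otimes>\<^bsub>T\<^esub> inv\<^bsub>T\<^esub> (cls v)"
      using cls_add[of u "- v"] diff by (simp add: cls_minus del: mult_FactGroup)
    then show ?case using diff assms(4) by (simp del: mult_FactGroup)
  next
    case (one x y) then show ?case using assms(3) by (simp add: pure_def)
  qed
  then show ?thesis using u by simp
qed

text \<open>\<open>f\<close> extends to the free abelian group and kills the three kinds of
  relations. Later \<open>f\<close> is built from a coordinate function: a tensor is recognised as
  nonzero by a homomorphism out of the tensor product.\<close>

lemma universal_property: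
  assumes "comm_group G"
    and closed: "\<And>x y. \<lbrakk>x \<in> carrier M; y \<in> carrier N\<rbrakk> \<Longrightarrow> f x y \<in> carrier G"
    and l: "\<And>x x' y. \<lbrakk>x \<in> carrier M; x' \<in> carrier M; y \<in> carrier N\<rbrakk> \<Longrightarrow> f (x \<oplus>\<^bsub>M\<^esub> x') y = f x y \<otimes>\<^bsub>G\<^esub> f x' y"
    and r: "\<And>x y y'. \<lbrakk>x \<in> carrier M; y \<in> carrier N; y' \<in> carrier N\<rbrakk> \<Longrightarrow> f x (y \<oplus>\<^bsub>N\<^esub> y') = f x y \<otimes>\<^bsub>G\<^esub> f x y'"
    and b: "\<And>a x y. \<lbrakk>a \<in> carrier A; x \<in> carrier M; y \<in> carrier N\<rbrakk> \<Longrightarrow> f (a \<odot>\<^bsub>M\<^esub> x) y = f x (a \<odot>\<^bsub>N\<^esub> y)"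
  obtains h where "h \<in> hom T G" "\<And>x y. \<lbrakk>x \<in> carrier M; y \<in> carrier N\<rbrakk> \<Longrightarrow> h (pure x y) = f x y"
proof -
  interpret G: comm_group G by fact
  obtain k where k: "k \<in> hom tfree G" "\<And>p. p \<in> carrier M \<times> carrier N \<Longrightarrow> k (frag_of p) = case_prod f p"
    unfolding tensor_free_def
    by (rule G.free_Abelian_group_universal[of "case_prod f" "carrier M \<times> carrier N"]) (use closed in auto)
  interpret k: group_hom tfree G k
    using k(1) by (auto simp: group_hom_def group_hom_axioms_def)
  have kadd: "k (u + v) = k u \<otimes>\<^bsub>G\<^esub> k v" if "supp u" "supp v" for u v
    using k.hom_mult[of u v] that by simp
  have kdiff: "k (u - v) = k u \<otimes>\<^bsub>G\<^esub> inv\<^bsub>G\<^esub> (k v)" if "supp u" "supp v" for u v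
    using kadd[of u "- v"] k.hom_inv[of v] that by (simp add: inv_tfree)
  \<comment> \<open>This commutator is the value of \<open>k\<close> on a relation expressing
    additivity in either variable.\<close>
  have cancel: "x \<otimes>\<^bsub>G\<^esub> y \<otimes>\<^bsub>G\<^esub> inv\<^bsub>G\<^esub> x \<otimes>\<^bsub>G\<^esub> inv\<^bsub>G\<^esub> y = \<one>\<^bsub>G\<^esub>" if "x \<in> carrier G" "y \<in> carrier G" for x y
    using that by (simp add: G.m_comm[of x y] G.inv_solve_right' G.m_assoc[of _ x])
  have "k u = \<one>\<^bsub>G\<^esub>" if "u \<in> gens" for u
    using that by (cases rule: gens_cases) (simp_all add: cancel k(2) l r b kdiff closed)
  then have "gens \<subseteq> kernel tfree G k" using supp_gens by (auto simp: kernel_def)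
  then have "null \<subseteq> kernel tfree G k"
    unfolding null_eq using tfree.generate_subgroup_incl[OF _ k.subgroup_kernel] by blast
  then obtain h where h: "h \<in> hom T G" "\<And>u. u \<in> carrier tfree \<Longrightarrow> h (null #>\<^bsub>tfree\<^esub> u) = k u"
    using k.FactGroup_universal_kernel[OF null_normal] by blast
  show ?thesis
  proof (rule that[OF h(1)])
    fix x y assume "x \<in> carrier M" "y \<in> carrier N"
    then show "h (pure x y) = f x y" using h(2)[of "frag_of (x, y)"] k(2) by (simp add: pure_def tensor_class_def)
  qed
qed

end

section \<open>Maps on tensor products induced by bilinear maps\<close>

definition bilinear_on :: "('a, 'e) ring_scheme \<Rightarrow> ('a, 'm1, 'c1) module_scheme \<Rightarrow> ('a, 'm2, 'c2) module_scheme \<Rightarrow>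
    ('a, 'm, 'c) module_scheme \<Rightarrow> ('m1 \<Rightarrow> 'm2 \<Rightarrow> 'm) \<Rightarrow> bool" where
  "bilinear_on A M1 M2 M f \<longleftrightarrow>
    (\<forall>x\<in>carrier M1. \<forall>y\<in>carrier M2. f x y \<in> carrier M \<and>
      (\<forall>x'\<in>carrier M1. f (x \<oplus>\<^bsub>M1\<^esub> x') y = f x y \<oplus>\<^bsub>M\<^esub> f x' y) \<and>
      (\<forall>y'\<in>carrier M2. f x (y \<oplus>\<^bsub>M2\<^esub> y') = f x y \<oplus>\<^bsub>M\<^esub> f x y') \<and>
      (\<forall>a\<in>carrier A. f (a \<odot>\<^bsub>M1\<^esub> x) y = a \<odot>\<^bsub>M\<^esub> f x y \<and> f x (a \<odot>\<^bsub>M2\<^esub> y) = a \<odot>\<^bsub>M\<^esub> f x y))"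

locale tensor_bilinear = T1: tensor_product A M1 N1 + T2: tensor_product A M2 N2 + T: tensor_product A M N
  for A :: "('a, 'e) ring_scheme"
    and M1 :: "('a, 'm1, 'c1) module_scheme" and N1 :: "('a, 'n1, 'd1) module_scheme"
    and M2 :: "('a, 'm2, 'c2) module_scheme" and N2 :: "('a, 'n2, 'd2) module_scheme"
    and M :: "('a, 'm, 'c) module_scheme" and N :: "('a, 'n, 'd) module_scheme" +
  fixes f :: "'m1 \<Rightarrow> 'm2 \<Rightarrow> 'm" and g :: "'n1 \<Rightarrow> 'n2 \<Rightarrow> 'n"
  assumes f: "bilinear_on A M1 M2 M f" and g: "bilinear_on A N1 N2 N g"
begin

definition ext where
  "ext u v = frag_extend (\<lambda>(x, y). frag_extend (\<lambda>(x', y'). frag_of (f x x', g y y')) v) u"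

lemma ext_diff_left: "ext (u - u') v = ext u v - ext u' v"
  by (simp add: ext_def frag_extend_diff)

lemma ext_add_left: "ext (u + u') v = ext u v + ext u' v"
  by (simp add: ext_def frag_extend_add)

lemma ext_add_right: "ext u (v + v') = ext u v + ext u v'"
  unfolding ext_def by (simp add: frag_extend_add frag_extend_fun_add case_prod_unfold)

lemma ext_diff_right: "ext u (v - v') = ext u v - ext u v'"
  unfolding ext_def by (simp add: frag_extend_diff frag_extend_fun_diff case_prod_unfold)

lemma ext_frag_of: "ext (frag_of (x, y)) (frag_of (x', y')) = frag_of (f x x', g y y')"
  by (simp add: ext_def)

lemma f_closed: "\<lbrakk>x \<in> carrier M1; y \<in> carrier M2\<rbrakk> \<Longrightarrow> f x y \<in> carrier M"
  using f unfolding bilinear_on_def by blast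

lemma g_closed: "\<lbrakk>x \<in> carrier N1; y \<in> carrier N2\<rbrakk> \<Longrightarrow> g x y \<in> carrier N"
  using g unfolding bilinear_on_def by blast

lemma ext_zero_left: "ext 0 v = 0" by (simp add: ext_def)

lemma ext_zero_right: "ext u 0 = 0" using ext_diff_right[of u 0 0] by simp

lemma ext_minus_left: "ext (- u) v = - ext u v" using ext_diff_left[of 0 u v] by (simp add: ext_zero_left)

lemma ext_minus_right: "ext u (- v) = - ext u v" using ext_diff_right[of u 0 v] by (simp add: ext_zero_right)

lemma supp_ext:
  assumes "T1.supp u" "T2.supp v" shows "T.supp (ext u v)"
  using assms(1)
proof (induction u rule: T1.supp_induct)
  case (one x y)
  show ?case using assms(2)
    by (induction v rule: T2.supp_induct) (use one in \<open>simp_all add: ext_zero_right ext_diff_right ext_frag_of f_closed g_closed\<close>)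
qed (simp_all add: ext_zero_left ext_diff_left)

lemma f_add_left: "\<lbrakk>x \<in> carrier M1; x' \<in> carrier M1; y \<in> carrier M2\<rbrakk> \<Longrightarrow> f (x \<oplus>\<^bsub>M1\<^esub> x') y = f x y \<oplus>\<^bsub>M\<^esub> f x' y"
  and f_add_right: "\<lbrakk>x \<in> carrier M1; y \<in> carrier M2; y' \<in> carrier M2\<rbrakk> \<Longrightarrow> f x (y \<oplus>\<^bsub>M2\<^esub> y') = f x y \<oplus>\<^bsub>M\<^esub> f x y'"
  and f_smult_left: "\<lbrakk>a \<in> carrier A; x \<in> carrier M1; y \<in> carrier M2\<rbrakk> \<Longrightarrow> f (a \<odot>\<^bsub>M1\<^esub> x) y = a \<odot>\<^bsub>M\<^esub> f x y"
  and f_smult_right: "\<lbrakk>a \<in> carrier A; x \<in> carrier M1; y \<in> carrier M2\<rbrakk> \<Longrightarrow> f x (a \<odot>\<^bsub>M2\<^esub> y) = a \<odot>\<^bsub>M\<^esub> f x y"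
  using f unfolding bilinear_on_def by blast+

lemma g_add_left: "\<lbrakk>x \<in> carrier N1; x' \<in> carrier N1; y \<in> carrier N2\<rbrakk> \<Longrightarrow> g (x \<oplus>\<^bsub>N1\<^esub> x') y = g x y \<oplus>\<^bsub>N\<^esub> g x' y"
  and g_add_right: "\<lbrakk>x \<in> carrier N1; y \<in> carrier N2; y' \<in> carrier N2\<rbrakk> \<Longrightarrow> g x (y \<oplus>\<^bsub>N2\<^esub> y') = g x y \<oplus>\<^bsub>N\<^esub> g x y'"
  and g_smult_left: "\<lbrakk>a \<in> carrier A; x \<in> carrier N1; y \<in> carrier N2\<rbrakk> \<Longrightarrow> g (a \<odot>\<^bsub>N1\<^esub> x) y = a \<odot>\<^bsub>N\<^esub> g x y"
  and g_smult_right: "\<lbrakk>a \<in> carrier A; x \<in> carrier N1; y \<in> carrier N2\<rbrakk> \<Longrightarrow> g x (a \<odot>\<^bsub>N2\<^esub> y) = a \<odot>\<^bsub>N\<^esub> g x y"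
  using g unfolding bilinear_on_def by blast+

text \<open>Paired with a pure tensor on the right, each relation turns into a relation of the same
  kind in the target, because \<open>f\<close> and \<open>g\<close> are bilinear. Additivity extends
  this to all right factors.\<close>

lemma ext_null_left:
  assumes "z \<in> T1.null" "T2.supp v" shows "ext z v \<in> T.null"
  using assms(1)
proof (rule T1.null_induct)
  fix u assume u: "u \<in> T1.gens"
  show "ext u v \<in> T.null" using assms(2)
  proof (induction v rule: T2.supp_induct)
    case (one x' y')
    from u have "ext u (frag_of (x', y')) \<in> T.gens"
    proof (cases rule: T1.gens_cases)
      case (left x1 x2 y)
      then show ?thesis
        using T.gens_left[of "f x1 x'" "f x2 x'" "g y y'"] one f_closed g_closed
        by (simp add: ext_diff_left ext_frag_of f_add_left)
    next
      case (right x y1 y2)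
      then show ?thesis
        using T.gens_right[of "f x x'" "g y1 y'" "g y2 y'"] one f_closed g_closed
        by (simp add: ext_diff_left ext_frag_of g_add_left)
    next
      case (smult a x y)
      then show ?thesis
        using T.gens_smult[of a "f x x'" "g y y'"] one f_closed g_closed
        by (simp add: ext_diff_left ext_frag_of f_smult_left g_smult_left)
    qed
    then show ?case by (rule T.gens_null)
  qed (simp_all add: ext_zero_right ext_diff_right T.null_zero T.null_diff)
qed (simp_all add: ext_zero_left ext_add_left ext_minus_left T.null_zero T.null_add T.null_minus)

lemma ext_null_right:
  assumes "z \<in> T2.null" "T1.supp v" shows "ext v z \<in> T.null"
  using assms(1)
proof (rule T2.null_induct)
  fix u assume u: "u \<in> T2.gens"
  show "ext v u \<in> T.null" using assms(2)
  proof (induction v rule: T1.supp_induct)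
    case (one x' y')
    from u have "ext (frag_of (x', y')) u \<in> T.gens"
    proof (cases rule: T2.gens_cases)
      case (left x1 x2 y)
      then show ?thesis
        using T.gens_left[of "f x' x1" "f x' x2" "g y' y"] one f_closed g_closed
        by (simp add: ext_diff_right ext_frag_of f_add_right)
    next
      case (right x y1 y2)
      then show ?thesis
        using T.gens_right[of "f x' x" "g y' y1" "g y' y2"] one f_closed g_closed
        by (simp add: ext_diff_right ext_frag_of g_add_right)
    next
      case (smult a x y)
      then show ?thesis
        using T.gens_smult[of a "f x' x" "g y' y"] one f_closed g_closed
        by (simp add: ext_diff_right ext_frag_of f_smult_right g_smult_right)
    qed
    then show ?case by (rule T.gens_null)
  qed (simp_all add: ext_zero_left ext_diff_left T.null_zero T.null_diff)
qed (simp_all add: ext_zero_right ext_add_right ext_minus_right T.null_zero T.null_add T.null_minus)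

abbreviation bimap where "bimap \<equiv> tensor_bimap A M N f g"

text \<open>Independence of representatives comes from
  \<open>u' v' - u v = (u' - u) v' + u (v' - v)\<close>, both of whose terms are null.\<close>

lemma bimap_cls:
  assumes u: "T1.supp u" and v: "T2.supp v"
  shows "bimap (T1.cls u) (T2.cls v) = T.cls (ext u v)"
proof -
  have *: "T.cls (ext u' v') = T.cls (ext u v)" if "u' \<in> T1.cls u" "v' \<in> T2.cls v" for u' v'
  proof -
    have n: "u' - u \<in> T1.null" "v' - v \<in> T2.null" using that T1.cls_memD T2.cls_memD by auto
    have s: "T1.supp u'" "T2.supp v'"
      using T1.supp_add[OF T1.null_supp[OF n(1)] u] T2.supp_add[OF T2.null_supp[OF n(2)] v] by simp_all
    have "ext u' v' - ext u v = ext (u' - u) v' + ext u (v' - v)"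
      by (simp add: ext_diff_left ext_diff_right)
    also have "\<dots> \<in> T.null" using n s u by (intro T.null_add ext_null_left ext_null_right)
    finally show ?thesis using s u v by (subst T.cls_eq_iff) (simp_all add: supp_ext)
  qed
  have "bimap (T1.cls u) (T2.cls v) = (\<Union>u'\<in>T1.cls u. \<Union>v'\<in>T2.cls v. T.cls (ext u' v'))"
    by (simp add: tensor_bimap_def ext_def)
  also have "\<dots> = (\<Union>u'\<in>T1.cls u. \<Union>v'\<in>T2.cls v. T.cls (ext u v))" using * by simp
  also have "\<dots> = T.cls (ext u v)" using T1.cls_self[OF u] T2.cls_self[OF v] by auto
  finally show ?thesis .
qed

lemma bimap_pure:
  assumes "x \<in> carrier M1" "y \<in> carrier N1" "x' \<in> carrier M2" "y' \<in> carrier N2"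
  shows "bimap (T1.pure x y) (T2.pure x' y') = T.pure (f x x') (g y y')"
  using assms unfolding T1.pure_def T2.pure_def T.pure_def by (subst bimap_cls) (simp_all add: ext_frag_of)

end

section \<open>Free modules and endomorphism algebras\<close>

locale free_module = module A M for A :: "('a, 'e) ring_scheme" and M :: "('a, 'm, 'c) module_scheme" +
  fixes S :: "'m set"
  assumes finite_S: "finite S" and S_subset: "S \<subseteq> carrier M"
    and basis: "\<And>x. x \<in> carrier M \<Longrightarrow> \<exists>!c. c \<in> S \<rightarrow>\<^sub>E carrier A \<and> x = (\<Oplus>\<^bsub>M\<^esub>s\<in>S. c s \<odot>\<^bsub>M\<^esub> s)"
begin

lemma S_closed [simp]: "s \<in> S \<Longrightarrow> s \<in> carrier M" using S_subset by blast

definition coord where "coord x = (THE c. c \<in> S \<rightarrow>\<^sub>E carrier A \<and> x = (\<Oplus>\<^bsub>M\<^esub>s\<in>S. c s \<odot>\<^bsub>M\<^esub> s))"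

lemma coord:
  assumes "x \<in> carrier M"
  shows coord_PiE: "coord x \<in> S \<rightarrow>\<^sub>E carrier A" and coord_expansion: "(\<Oplus>\<^bsub>M\<^esub>s\<in>S. coord x s \<odot>\<^bsub>M\<^esub> s) = x"
  using theI'[OF basis[OF assms]] unfolding coord_def by auto

lemma coord_closed [simp]: "\<lbrakk>x \<in> carrier M; s \<in> S\<rbrakk> \<Longrightarrow> coord x s \<in> carrier A"
  using coord_PiE by blast

lemma coord_unique:
  assumes "c \<in> S \<rightarrow> carrier A" "s \<in> S"
  shows "coord (\<Oplus>\<^bsub>M\<^esub>s\<in>S. c s \<odot>\<^bsub>M\<^esub> s) s = c s"
proof -
  \<comment> \<open>Uniqueness of coordinates is a statement about extensional functions, so
    \<open>c\<close> is first cut down to \<open>S\<close>.\<close>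
  have eq: "(\<Oplus>\<^bsub>M\<^esub>s\<in>S. c s \<odot>\<^bsub>M\<^esub> s) = (\<Oplus>\<^bsub>M\<^esub>s\<in>S. restrict c S s \<odot>\<^bsub>M\<^esub> s)"
    by (rule M.finsum_cong') (use assms in \<open>auto simp: Pi_iff\<close>)
  have cl: "(\<Oplus>\<^bsub>M\<^esub>s\<in>S. c s \<odot>\<^bsub>M\<^esub> s) \<in> carrier M" using assms by (auto simp: Pi_iff intro!: M.finsum_closed)
  have "coord (\<Oplus>\<^bsub>M\<^esub>s\<in>S. c s \<odot>\<^bsub>M\<^esub> s) = restrict c S"
    unfolding coord_def using basis[OF cl] eq assms by (intro the1_equality) auto
  then show ?thesis using assms by simp
qed

lemma coord_add:
  assumes "x \<in> carrier M" "y \<in> carrier M" "s \<in> S"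
  shows "coord (x \<oplus>\<^bsub>M\<^esub> y) s = coord x s \<oplus>\<^bsub>A\<^esub> coord y s"
proof -
  have "x \<oplus>\<^bsub>M\<^esub> y = (\<Oplus>\<^bsub>M\<^esub>s\<in>S. coord x s \<odot>\<^bsub>M\<^esub> s \<oplus>\<^bsub>M\<^esub> coord y s \<odot>\<^bsub>M\<^esub> s)"
    using assms by (subst M.finsum_addf) (auto simp: coord_expansion)
  also have "\<dots> = (\<Oplus>\<^bsub>M\<^esub>s\<in>S. (coord x s \<oplus>\<^bsub>A\<^esub> coord y s) \<odot>\<^bsub>M\<^esub> s)"
    using assms by (intro M.finsum_cong') (auto simp: smult_l_distr)
  finally show ?thesis using assms coord_closed by (simp add: coord_unique Pi_iff)
qed

lemma coord_smult:
  assumes "a \<in> carrier A" "x \<in> carrier M" "s \<in> S"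
  shows "coord (a \<odot>\<^bsub>M\<^esub> x) s = a \<otimes>\<^bsub>A\<^esub> coord x s"
proof -
  have "a \<odot>\<^bsub>M\<^esub> x = (\<Oplus>\<^bsub>M\<^esub>s\<in>S. a \<odot>\<^bsub>M\<^esub> (coord x s \<odot>\<^bsub>M\<^esub> s))"
    using assms finite_S by (subst finsum_smult_ldistr[symmetric]) (auto simp: coord_expansion)
  also have "\<dots> = (\<Oplus>\<^bsub>M\<^esub>s\<in>S. (a \<otimes>\<^bsub>A\<^esub> coord x s) \<odot>\<^bsub>M\<^esub> s)"
    using assms by (intro M.finsum_cong') (auto simp: smult_assoc1)
  finally show ?thesis using assms coord_closed by (simp add: coord_unique Pi_iff)
qed

lemma coord_eqI:
  assumes "x \<in> carrier M" "y \<in> carrier M" "\<And>s. s \<in> S \<Longrightarrow> coord x s = coord y s"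
  shows "x = y"
proof -
  have "x = (\<Oplus>\<^bsub>M\<^esub>s\<in>S. coord x s \<odot>\<^bsub>M\<^esub> s)" using assms by (simp add: coord_expansion)
  also have "\<dots> = (\<Oplus>\<^bsub>M\<^esub>s\<in>S. coord y s \<odot>\<^bsub>M\<^esub> s)"
    using assms by (intro M.finsum_cong') auto
  also have "\<dots> = y" using assms by (simp add: coord_expansion)
  finally show ?thesis .
qed

lemma coord_zero: "s \<in> S \<Longrightarrow> coord \<zero>\<^bsub>M\<^esub> s = \<zero>\<^bsub>A\<^esub>"
  using coord_smult[of "\<zero>\<^bsub>A\<^esub>" "\<zero>\<^bsub>M\<^esub>" s] coord_closed[of "\<zero>\<^bsub>M\<^esub>" s] by simp

text \<open>The last clause takes a scalar multiple of a single basis element, so for A-linear maps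
  a claim reduces to the basis.\<close>

lemma span_induct:
  assumes "x \<in> carrier M" "P \<zero>\<^bsub>M\<^esub>" "\<And>x y. \<lbrakk>x \<in> carrier M; y \<in> carrier M; P x; P y\<rbrakk> \<Longrightarrow> P (x \<oplus>\<^bsub>M\<^esub> y)"
    "\<And>a s. \<lbrakk>a \<in> carrier A; s \<in> S\<rbrakk> \<Longrightarrow> P (a \<odot>\<^bsub>M\<^esub> s)"
  shows "P x"
proof -
  have "P (\<Oplus>\<^bsub>M\<^esub>s\<in>I. coord x s \<odot>\<^bsub>M\<^esub> s)" if "I \<subseteq> S" for I
    using finite_subset[OF that finite_S] that
  proof (induction I)
    case empty
    show ?case using assms(2) by simp
  next
    case (insert i I)
    have c: "(\<lambda>s. coord x s \<odot>\<^bsub>M\<^esub> s) \<in> I \<rightarrow> carrier M" "coord x i \<odot>\<^bsub>M\<^esub> i \<in> carrier M"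
      using insert.prems assms(1) by auto
    have "P (coord x i \<odot>\<^bsub>M\<^esub> i \<oplus>\<^bsub>M\<^esub> (\<Oplus>\<^bsub>M\<^esub>s\<in>I. coord x s \<odot>\<^bsub>M\<^esub> s))"
    proof (rule assms(3))
      show "P (coord x i \<odot>\<^bsub>M\<^esub> i)" by (rule assms(4)) (use insert.prems assms(1) in auto)
      show "P (\<Oplus>\<^bsub>M\<^esub>s\<in>I. coord x s \<odot>\<^bsub>M\<^esub> s)" using insert by blast
    qed (use c in \<open>simp_all add: M.finsum_closed\<close>)
    then show ?case using insert.hyps c by simp
  qed
  from this[of S] show ?thesis unfolding coord_expansion[OF assms(1)] by blast
qed

end

lemma free_of_finite_rankE:
  assumes "free_of_finite_rank A M" "module A M"
  obtains S where "free_module A M S"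
proof -
  obtain S where "finite S" "S \<subseteq> carrier M"
    "\<forall>x\<in>carrier M. \<exists>!c. c \<in> S \<rightarrow>\<^sub>E carrier A \<and> x = (\<Oplus>\<^bsub>M\<^esub>s\<in>S. c s \<odot>\<^bsub>M\<^esub> s)"
    using assms(1) unfolding free_of_finite_rank_def by (elim exE conjE)
  then have "free_module A M S"
    using assms(2) unfolding free_module_def free_module_axioms_def by (intro conjI allI impI) simp_all
  then show ?thesis by (rule that)
qed

lemma restrict_scalars_simps [simp]:
  "carrier (restrict_scalars R P) = carrier P" "\<zero>\<^bsub>restrict_scalars R P\<^esub> = \<zero>\<^bsub>P\<^esub>"
  "add (restrict_scalars R P) = add P" "a \<odot>\<^bsub>restrict_scalars R P\<^esub> p = (a \<odot>\<^bsub>R\<^esub> \<one>\<^bsub>R\<^esub>) \<odot>\<^bsub>P\<^esub> p"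
  by (simp_all add: restrict_scalars_def)

lemma additive_End_simps [simp]:
  "add (additive_End P) f g = (\<lambda>x\<in>carrier P. f x \<oplus>\<^bsub>P\<^esub> g x)" "\<zero>\<^bsub>additive_End P\<^esub> = (\<lambda>x\<in>carrier P. \<zero>\<^bsub>P\<^esub>)"
  "carrier (additive_End P) = {f \<in> carrier P \<rightarrow>\<^sub>E carrier P. \<forall>x\<in>carrier P. \<forall>y\<in>carrier P. f (x \<oplus>\<^bsub>P\<^esub> y) = f x \<oplus>\<^bsub>P\<^esub> f y}"
  by (simp_all add: additive_End_def)

lemma End_ring_simps [simp]:
  "add (End_ring R P) f g = (\<lambda>x\<in>carrier P. f x \<oplus>\<^bsub>P\<^esub> g x)" "\<zero>\<^bsub>End_ring R P\<^esub> = (\<lambda>x\<in>carrier P. \<zero>\<^bsub>P\<^esub>)"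
  by (simp_all add: End_ring_def)

lemma End_ring_mem:
  "f \<in> carrier (End_ring R P) \<longleftrightarrow> f \<in> carrier P \<rightarrow>\<^sub>E carrier P \<and>
    (\<forall>x\<in>carrier P. \<forall>y\<in>carrier P. f (x \<oplus>\<^bsub>P\<^esub> y) = f x \<oplus>\<^bsub>P\<^esub> f y) \<and>
    (\<forall>r\<in>carrier R. \<forall>x\<in>carrier P. f (r \<odot>\<^bsub>P\<^esub> x) = r \<odot>\<^bsub>P\<^esub> f x)"
  by (auto simp: End_ring_def)

lemma End_algebra_simps [simp]:
  "carrier (End_algebra R P) = carrier (End_ring R P)"
  "add (End_algebra R P) f g = (\<lambda>x\<in>carrier P. f x \<oplus>\<^bsub>P\<^esub> g x)" "\<zero>\<^bsub>End_algebra R P\<^esub> = (\<lambda>x\<in>carrier P. \<zero>\<^bsub>P\<^esub>)"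
  "a \<odot>\<^bsub>End_algebra R P\<^esub> f = (\<lambda>x\<in>carrier P. (a \<odot>\<^bsub>R\<^esub> \<one>\<^bsub>R\<^esub>) \<odot>\<^bsub>P\<^esub> f x)"
  by (simp_all add: End_algebra_def ring.defs module.defs)

lemma DEnd_ring_mem:
  "\<sigma> \<in> carrier (DEnd_ring R P) \<longleftrightarrow> \<sigma> \<in> carrier P \<rightarrow>\<^sub>E carrier P \<and>
    (\<forall>x\<in>carrier P. \<forall>y\<in>carrier P. \<sigma> (x \<oplus>\<^bsub>P\<^esub> y) = \<sigma> x \<oplus>\<^bsub>P\<^esub> \<sigma> y) \<and>
    (\<forall>\<alpha>\<in>carrier (End_ring R P). \<forall>x\<in>carrier P. \<sigma> (\<alpha> x) = \<alpha> (\<sigma> x))"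
proof -
  have "compose (carrier P) \<sigma> \<alpha> = compose (carrier P) \<alpha> \<sigma> \<longleftrightarrow> (\<forall>x\<in>carrier P. \<sigma> (\<alpha> x) = \<alpha> (\<sigma> x))" for \<alpha>
    by (auto simp: compose_def fun_eq_iff)
  then show ?thesis by (auto simp: DEnd_ring_def)
qed

section \<open>The A-module structures on P and on its endomorphisms\<close>

locale algebra_module = alg: assoc_algebra A R + P: left_module R P
  for A :: "('a, 'e) ring_scheme" and R :: "('a, 'r, 'd) module_scheme" and P :: "('r, 'p, 'f) module_scheme"
begin

abbreviation RP where "RP \<equiv> restrict_scalars R P"
abbreviation EndA where "EndA \<equiv> End_algebra R P"

lemma scalar_central: "\<lbrakk>a \<in> carrier A; r \<in> carrier R\<rbrakk> \<Longrightarrow> (a \<odot>\<^bsub>R\<^esub> \<one>\<^bsub>R\<^esub>) \<otimes>\<^bsub>R\<^esub> r = r \<otimes>\<^bsub>R\<^esub> (a \<odot>\<^bsub>R\<^esub> \<one>\<^bsub>R\<^esub>)"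
  by (simp add: alg.smult_assoc2 alg.smult_assoc3)

lemma scalar_smult: "\<lbrakk>a \<in> carrier A; r \<in> carrier R; p \<in> carrier P\<rbrakk> \<Longrightarrow> (a \<odot>\<^bsub>R\<^esub> r) \<odot>\<^bsub>P\<^esub> p = (a \<odot>\<^bsub>R\<^esub> \<one>\<^bsub>R\<^esub>) \<odot>\<^bsub>P\<^esub> (r \<odot>\<^bsub>P\<^esub> p)"
  by (simp add: P.smult_assoc1[symmetric] alg.smult_assoc2)

lemma scalar_commute:
  "\<lbrakk>a \<in> carrier A; r \<in> carrier R; p \<in> carrier P\<rbrakk>
    \<Longrightarrow> (a \<odot>\<^bsub>R\<^esub> \<one>\<^bsub>R\<^esub>) \<odot>\<^bsub>P\<^esub> (r \<odot>\<^bsub>P\<^esub> p) = r \<odot>\<^bsub>P\<^esub> ((a \<odot>\<^bsub>R\<^esub> \<one>\<^bsub>R\<^esub>) \<odot>\<^bsub>P\<^esub> p)"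
  by (simp add: P.smult_assoc1[symmetric] scalar_central)

lemma scalar_mult:
  assumes "a \<in> carrier A" "b \<in> carrier A"
  shows "(a \<otimes>\<^bsub>A\<^esub> b) \<odot>\<^bsub>R\<^esub> \<one>\<^bsub>R\<^esub> = (a \<odot>\<^bsub>R\<^esub> \<one>\<^bsub>R\<^esub>) \<otimes>\<^bsub>R\<^esub> (b \<odot>\<^bsub>R\<^esub> \<one>\<^bsub>R\<^esub>)"
  using assms by (simp add: alg.smult_assoc2 alg.smult_assoc1)

lemma module_restrict_scalars: "module A RP"
proof (rule moduleI)
  show "cring A" ..
  show "abelian_group RP"
  proof (rule abelian_groupI)
    show "\<exists>y\<in>carrier RP. y \<oplus>\<^bsub>RP\<^esub> x = \<zero>\<^bsub>RP\<^esub>" if "x \<in> carrier RP" for x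
      using that by (intro bexI[of _ "\<ominus>\<^bsub>P\<^esub> x"]) (simp_all add: P.M.l_neg)
  qed (simp_all add: P.M.a_ac)
qed (simp_all add: alg.smult_l_distr P.smult_l_distr P.smult_r_distr scalar_mult P.smult_assoc1)

sublocale RP: module A RP by (rule module_restrict_scalars)

lemma smult_zero [simp]: "r \<in> carrier R \<Longrightarrow> r \<odot>\<^bsub>P\<^esub> \<zero>\<^bsub>P\<^esub> = \<zero>\<^bsub>P\<^esub>"
  using P.smult_r_distr[of r "\<zero>\<^bsub>P\<^esub>" "\<zero>\<^bsub>P\<^esub>"] by simp

lemma module_End_algebra: "module A EndA"
proof (rule moduleI)
  show "cring A" ..
  have cl: "f x \<in> carrier P" if "f \<in> carrier (End_ring R P)" "x \<in> carrier P" for f x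
    using that by (auto simp: End_ring_mem)
  have ext: "f = g" if "f \<in> carrier (End_ring R P)" "g \<in> carrier P \<rightarrow>\<^sub>E carrier P" "\<And>x. x \<in> carrier P \<Longrightarrow> f x = g x" for f g
    using that by (auto simp: End_ring_mem intro: PiE_ext)
  show "abelian_group EndA"
  proof (rule abelian_groupI)
    fix f assume f: "f \<in> carrier EndA"
    show "\<zero>\<^bsub>EndA\<^esub> \<oplus>\<^bsub>EndA\<^esub> f = f" using f by (intro ext[symmetric]) (auto simp: cl)
    let ?g = "\<lambda>x\<in>carrier P. \<ominus>\<^bsub>P\<^esub> f x"
    show "\<exists>g\<in>carrier EndA. g \<oplus>\<^bsub>EndA\<^esub> f = \<zero>\<^bsub>EndA\<^esub>"
    proof (intro bexI[of _ ?g])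
      have "\<ominus>\<^bsub>P\<^esub> (r \<odot>\<^bsub>P\<^esub> y) = r \<odot>\<^bsub>P\<^esub> (\<ominus>\<^bsub>P\<^esub> y)" if "r \<in> carrier R" "y \<in> carrier P" for r y
        using that P.smult_r_distr[of r "\<ominus>\<^bsub>P\<^esub> y" y] by (intro P.M.minus_equality) (simp_all add: P.M.l_neg)
      then show "?g \<in> carrier EndA" using f cl by (auto simp: End_ring_mem P.M.minus_add)
    qed (use f cl in \<open>auto simp: P.M.l_neg fun_eq_iff\<close>)
    fix g assume g: "g \<in> carrier EndA"
    show "f \<oplus>\<^bsub>EndA\<^esub> g \<in> carrier EndA"
      using f g by (auto simp: End_ring_mem P.smult_r_distr Pi_iff PiE_iff P.M.a_ac)
    show "f \<oplus>\<^bsub>EndA\<^esub> g = g \<oplus>\<^bsub>EndA\<^esub> f" using f g cl by (auto simp: fun_eq_iff P.M.a_comm)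
    fix h assume h: "h \<in> carrier EndA"
    show "f \<oplus>\<^bsub>EndA\<^esub> g \<oplus>\<^bsub>EndA\<^esub> h = f \<oplus>\<^bsub>EndA\<^esub> (g \<oplus>\<^bsub>EndA\<^esub> h)" using f g h cl by (auto simp: fun_eq_iff P.M.a_assoc)
  qed (auto simp: End_ring_mem)
  fix a f assume a: "a \<in> carrier A" and f: "f \<in> carrier EndA"
  show "a \<odot>\<^bsub>EndA\<^esub> f \<in> carrier EndA"
    using a f by (auto simp: End_ring_mem P.smult_r_distr PiE_iff scalar_commute[OF a])
  { fix b assume b: "b \<in> carrier A"
    show "(a \<oplus>\<^bsub>A\<^esub> b) \<odot>\<^bsub>EndA\<^esub> f = a \<odot>\<^bsub>EndA\<^esub> f \<oplus>\<^bsub>EndA\<^esub> b \<odot>\<^bsub>EndA\<^esub> f"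
      using a b f cl by (auto simp: fun_eq_iff alg.smult_l_distr P.smult_l_distr)
    show "a \<otimes>\<^bsub>A\<^esub> b \<odot>\<^bsub>EndA\<^esub> f = a \<odot>\<^bsub>EndA\<^esub> (b \<odot>\<^bsub>EndA\<^esub> f)"
      using a b f cl by (auto simp: fun_eq_iff scalar_mult P.smult_assoc1) }
  fix g assume g: "g \<in> carrier EndA"
  show "a \<odot>\<^bsub>EndA\<^esub> (f \<oplus>\<^bsub>EndA\<^esub> g) = a \<odot>\<^bsub>EndA\<^esub> f \<oplus>\<^bsub>EndA\<^esub> a \<odot>\<^bsub>EndA\<^esub> g"
    using a f g cl by (auto simp: fun_eq_iff P.smult_r_distr)
next
  fix f assume "f \<in> carrier EndA"
  then show "\<one>\<^bsub>A\<^esub> \<odot>\<^bsub>EndA\<^esub> f = f" by (auto simp: End_ring_mem fun_eq_iff PiE_iff extensional_def)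
qed

sublocale EndA: module A EndA by (rule module_End_algebra)

lemma scalar_End: "a \<in> carrier A \<Longrightarrow> (\<lambda>p\<in>carrier P. (a \<odot>\<^bsub>R\<^esub> \<one>\<^bsub>R\<^esub>) \<odot>\<^bsub>P\<^esub> p) \<in> carrier (End_ring R P)"
  by (auto simp: End_ring_mem P.smult_r_distr scalar_commute[of a])

text \<open>Scalars from A act through central elements of R and are therefore R-endomorphisms of P.
  A map commuting with all of these is A-linear, although membership in the double centraliser only
  asks for additivity.\<close>

lemma DEnd_scalar:
  assumes "\<sigma> \<in> carrier (DEnd_ring R P)" "a \<in> carrier A" "p \<in> carrier P"
  shows "\<sigma> ((a \<odot>\<^bsub>R\<^esub> \<one>\<^bsub>R\<^esub>) \<odot>\<^bsub>P\<^esub> p) = (a \<odot>\<^bsub>R\<^esub> \<one>\<^bsub>R\<^esub>) \<odot>\<^bsub>P\<^esub> \<sigma> p"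
  using assms scalar_End[OF assms(2)] unfolding DEnd_ring_mem by (auto dest!: bspec[of _ _ "\<lambda>p\<in>carrier P. (a \<odot>\<^bsub>R\<^esub> \<one>\<^bsub>R\<^esub>) \<odot>\<^bsub>P\<^esub> p"] bspec[of _ _ p] simp: PiE_iff)

end

section \<open>Reduction modulo a maximal ideal\<close>

text \<open>
  \<open>B\<close> is a copy of \<open>A / I\<close>. Keeping it abstract lets the residue field and its copy in another type
  share one development.
\<close>

locale quotient_algebra = B: assoc_algebra A B
  for A :: "('a, 'e) ring_scheme" and B :: "('a, 'b) module" +
  fixes I :: "'a set"
  assumes scalar_surj: "b \<in> carrier B \<Longrightarrow> \<exists>a\<in>carrier A. b = a \<odot>\<^bsub>B\<^esub> \<one>\<^bsub>B\<^esub>"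
    and scalar_kernel: "a \<in> carrier A \<Longrightarrow> a \<odot>\<^bsub>B\<^esub> \<one>\<^bsub>B\<^esub> = \<zero>\<^bsub>B\<^esub> \<longleftrightarrow> a \<in> I"

locale quotient_tensor = quotient_algebra A B I + tensor_product A B N
  for A :: "('a, 'e) ring_scheme" and B :: "('a, 'b) module" and I and N :: "('a, 'n, 'd) module_scheme"
begin

definition red where "red n = pure \<one>\<^bsub>B\<^esub> n"

lemma red_closed [simp]: "n \<in> carrier N \<Longrightarrow> red n \<in> carrier T"
  by (simp add: red_def)

lemma red_add: "\<lbrakk>x \<in> carrier N; y \<in> carrier N\<rbrakk> \<Longrightarrow> red (x \<oplus>\<^bsub>N\<^esub> y) = red x \<otimes>\<^bsub>T\<^esub> red y"
  unfolding red_def by (rule pure_add_right) simp_all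

lemma red_zero: "red \<zero>\<^bsub>N\<^esub> = \<one>\<^bsub>T\<^esub>"
  using red_add[of "\<zero>\<^bsub>N\<^esub>" "\<zero>\<^bsub>N\<^esub>"] T.l_cancel_one[of "red \<zero>\<^bsub>N\<^esub>" "red \<zero>\<^bsub>N\<^esub>"] by (simp del: mult_FactGroup one_FactGroup)

lemma red_neg: "x \<in> carrier N \<Longrightarrow> red (\<ominus>\<^bsub>N\<^esub> x) = inv\<^bsub>T\<^esub> (red x)"
  using red_add[of "\<ominus>\<^bsub>N\<^esub> x" x]
  by (intro T.inv_equality[symmetric]) (simp_all add: N.l_neg red_zero del: mult_FactGroup one_FactGroup)

lemma red_diff: "\<lbrakk>x \<in> carrier N; y \<in> carrier N\<rbrakk> \<Longrightarrow> red (x \<ominus>\<^bsub>N\<^esub> y) = red x \<otimes>\<^bsub>T\<^esub> inv\<^bsub>T\<^esub> (red y)"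
  unfolding a_minus_def by (simp add: red_add red_neg del: mult_FactGroup one_FactGroup)

lemma red_eq_iff: "\<lbrakk>x \<in> carrier N; y \<in> carrier N\<rbrakk> \<Longrightarrow> red x = red y \<longleftrightarrow> red (x \<ominus>\<^bsub>N\<^esub> y) = \<one>\<^bsub>T\<^esub>"
  by (metis red_diff red_closed T.inv_closed T.inv_inv T.inv_equality T.r_inv)

lemma pure_scalar: "\<lbrakk>a \<in> carrier A; n \<in> carrier N\<rbrakk> \<Longrightarrow> pure (a \<odot>\<^bsub>B\<^esub> \<one>\<^bsub>B\<^esub>) n = red (a \<odot>\<^bsub>N\<^esub> n)"
  unfolding red_def by (rule pure_balanced) simp_all

text \<open>A scalar of the quotient comes from A and can be moved across the tensor sign, so every
  pure tensor can be given the left factor one, and such tensors are closed under differences. Thus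
  B \<otimes> N is a quotient of N.\<close>

lemma red_surj: assumes "Y \<in> carrier T" shows "\<exists>n\<in>carrier N. Y = red n"
  using assms
proof (induction Y rule: T_induct)
  case 2 show ?case using red_zero by (intro bexI[of _ "\<zero>\<^bsub>N\<^esub>"]) simp_all
next
  case (3 b n)
  then obtain a where "a \<in> carrier A" "b = a \<odot>\<^bsub>B\<^esub> \<one>\<^bsub>B\<^esub>" using scalar_surj by blast
  then show ?case using 3 by (intro bexI[of _ "a \<odot>\<^bsub>N\<^esub> n"]) (simp_all add: pure_scalar)
next
  case (4 X Y)
  then obtain x y where "x \<in> carrier N" "y \<in> carrier N" "X = red x" "Y = red y" by blast
  then show ?case by (intro bexI[of _ "x \<ominus>\<^bsub>N\<^esub> y"]) (simp_all add: red_diff del: mult_FactGroup)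
qed (use assms in simp)

end

lemma op_algebra_simps [simp]:
  "carrier (op_algebra B) = carrier B" "\<one>\<^bsub>op_algebra B\<^esub> = \<one>\<^bsub>B\<^esub>" "\<zero>\<^bsub>op_algebra B\<^esub> = \<zero>\<^bsub>B\<^esub>"
  "add (op_algebra B) = add B" "smult (op_algebra B) = smult B" "x \<otimes>\<^bsub>op_algebra B\<^esub> y = y \<otimes>\<^bsub>B\<^esub> x"
  by (simp_all add: op_algebra_def)

lemma assoc_algebra_op:
  fixes B :: "('a, 'b) module"
  assumes "assoc_algebra A B"
  shows "assoc_algebra A (op_algebra B)"
proof -
  interpret B: assoc_algebra A B by fact
  have ab: "abelian_group (op_algebra B)"
    using B.M.abelian_group_axioms unfolding op_algebra_def
    by (simp add: abelian_group_def abelian_monoid_def abelian_group_axioms_def)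
  have "module A (op_algebra B)"
    by (rule moduleI) (auto simp: B.smult_l_distr B.smult_r_distr B.smult_assoc1 B.R.is_cring ab)
  moreover have "ring (op_algebra B)"
  proof (rule ringI[OF ab])
    show "Group.monoid (op_algebra B)" by (rule monoidI) (auto simp: B.m_assoc)
  qed (auto simp: B.l_distr B.r_distr)
  ultimately show ?thesis
    by (simp add: assoc_algebra_def assoc_algebra_axioms_def B.smult_assoc2 B.smult_assoc3)
qed

text \<open>\<open>Psi\<close> starts from the opposite algebra; with this the elements of its
  source, too, have the form one tensor an endomorphism.\<close>

lemma quotient_algebra_op:
  assumes "quotient_algebra A B I" shows "quotient_algebra A (op_algebra B) I"
  using assms unfolding quotient_algebra_def quotient_algebra_axioms_def by (simp add: assoc_algebra_op)

text \<open>\<open>d\<close> is meant as a left inverse of the injection \<open>e\<close>. The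
  hypothesis on \<open>Psi\<close> covers algebras with elements in one fixed type; a residue field
  has elements of another type and must be copied into it.\<close>

definition transport_algebra :: "('b \<Rightarrow> 'c) \<Rightarrow> ('c \<Rightarrow> 'b) \<Rightarrow> ('a, 'b) module \<Rightarrow> ('a, 'c) module" where
  "transport_algebra e d B = \<lparr>carrier = e ` carrier B, monoid.mult = (\<lambda>x y. e (d x \<otimes>\<^bsub>B\<^esub> d y)), one = e \<one>\<^bsub>B\<^esub>,
     zero = e \<zero>\<^bsub>B\<^esub>, add = (\<lambda>x y. e (d x \<oplus>\<^bsub>B\<^esub> d y)), smult = (\<lambda>a x. e (a \<odot>\<^bsub>B\<^esub> d x))\<rparr>"

lemma transport_quotient_algebra:
  assumes "quotient_algebra A B I" and de: "\<And>x. d (e x) = x"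
  shows "quotient_algebra A (transport_algebra e d B) I"
proof -
  interpret B: quotient_algebra A B I by fact
  let ?C = "transport_algebra e d B"
  have inj: "e x = e y \<longleftrightarrow> x = y" for x y using de by metis
  note simps = transport_algebra_def de inj
  have ab: "abelian_group ?C"
  proof (rule abelian_groupI)
    show "\<exists>y\<in>carrier ?C. y \<oplus>\<^bsub>?C\<^esub> x = \<zero>\<^bsub>?C\<^esub>" if x: "x \<in> carrier ?C" for x
    proof -
      obtain b where "b \<in> carrier B" "x = e b" using x by (auto simp: simps)
      then show ?thesis by (intro bexI[of _ "e (\<ominus>\<^bsub>B\<^esub> b)"]) (auto simp: simps B.B.M.l_neg)
    qed
  qed (auto simp: simps B.B.M.a_ac)
  have "module A ?C"
    by (rule moduleI[OF B.B.R.is_cring ab])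
      (auto simp: simps B.B.smult_l_distr B.B.smult_r_distr B.B.smult_assoc1)
  moreover have "ring ?C"
  proof (rule ringI[OF ab])
    show "Group.monoid ?C" by (rule monoidI) (auto simp: simps B.B.m_assoc)
  qed (auto simp: simps B.B.l_distr B.B.r_distr)
  ultimately have "assoc_algebra A ?C"
    unfolding assoc_algebra_def assoc_algebra_axioms_def
    by (auto simp: simps B.B.smult_assoc2 B.B.smult_assoc3)
  moreover have "\<exists>a\<in>carrier A. x = a \<odot>\<^bsub>?C\<^esub> \<one>\<^bsub>?C\<^esub>" if "x \<in> carrier ?C" for x
    using that B.scalar_surj by (fastforce simp: simps)
  moreover have "a \<odot>\<^bsub>?C\<^esub> \<one>\<^bsub>?C\<^esub> = \<zero>\<^bsub>?C\<^esub> \<longleftrightarrow> a \<in> I" if "a \<in> carrier A" for a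
    using B.scalar_kernel[OF that] by (simp add: simps)
  ultimately show ?thesis
    unfolding quotient_algebra_def quotient_algebra_axioms_def by blast
qed

lemma residue_algebra_simps [simp]:
  "carrier (residue_algebra A J) = carrier (A Quot J)" "\<one>\<^bsub>residue_algebra A J\<^esub> = \<one>\<^bsub>A Quot J\<^esub>"
  "\<zero>\<^bsub>residue_algebra A J\<^esub> = \<zero>\<^bsub>A Quot J\<^esub>" "add (residue_algebra A J) = add (A Quot J)"
  "monoid.mult (residue_algebra A J) = monoid.mult (A Quot J)"
  "a \<odot>\<^bsub>residue_algebra A J\<^esub> X = (J +>\<^bsub>A\<^esub> a) \<otimes>\<^bsub>A Quot J\<^esub> X"
  by (simp_all add: residue_algebra_def ring.defs module.defs)

lemma residue_quotient_algebra:
  assumes "ideal J A" "cring A" shows "quotient_algebra A (residue_algebra A J) J"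
proof -
  interpret J: ideal J A by fact
  interpret A: cring A by fact
  interpret Q: cring "A Quot J" by (rule J.quotient_is_cring) (rule assms(2))
  interpret h: ring_hom_ring A "A Quot J" "(+>\<^bsub>A\<^esub>) J"
    by (rule J.rcos_ring_hom_ring)
  let ?C = "residue_algebra A J"
  have ab: "abelian_group ?C"
  proof (rule abelian_groupI)
    show "\<exists>y\<in>carrier ?C. y \<oplus>\<^bsub>?C\<^esub> x = \<zero>\<^bsub>?C\<^esub>" if "x \<in> carrier ?C" for x
      using that by (intro bexI[of _ "\<ominus>\<^bsub>A Quot J\<^esub> x"]) (simp_all add: Q.l_neg)
  qed (simp_all add: Q.a_ac)
  have "module A ?C"
    by (rule moduleI[OF assms(2) ab]) (simp_all add: Q.l_distr Q.r_distr Q.m_assoc)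
  moreover have "ring ?C"
  proof (rule ringI[OF ab])
    show "Group.monoid ?C" by (rule monoidI) (auto simp: Q.m_assoc)
  qed (auto simp: Q.l_distr Q.r_distr)
  moreover have "assoc_algebra_axioms A ?C"
  proof (rule assoc_algebra_axioms.intro)
    fix a X Y assume aXY: "a \<in> carrier A" "X \<in> carrier ?C" "Y \<in> carrier ?C"
    show "(a \<odot>\<^bsub>?C\<^esub> X) \<otimes>\<^bsub>?C\<^esub> Y = a \<odot>\<^bsub>?C\<^esub> (X \<otimes>\<^bsub>?C\<^esub> Y)" using aXY by (simp add: Q.m_assoc)
    show "X \<otimes>\<^bsub>?C\<^esub> (a \<odot>\<^bsub>?C\<^esub> Y) = a \<odot>\<^bsub>?C\<^esub> (X \<otimes>\<^bsub>?C\<^esub> Y)" using aXY Q.m_lcomm[of X "J +>\<^bsub>A\<^esub> a" Y] by simp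
  qed
  ultimately have "assoc_algebra A ?C" by (rule assoc_algebra.intro)
  moreover have "\<exists>a\<in>carrier A. x = a \<odot>\<^bsub>?C\<^esub> \<one>\<^bsub>?C\<^esub>" if "x \<in> carrier ?C" for x
  proof -
    have "x \<in> a_rcosets\<^bsub>A\<^esub> J" using that unfolding residue_algebra_simps FactRing_def by (simp only: partial_object.simps)
    then obtain a where a: "a \<in> carrier A" "x = J +>\<^bsub>A\<^esub> a" unfolding A_RCOSETS_def' by blast
    have "a \<odot>\<^bsub>?C\<^esub> \<one>\<^bsub>?C\<^esub> = J +>\<^bsub>A\<^esub> a" using a(1) by simp
    then show ?thesis using a by blast
  qed
  moreover have "a \<odot>\<^bsub>?C\<^esub> \<one>\<^bsub>?C\<^esub> = \<zero>\<^bsub>?C\<^esub> \<longleftrightarrow> a \<in> J" if "a \<in> carrier A" for a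
  proof -
    have "a \<odot>\<^bsub>?C\<^esub> \<one>\<^bsub>?C\<^esub> = J +>\<^bsub>A\<^esub> a" using that by simp
    moreover have "\<zero>\<^bsub>?C\<^esub> = J" unfolding residue_algebra_simps FactRing_def by (simp only: ring.simps)
    moreover have "J +>\<^bsub>A\<^esub> a = J \<longleftrightarrow> a \<in> J"
      using J.rcos_const_imp_mem[OF that] ring.a_rcos_zero[OF cring.axioms(1)[OF assms(2)] assms(1)] by (rule iffI)
    ultimately show ?thesis by (simp only:)
  qed
  ultimately show ?thesis
    unfolding quotient_algebra_def quotient_algebra_axioms_def by (intro conjI allI impI)
qed

lemma base_change_module_simps [simp]:
  "carrier (base_change_module A B R P) = carrier (tensor_free B (restrict_scalars R P) Mod tensor_null A B (restrict_scalars R P))"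
  "add (base_change_module A B R P) = monoid.mult (tensor_free B (restrict_scalars R P) Mod tensor_null A B (restrict_scalars R P))"
  "smult (base_change_module A B R P) = tensor_bimap A B (restrict_scalars R P) (monoid.mult B) (smult P)"
  by (simp_all add: base_change_module_def Let_def)

lemma tensor_ring_simps [simp]:
  "carrier (tensor_ring A B R) = carrier (tensor_free B R Mod tensor_null A B R)"
  "add (tensor_ring A B R) = monoid.mult (tensor_free B R Mod tensor_null A B R)"
  "zero (tensor_ring A B R) = \<one>\<^bsub>tensor_free B R Mod tensor_null A B R\<^esub>"
  "monoid.mult (tensor_ring A B R) = tensor_bimap A B R (monoid.mult B) (monoid.mult R)"
  "one (tensor_ring A B R) = tensor_class A B R (frag_of (\<one>\<^bsub>B\<^esub>, \<one>\<^bsub>R\<^esub>))"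
  by (simp_all add: tensor_ring_def)

locale reduction = algebra_module A R P + quotient_algebra A B I + free_module A "restrict_scalars R P" S
  for A :: "('a, 'e) ring_scheme" and R :: "('a, 'r, 'd) module_scheme" and P :: "('r, 'p, 'f) module_scheme"
    and B :: "('a, 'b) module" and I S
begin

sublocale TP: quotient_tensor A B I RP ..
sublocale TR: quotient_tensor A B I R ..
sublocale opB: quotient_algebra A "op_algebra B" I by (rule quotient_algebra_op) (rule quotient_algebra_axioms)
sublocale TE: quotient_tensor A "op_algebra B" I EndA ..

sublocale act: tensor_bilinear A B R B RP B RP "monoid.mult B" "smult P"
proof
  show "bilinear_on A B B B (monoid.mult B)"
    by (simp add: bilinear_on_def B.l_distr B.r_distr B.smult_assoc2 B.smult_assoc3)
  show "bilinear_on A R RP RP (smult P)"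
    unfolding bilinear_on_def
  proof (intro ballI conjI)
    fix r p a assume "r \<in> carrier R" "p \<in> carrier RP" "a \<in> carrier A"
    then show "(a \<odot>\<^bsub>R\<^esub> r) \<odot>\<^bsub>P\<^esub> p = a \<odot>\<^bsub>RP\<^esub> (r \<odot>\<^bsub>P\<^esub> p)" "r \<odot>\<^bsub>P\<^esub> (a \<odot>\<^bsub>RP\<^esub> p) = a \<odot>\<^bsub>RP\<^esub> (r \<odot>\<^bsub>P\<^esub> p)"
      using scalar_smult[of a r p] scalar_commute[of a r p] by simp_all
  qed (simp_all add: P.smult_l_distr P.smult_r_distr)
qed

sublocale psi: tensor_bilinear A "op_algebra B" EndA B RP B RP "\<lambda>b b'. b' \<otimes>\<^bsub>B\<^esub> b" "\<lambda>\<alpha> p. \<alpha> p"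
proof
  show "bilinear_on A (op_algebra B) B B (\<lambda>b b'. b' \<otimes>\<^bsub>B\<^esub> b)"
    by (simp add: bilinear_on_def B.l_distr B.r_distr B.smult_assoc2 B.smult_assoc3)
  show "bilinear_on A EndA RP RP (\<lambda>\<alpha> p. \<alpha> p)"
    by (auto simp: bilinear_on_def End_ring_mem)
qed

lemma S_closed_P [simp]: "s \<in> S \<Longrightarrow> s \<in> carrier P"
  using S_closed[of s] by simp

lemma act_red: "\<lbrakk>r \<in> carrier R; p \<in> carrier P\<rbrakk> \<Longrightarrow> act.bimap (TR.red r) (TP.red p) = TP.red (r \<odot>\<^bsub>P\<^esub> p)"
  unfolding TR.red_def TP.red_def by (subst act.bimap_pure) simp_all

lemma psi_red: "\<lbrakk>\<alpha> \<in> carrier (End_ring R P); p \<in> carrier P\<rbrakk> \<Longrightarrow> psi.bimap (TE.red \<alpha>) (TP.red p) = TP.red (\<alpha> p)"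
  unfolding TE.red_def TP.red_def by (subst psi.bimap_pure) simp_all

text \<open>The kernel of reduction is I P. In one direction, the homomorphism sending
  \<open>b \<otimes> p\<close> to \<open>b\<close> multiplied by the coordinate of \<open>p\<close>
  at \<open>s\<close> detects that coordinate modulo I. In the other, a basis term with coefficient
  in I becomes a tensor with left factor zero.\<close>

lemma red_kernel:
  assumes "p \<in> carrier P"
  shows "TP.red p = \<one>\<^bsub>TP.T\<^esub> \<longleftrightarrow> (\<forall>s\<in>S. coord p s \<in> I)"
proof (intro iffI ballI)
  fix s assume s: "s \<in> S" and p: "TP.red p = \<one>\<^bsub>TP.T\<^esub>"
  have "comm_group (add_monoid B)" by (rule B.M.a_comm_group)
  then obtain h where h: "h \<in> hom TP.T (add_monoid B)"
    "\<And>b p. \<lbrakk>b \<in> carrier B; p \<in> carrier RP\<rbrakk> \<Longrightarrow> h (TP.pure b p) = coord p s \<odot>\<^bsub>B\<^esub> b"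
  proof (rule TP.universal_property[of "add_monoid B" "\<lambda>b p. coord p s \<odot>\<^bsub>B\<^esub> b"])
    fix a b p assume "a \<in> carrier A" "b \<in> carrier B" "p \<in> carrier RP"
    then show "coord p s \<odot>\<^bsub>B\<^esub> (a \<odot>\<^bsub>B\<^esub> b) = coord (a \<odot>\<^bsub>RP\<^esub> p) s \<odot>\<^bsub>B\<^esub> b"
      using s by (simp add: coord_smult B.smult_assoc1[symmetric] alg.R.m_comm del: restrict_scalars_simps(4))
  qed (use s in \<open>simp_all add: B.smult_r_distr B.smult_l_distr coord_add[simplified]\<close>)
  interpret h: group_hom TP.T "add_monoid B" h
    using h(1) B.M.a_comm_group by (simp add: group_hom_def group_hom_axioms_def comm_group_def)
  have "coord p s \<odot>\<^bsub>B\<^esub> \<one>\<^bsub>B\<^esub> = h (TP.red p)" using h(2)[of "\<one>\<^bsub>B\<^esub>" p] assms by (simp add: TP.red_def)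
  also have "\<dots> = \<zero>\<^bsub>B\<^esub>" unfolding p using h.hom_one by simp
  finally show "coord p s \<in> I" using scalar_kernel[of "coord p s"] s assms by simp
next
  assume *: "\<forall>s\<in>S. coord p s \<in> I"
  have trm: "TP.red (coord p s \<odot>\<^bsub>RP\<^esub> s) = \<one>\<^bsub>TP.T\<^esub>" if s: "s \<in> S" for s
  proof -
    have "TP.red (coord p s \<odot>\<^bsub>RP\<^esub> s) = TP.pure (coord p s \<odot>\<^bsub>B\<^esub> \<one>\<^bsub>B\<^esub>) s"
      using s assms by (intro TP.pure_scalar[symmetric]) simp_all
    \<comment> \<open>The left factor zero is written as a multiple of one, so that moving this
      scalar back to the right yields the reduction of zero.\<close>
    also have "coord p s \<odot>\<^bsub>B\<^esub> \<one>\<^bsub>B\<^esub> = \<zero>\<^bsub>A\<^esub> \<odot>\<^bsub>B\<^esub> \<one>\<^bsub>B\<^esub>"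
      using * s assms scalar_kernel[of "coord p s"] by simp
    also have "TP.pure \<dots> s = TP.red (\<zero>\<^bsub>A\<^esub> \<odot>\<^bsub>RP\<^esub> s)"
      using s by (intro TP.pure_scalar) simp_all
    also have "\<dots> = \<one>\<^bsub>TP.T\<^esub>" using s TP.red_zero by (simp del: restrict_scalars_simps(4) one_FactGroup)
    finally show ?thesis .
  qed
  have "TP.red (\<Oplus>\<^bsub>RP\<^esub>s\<in>F. coord p s \<odot>\<^bsub>RP\<^esub> s) = \<one>\<^bsub>TP.T\<^esub>" if "F \<subseteq> S" for F
    using finite_subset[OF that finite_S] that
  proof (induction F)
    case empty
    show ?case using TP.red_zero by simp
  next
    case (insert i F)
    have c: "coord p s \<odot>\<^bsub>RP\<^esub> s \<in> carrier RP" if "s \<in> S" for s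
      using coord_closed[of p s] assms that by (intro RP.smult_closed) simp_all
    have F: "(\<lambda>s. coord p s \<odot>\<^bsub>RP\<^esub> s) \<in> F \<rightarrow> carrier RP" using insert.prems c by blast
    have i: "coord p i \<odot>\<^bsub>RP\<^esub> i \<in> carrier RP" using insert.prems c by blast
    have "(\<Oplus>\<^bsub>RP\<^esub>s\<in>insert i F. coord p s \<odot>\<^bsub>RP\<^esub> s) = coord p i \<odot>\<^bsub>RP\<^esub> i \<oplus>\<^bsub>RP\<^esub> (\<Oplus>\<^bsub>RP\<^esub>s\<in>F. coord p s \<odot>\<^bsub>RP\<^esub> s)"
      using insert.hyps F i by (rule RP.M.finsum_insert)
    also have "TP.red \<dots> = TP.red (coord p i \<odot>\<^bsub>RP\<^esub> i) \<otimes>\<^bsub>TP.T\<^esub> TP.red (\<Oplus>\<^bsub>RP\<^esub>s\<in>F. coord p s \<odot>\<^bsub>RP\<^esub> s)"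
      using i RP.M.finsum_closed[OF F] by (rule TP.red_add)
    also have "\<dots> = \<one>\<^bsub>TP.T\<^esub> \<otimes>\<^bsub>TP.T\<^esub> \<one>\<^bsub>TP.T\<^esub>" using insert trm by simp
    finally show ?case by (simp only: TP.T.l_one TP.T.one_closed)
  qed
  from this[of S] show "TP.red p = \<one>\<^bsub>TP.T\<^esub>" using coord_expansion[of p] assms by simp
qed

lemma red_eq_iff_coord:
  assumes "p \<in> carrier P" "p' \<in> carrier P"
  shows "TP.red p = TP.red p' \<longleftrightarrow> (\<forall>s\<in>S. coord (p \<ominus>\<^bsub>RP\<^esub> p') s \<in> I)"
proof -
  have "p \<ominus>\<^bsub>RP\<^esub> p' \<in> carrier P" using RP.M.minus_closed[of p p'] assms by simp
  then show ?thesis using red_kernel[of "p \<ominus>\<^bsub>RP\<^esub> p'"] TP.red_eq_iff[of p p'] assms by (simp only: restrict_scalars_simps(1))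
qed

text \<open>By A-linearity \<sigma> maps I P into itself, and elements with the same reduction
  differ by an element of I P. Hence \<sigma> induces a map on the reduced module.\<close>

lemma DEnd_preserves_red:
  assumes \<sigma>: "\<sigma> \<in> carrier (DEnd_ring R P)" and p: "p \<in> carrier P" "p' \<in> carrier P" "TP.red p = TP.red p'"
  shows "TP.red (\<sigma> p) = TP.red (\<sigma> p')"
proof -
  have fn: "\<sigma> x \<in> carrier P" if "x \<in> carrier P" for x using \<sigma> that by (auto simp: DEnd_ring_mem)
  have add: "\<sigma> (x \<oplus>\<^bsub>P\<^esub> y) = \<sigma> x \<oplus>\<^bsub>P\<^esub> \<sigma> y" if "x \<in> carrier P" "y \<in> carrier P" for x y
    using \<sigma> that by (auto simp: DEnd_ring_mem)
  have key: "TP.red (\<sigma> (\<Oplus>\<^bsub>RP\<^esub>s\<in>F. c s \<odot>\<^bsub>RP\<^esub> s)) = \<one>\<^bsub>TP.T\<^esub>" if F: "F \<subseteq> S" and c: "\<And>s. s \<in> S \<Longrightarrow> c s \<in> carrier A \<and> c s \<in> I" for F c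
    using finite_subset[OF F finite_S] F
  proof (induction F)
    case empty
    have "\<sigma> \<zero>\<^bsub>P\<^esub> = \<zero>\<^bsub>P\<^esub>" using DEnd_scalar[OF \<sigma>, of "\<zero>\<^bsub>A\<^esub>" "\<zero>\<^bsub>P\<^esub>"] fn[of "\<zero>\<^bsub>P\<^esub>"] RP.smult_l_null[of "\<sigma> \<zero>\<^bsub>P\<^esub>"] RP.smult_l_null[of "\<zero>\<^bsub>P\<^esub>"]
      by simp
    then show ?case using TP.red_zero by simp
  next
    case (insert i F)
    have cl: "c s \<odot>\<^bsub>RP\<^esub> s \<in> carrier RP" if "s \<in> S" for s
      using c[OF that] that by (intro RP.smult_closed) simp_all
    have F: "(\<lambda>s. c s \<odot>\<^bsub>RP\<^esub> s) \<in> F \<rightarrow> carrier RP" using insert.prems cl by blast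
    have i: "c i \<odot>\<^bsub>RP\<^esub> i \<in> carrier RP" "i \<in> S" using insert.prems cl by blast+
    note Fc = RP.M.finsum_closed[OF F]
    have "(\<Oplus>\<^bsub>RP\<^esub>s\<in>insert i F. c s \<odot>\<^bsub>RP\<^esub> s) = c i \<odot>\<^bsub>RP\<^esub> i \<oplus>\<^bsub>RP\<^esub> (\<Oplus>\<^bsub>RP\<^esub>s\<in>F. c s \<odot>\<^bsub>RP\<^esub> s)"
      using insert.hyps F i(1) by (rule RP.M.finsum_insert)
    also have "\<sigma> \<dots> = \<sigma> (c i \<odot>\<^bsub>RP\<^esub> i) \<oplus>\<^bsub>RP\<^esub> \<sigma> (\<Oplus>\<^bsub>RP\<^esub>s\<in>F. c s \<odot>\<^bsub>RP\<^esub> s)"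
      unfolding restrict_scalars_simps(3) using i(1) Fc unfolding restrict_scalars_simps(1) by (rule add)
    also have "TP.red \<dots> = TP.red (\<sigma> (c i \<odot>\<^bsub>RP\<^esub> i)) \<otimes>\<^bsub>TP.T\<^esub> TP.red (\<sigma> (\<Oplus>\<^bsub>RP\<^esub>s\<in>F. c s \<odot>\<^bsub>RP\<^esub> s))"
      using i(1) Fc fn by (intro TP.red_add) (simp_all only: restrict_scalars_simps(1))
    also have "TP.red (\<sigma> (\<Oplus>\<^bsub>RP\<^esub>s\<in>F. c s \<odot>\<^bsub>RP\<^esub> s)) = \<one>\<^bsub>TP.T\<^esub>" using insert by blast
    also have "\<sigma> (c i \<odot>\<^bsub>RP\<^esub> i) = c i \<odot>\<^bsub>RP\<^esub> \<sigma> i" using DEnd_scalar[OF \<sigma>, of "c i" i] c[OF i(2)] i by simp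
    also have "TP.red (c i \<odot>\<^bsub>RP\<^esub> \<sigma> i) = TP.pure (c i \<odot>\<^bsub>B\<^esub> \<one>\<^bsub>B\<^esub>) (\<sigma> i)"
      using c[OF i(2)] fn[of i] i(2) by (intro TP.pure_scalar[symmetric]) simp_all
    also have "c i \<odot>\<^bsub>B\<^esub> \<one>\<^bsub>B\<^esub> = \<zero>\<^bsub>A\<^esub> \<odot>\<^bsub>B\<^esub> \<one>\<^bsub>B\<^esub>" using c[OF i(2)] scalar_kernel[of "c i"] by simp
    also have "TP.pure \<dots> (\<sigma> i) = TP.red (\<zero>\<^bsub>A\<^esub> \<odot>\<^bsub>RP\<^esub> \<sigma> i)" using fn[of i] i(2) by (intro TP.pure_scalar) simp_all
    also have "\<zero>\<^bsub>A\<^esub> \<odot>\<^bsub>RP\<^esub> \<sigma> i = \<zero>\<^bsub>RP\<^esub>" using RP.smult_l_null[of "\<sigma> i"] fn[of i] i(2) by simp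
    also have "TP.red \<zero>\<^bsub>RP\<^esub> = \<one>\<^bsub>TP.T\<^esub>" by (rule TP.red_zero)
    finally show ?case by (simp only: TP.T.l_one TP.T.one_closed)
  qed
  define d where "d = p \<ominus>\<^bsub>RP\<^esub> p'"
  have d: "d \<in> carrier P" using RP.M.minus_closed[of p p'] p by (simp add: d_def)
  have "\<forall>s\<in>S. coord d s \<in> I" using red_eq_iff_coord[OF p(1,2)] p(3) by (simp add: d_def)
  then have "TP.red (\<sigma> (\<Oplus>\<^bsub>RP\<^esub>s\<in>S. coord d s \<odot>\<^bsub>RP\<^esub> s)) = \<one>\<^bsub>TP.T\<^esub>"
    using coord_closed[of d] d by (intro key) simp_all
  then have "TP.red (\<sigma> d) = \<one>\<^bsub>TP.T\<^esub>" using coord_expansion[of d] d by (simp only: restrict_scalars_simps(1))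
  moreover have "p = d \<oplus>\<^bsub>P\<^esub> p'"
    using RP.M.add.inv_solve_right[of d p p'] p d unfolding d_def a_minus_def by simp
  then have "\<sigma> p = \<sigma> d \<oplus>\<^bsub>RP\<^esub> \<sigma> p'" using add[OF d p(2)] by simp
  then have "TP.red (\<sigma> p) = TP.red (\<sigma> d) \<otimes>\<^bsub>TP.T\<^esub> TP.red (\<sigma> p')"
    using TP.red_add[of "\<sigma> d" "\<sigma> p'"] fn[OF d] fn[OF p(2)] by (simp del: mult_FactGroup restrict_scalars_simps(3))
  ultimately show ?thesis using TP.red_closed[of "\<sigma> p'"] fn[OF p(2)] by (simp del: mult_FactGroup one_FactGroup)
qed

end

text \<open>
  The double centraliser property is assumed over \<open>F\<close>, the surjectivity of \<open>\<Psi>\<close> over \<open>B\<close>, both copies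
  of \<open>A / I\<close>: endomorphisms over \<open>F\<close> are moved to \<open>B\<close>, because \<open>1 \<otimes> p\<close> vanishes in either base change
  exactly when all coordinates of \<open>p\<close> lie in \<open>I\<close>, and then lifted to \<open>P\<close> by \<open>\<Psi>\<close>.
\<close>

theorem DEnd_congruent_homothety:
  assumes F: "reduction A R P F I S" and B: "reduction A R P B I S"
    and surj: "carrier (End_ring (tensor_ring A B R) (base_change_module A B R P))
      \<subseteq> Psi A B R P ` carrier (tensor_ring A (op_algebra B) (End_algebra R P))"
    and dcp: "double_centraliser_property (tensor_ring A F R) (base_change_module A F R P)"
    and \<sigma>: "\<sigma> \<in> carrier (DEnd_ring R P)"
  shows "\<exists>r\<in>carrier R. \<forall>p\<in>carrier P. \<forall>s\<in>S.
    free_module.coord A (restrict_scalars R P) S (\<sigma> p \<ominus>\<^bsub>restrict_scalars R P\<^esub> (r \<odot>\<^bsub>P\<^esub> p)) s \<in> I"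
proof -
  interpret F: reduction A R P F I S by fact
  interpret B: reduction A R P B I S by fact
  have red_FB: "F.TP.red p = F.TP.red p' \<longleftrightarrow> B.TP.red p = B.TP.red p'" if "p \<in> carrier P" "p' \<in> carrier P" for p p'
    using F.red_eq_iff_coord[OF that] B.red_eq_iff_coord[OF that] by simp
  have \<sigma>P: "\<sigma> p \<in> carrier P" if "p \<in> carrier P" for p using \<sigma> that by (auto simp: DEnd_ring_mem)
  have lift: "\<exists>\<alpha>\<in>carrier (End_ring R P). \<forall>p\<in>carrier P. \<beta> (F.TP.red p) = F.TP.red (\<alpha> p)"
    if \<beta>: "\<beta> \<in> carrier (End_ring (tensor_ring A F R) (base_change_module A F R P))" for \<beta>
  proof -
    have \<beta>T: "\<beta> Y \<in> carrier F.TP.T" if "Y \<in> carrier F.TP.T" for Y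
      using \<beta> that unfolding End_ring_mem base_change_module_simps by (blast dest: PiE_mem)
    have \<beta>_add: "\<beta> (X \<otimes>\<^bsub>F.TP.T\<^esub> Y) = \<beta> X \<otimes>\<^bsub>F.TP.T\<^esub> \<beta> Y" if "X \<in> carrier F.TP.T" "Y \<in> carrier F.TP.T" for X Y
      using \<beta> that unfolding End_ring_mem base_change_module_simps by blast
    have \<beta>_act: "\<beta> (F.act.bimap r Y) = F.act.bimap r (\<beta> Y)" if "r \<in> carrier F.TR.T" "Y \<in> carrier F.TP.T" for r Y
      using \<beta> that unfolding End_ring_mem base_change_module_simps tensor_ring_simps by blast
    have "\<forall>p\<in>carrier P. \<exists>p'. p' \<in> carrier P \<and> \<beta> (F.TP.red p) = F.TP.red p'"
    proof
      fix p assume "p \<in> carrier P"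
      then have "\<beta> (F.TP.red p) \<in> carrier F.TP.T" using F.TP.red_closed[of p] by (intro \<beta>T) simp
      from F.TP.red_surj[OF this] show "\<exists>p'. p' \<in> carrier P \<and> \<beta> (F.TP.red p) = F.TP.red p'" by auto
    qed
    \<comment> \<open>\<open>b\<close> lifts \<beta> pointwise and need be neither additive nor
      R-linear; only its reductions are.\<close>
    from bchoice[OF this] obtain b where
      b: "\<And>p. p \<in> carrier P \<Longrightarrow> b p \<in> carrier P" "\<And>p. p \<in> carrier P \<Longrightarrow> \<beta> (F.TP.red p) = F.TP.red (b p)" by auto
    have b_cong: "B.TP.red (b p) = B.TP.red (b p')" if "p \<in> carrier P" "p' \<in> carrier P" "B.TP.red p = B.TP.red p'" for p p'
    proof -
      have "F.TP.red (b p) = F.TP.red (b p')" using that red_FB[of p p'] b(2)[of p] b(2)[of p'] by simp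
      then show ?thesis using red_FB[of "b p" "b p'"] b(1)[of p] b(1)[of p'] that by simp
    qed
    have "\<forall>Y\<in>carrier B.TP.T. \<exists>p. p \<in> carrier P \<and> Y = B.TP.red p"
    using B.TP.red_surj unfolding restrict_scalars_simps by blast
  from bchoice[OF this] obtain c where
    c': "\<forall>Y\<in>carrier B.TP.T. c Y \<in> carrier P \<and> Y = B.TP.red (c Y)" by (rule exE)
    note c = c'[rule_format]
    \<comment> \<open>The copy of \<beta> over \<open>B\<close>: lift a class to P by
      \<open>c\<close>, apply \<open>b\<close>, reduce. By \<open>b_cong\<close> the lift chosen
      does not affect the result.\<close>
    define \<beta>' where "\<beta>' = (\<lambda>Y\<in>carrier B.TP.T. B.TP.red (b (c Y)))"
    have \<beta>': "\<beta>' (B.TP.red p) = B.TP.red (b p)" if "p \<in> carrier P" for p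
      using c[of "B.TP.red p"] B.TP.red_closed[of p] that b_cong[of "c (B.TP.red p)" p] by (simp add: \<beta>'_def)
    have "\<beta>' \<in> carrier (End_ring (tensor_ring A B R) (base_change_module A B R P))"
      unfolding End_ring_mem base_change_module_simps tensor_ring_simps
    proof (intro conjI ballI)
      show "\<beta>' \<in> carrier B.TP.T \<rightarrow>\<^sub>E carrier B.TP.T"
        unfolding \<beta>'_def
      proof (rule restrict_PiE_iff[THEN iffD2], intro ballI)
        fix Y assume "Y \<in> carrier B.TP.T"
        from c[OF this] have "b (c Y) \<in> carrier P" using b(1) by blast
        then show "B.TP.red (b (c Y)) \<in> carrier B.TP.T" using B.TP.red_closed[of "b (c Y)"] by simp
      qed
      fix X Y assume "X \<in> carrier B.TP.T" "Y \<in> carrier B.TP.T"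
      then obtain x y where xy: "x \<in> carrier P" "X = B.TP.red x" "y \<in> carrier P" "Y = B.TP.red y"
        using B.TP.red_surj[of X] B.TP.red_surj[of Y] by auto
      have "F.TP.red (b (x \<oplus>\<^bsub>P\<^esub> y)) = F.TP.red (b x \<oplus>\<^bsub>P\<^esub> b y)"
        using \<beta>_add[of "F.TP.red x" "F.TP.red y"] xy
          b(1)[of x] b(1)[of y] b(2)[of x] b(2)[of y] b(2)[of "x \<oplus>\<^bsub>P\<^esub> y"]
          F.TP.red_add[of x y] F.TP.red_add[of "b x" "b y"] F.TP.red_closed[of x] F.TP.red_closed[of y]
        by (simp del: mult_FactGroup)
      then have "B.TP.red (b (x \<oplus>\<^bsub>P\<^esub> y)) = B.TP.red (b x \<oplus>\<^bsub>P\<^esub> b y)"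
        using red_FB[of "b (x \<oplus>\<^bsub>P\<^esub> y)" "b x \<oplus>\<^bsub>P\<^esub> b y"] xy b(1)[of x] b(1)[of y] b(1)[of "x \<oplus>\<^bsub>P\<^esub> y"] by simp
      then show "\<beta>' (X \<otimes>\<^bsub>B.TP.T\<^esub> Y) = \<beta>' X \<otimes>\<^bsub>B.TP.T\<^esub> \<beta>' Y"
        using xy \<beta>'[of x] \<beta>'[of y] \<beta>'[of "x \<oplus>\<^bsub>P\<^esub> y"] b(1)[of x] b(1)[of y] B.TP.red_add[of x y] B.TP.red_add[of "b x" "b y"]
        by (simp del: mult_FactGroup)
    next
      fix r X assume "r \<in> carrier B.TR.T" "X \<in> carrier B.TP.T"
      then obtain x t where xt: "x \<in> carrier P" "X = B.TP.red x" "t \<in> carrier R" "r = B.TR.red t"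
        using B.TP.red_surj[of X] B.TR.red_surj[of r] by auto
      have "F.TP.red (b (t \<odot>\<^bsub>P\<^esub> x)) = F.TP.red (t \<odot>\<^bsub>P\<^esub> b x)"
        using \<beta>_act[of "F.TR.red t" "F.TP.red x"] xt b(1)[of x] b(2)[of x] b(2)[of "t \<odot>\<^bsub>P\<^esub> x"]
          F.act_red[of t x] F.act_red[of t "b x"] F.TP.red_closed[of x] F.TR.red_closed[of t] by simp
      then have "B.TP.red (b (t \<odot>\<^bsub>P\<^esub> x)) = B.TP.red (t \<odot>\<^bsub>P\<^esub> b x)"
        using red_FB[of "b (t \<odot>\<^bsub>P\<^esub> x)" "t \<odot>\<^bsub>P\<^esub> b x"] xt b(1)[of x] b(1)[of "t \<odot>\<^bsub>P\<^esub> x"] by simp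
      then show "\<beta>' (B.act.bimap r X) = B.act.bimap r (\<beta>' X)"
        using xt \<beta>'[of x] \<beta>'[of "t \<odot>\<^bsub>P\<^esub> x"] b(1)[of x] B.act_red[of t x] B.act_red[of t "b x"] by simp
    qed
    \<comment> \<open>A preimage under \<open>Psi\<close> has the form one tensor \<alpha>, and this
      \<alpha> is the endomorphism of P whose reduction over \<open>F\<close> is \<beta>.\<close>
    then obtain X where X: "X \<in> carrier (tensor_ring A (op_algebra B) (End_algebra R P))" "\<beta>' = Psi A B R P X"
      using surj by blast
    then obtain \<alpha> where \<alpha>: "\<alpha> \<in> carrier (End_ring R P)" "X = B.TE.red \<alpha>"
      using B.TE.red_surj[of X] by auto
    have "\<beta> (F.TP.red p) = F.TP.red (\<alpha> p)" if p: "p \<in> carrier P" for p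
    proof -
      have "\<alpha> p \<in> carrier P" using \<alpha> p by (auto simp: End_ring_mem)
      have "B.TP.red (b p) = Psi A B R P X (B.TP.red p)" using \<beta>'[OF p] X(2) by simp
      also have "\<dots> = B.TP.red (\<alpha> p)"
        using B.psi_red[OF \<alpha>(1) p] B.TP.red_closed[of p] p by (simp add: Psi_def \<alpha>(2))
      finally have "F.TP.red (b p) = F.TP.red (\<alpha> p)" using red_FB[of "b p" "\<alpha> p"] b(1)[OF p] \<open>\<alpha> p \<in> _\<close> by simp
      then show ?thesis using b(2)[OF p] by simp
    qed
    then show ?thesis using \<alpha>(1) by blast
  qed
  have "\<forall>Y\<in>carrier F.TP.T. \<exists>p. p \<in> carrier P \<and> Y = F.TP.red p"
    using F.TP.red_surj unfolding restrict_scalars_simps by blast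
  from bchoice[OF this] obtain c where
    c': "\<forall>Y\<in>carrier F.TP.T. c Y \<in> carrier P \<and> Y = F.TP.red (c Y)" by (rule exE)
  note c = c'[rule_format]
  \<comment> \<open>The map induced by \<sigma> on the reduced module;
    \<open>DEnd_preserves_red\<close> makes the lift \<open>c\<close> irrelevant.\<close>
  define \<tau> where "\<tau> = (\<lambda>Y\<in>carrier F.TP.T. F.TP.red (\<sigma> (c Y)))"
  have \<tau>: "\<tau> (F.TP.red p) = F.TP.red (\<sigma> p)" if p: "p \<in> carrier P" for p
    using c[of "F.TP.red p"] F.TP.red_closed[of p] p F.DEnd_preserves_red[OF \<sigma>, of "c (F.TP.red p)" p]
    by (simp add: \<tau>_def)
  have "\<tau> \<in> carrier (DEnd_ring (tensor_ring A F R) (base_change_module A F R P))"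
    unfolding DEnd_ring_mem base_change_module_simps
  proof (intro conjI ballI)
    show "\<tau> \<in> carrier F.TP.T \<rightarrow>\<^sub>E carrier F.TP.T"
      unfolding \<tau>_def
    proof (rule restrict_PiE_iff[THEN iffD2], intro ballI)
      fix Y assume "Y \<in> carrier F.TP.T"
      from c[OF this] have "\<sigma> (c Y) \<in> carrier P" using \<sigma>P by blast
      then show "F.TP.red (\<sigma> (c Y)) \<in> carrier F.TP.T" using F.TP.red_closed[of "\<sigma> (c Y)"] by simp
    qed
    fix X Y assume "X \<in> carrier F.TP.T" "Y \<in> carrier F.TP.T"
    then obtain x y where xy: "x \<in> carrier P" "X = F.TP.red x" "y \<in> carrier P" "Y = F.TP.red y"
      using F.TP.red_surj[of X] F.TP.red_surj[of Y] by auto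
    have "\<sigma> (x \<oplus>\<^bsub>P\<^esub> y) = \<sigma> x \<oplus>\<^bsub>P\<^esub> \<sigma> y" using \<sigma> xy by (auto simp: DEnd_ring_mem)
    then show "\<tau> (X \<otimes>\<^bsub>F.TP.T\<^esub> Y) = \<tau> X \<otimes>\<^bsub>F.TP.T\<^esub> \<tau> Y"
      using xy \<tau>[of x] \<tau>[of y] \<tau>[of "x \<oplus>\<^bsub>P\<^esub> y"] \<sigma>P[of x] \<sigma>P[of y] F.TP.red_add[of x y] F.TP.red_add[of "\<sigma> x" "\<sigma> y"]
      by (simp del: mult_FactGroup)
  next
    fix \<beta> X assume \<beta>: "\<beta> \<in> carrier (End_ring (tensor_ring A F R) (base_change_module A F R P))" and "X \<in> carrier F.TP.T"
    then obtain x where x: "x \<in> carrier P" "X = F.TP.red x" using F.TP.red_surj[of X] by auto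
    obtain \<alpha> where \<alpha>: "\<alpha> \<in> carrier (End_ring R P)" "\<And>p. p \<in> carrier P \<Longrightarrow> \<beta> (F.TP.red p) = F.TP.red (\<alpha> p)"
      using lift[OF \<beta>] by auto
    have "\<alpha> x \<in> carrier P" using \<alpha>(1) x by (auto simp: End_ring_mem)
    moreover have "\<sigma> (\<alpha> x) = \<alpha> (\<sigma> x)" using \<sigma> \<alpha>(1) x by (auto simp: DEnd_ring_mem)
    \<comment> \<open>Commutation descends: \<beta> is the reduction of \<alpha>, and \<sigma>
      commutes with \<alpha>.\<close>
    ultimately show "\<tau> (\<beta> X) = \<beta> (\<tau> X)"
      using \<tau>[of x] \<tau>[of "\<alpha> x"] \<alpha>(2)[of x] \<alpha>(2)[of "\<sigma> x"] \<sigma>P[of x] x by simp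
  qed
  then obtain z where z: "z \<in> carrier (tensor_ring A F R)" "\<tau> = homothety (base_change_module A F R P) z"
    using dcp unfolding double_centraliser_property_def by blast
  then obtain r where r: "r \<in> carrier R" "z = F.TR.red r" using F.TR.red_surj[of z] by auto
  show ?thesis
  proof (intro bexI[of _ r] ballI)
    fix p s assume p: "p \<in> carrier P" and s: "s \<in> S"
    have "F.TP.red (\<sigma> p) = \<tau> (F.TP.red p)" using \<tau>[OF p] by simp
    also have "\<dots> = F.act.bimap z (F.TP.red p)"
      using F.TP.red_closed[of p] p by (simp add: z(2) homothety_def)
    also have "\<dots> = F.TP.red (r \<odot>\<^bsub>P\<^esub> p)" using F.act_red[of r p] r p by simp
    finally show "F.coord (\<sigma> p \<ominus>\<^bsub>restrict_scalars R P\<^esub> (r \<odot>\<^bsub>P\<^esub> p)) s \<in> I"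
      using F.red_eq_iff_coord[of "\<sigma> p" "r \<odot>\<^bsub>P\<^esub> p"] \<sigma>P[OF p] r p s by simp
  qed (rule r)
qed

section \<open>Semisimplicity of the generic fibre\<close>

lemma (in domain) bilinear_fraction_mult: "bilinear_on R Frac Frac Frac (monoid.mult Frac)"
proof -
  interpret K: cring Frac by (rule cring_fraction_field)
  interpret K: module R Frac by (rule module_fraction_field)
  have l: "(a \<odot>\<^bsub>Frac\<^esub> x) \<otimes>\<^bsub>Frac\<^esub> y = a \<odot>\<^bsub>Frac\<^esub> (x \<otimes>\<^bsub>Frac\<^esub> y)"
    if "a \<in> carrier R" "x \<in> carrier Frac" "y \<in> carrier Frac" for a x y
    using that by (elim fraction_carrierE) (simp add: fraction_smult fraction_mult integral_iff m_assoc)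
  have r: "x \<otimes>\<^bsub>Frac\<^esub> (a \<odot>\<^bsub>Frac\<^esub> y) = a \<odot>\<^bsub>Frac\<^esub> (x \<otimes>\<^bsub>Frac\<^esub> y)"
    if "a \<in> carrier R" "x \<in> carrier Frac" "y \<in> carrier Frac" for a x y
    using l[of a y x] that by (simp add: K.m_comm)
  show ?thesis unfolding bilinear_on_def by (simp add: K.l_distr K.r_distr l r)
qed

locale generic_fibre = A: domain A + alg: assoc_algebra A R + free_module A R S
  for A :: "('a, 'e) ring_scheme" and R :: "('a, 'r, 'd) module_scheme" and S
begin

abbreviation K where "K \<equiv> fraction_field A"

sublocale K: module A K by (rule A.module_fraction_field)
sublocale TK: tensor_product A K R ..
sublocale mul: tensor_bilinear A K R K R K R "monoid.mult K" "monoid.mult R"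
proof
  show "bilinear_on A K K K (monoid.mult K)" by (rule A.bilinear_fraction_mult)
  show "bilinear_on A R R R (monoid.mult R)"
    by (simp add: bilinear_on_def alg.l_distr alg.r_distr alg.smult_assoc2 alg.smult_assoc3)
qed

text \<open>
  \<open>quot a r\<close> is \<open>1/a \<otimes> r\<close>; every element of \<open>K \<otimes> R\<close> has this form.
\<close>

definition quot where "quot a r = TK.pure (fraction A \<one>\<^bsub>A\<^esub> a) r"

abbreviation nz where "nz \<equiv> carrier A - {\<zero>\<^bsub>A\<^esub>}"

lemma quot_closed [simp]: "\<lbrakk>a \<in> nz; r \<in> carrier R\<rbrakk> \<Longrightarrow> quot a r \<in> carrier TK.T"
  unfolding quot_def by (intro TK.pure_closed A.fraction_closed) auto

lemma nz_mult: "\<lbrakk>a \<in> nz; b \<in> nz\<rbrakk> \<Longrightarrow> a \<otimes>\<^bsub>A\<^esub> b \<in> nz" by (rule A.nz_mult)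

lemma quot_expand:
  assumes "a \<in> nz" "b \<in> nz" "r \<in> carrier R"
  shows "quot (a \<otimes>\<^bsub>A\<^esub> b) (b \<odot>\<^bsub>R\<^esub> r) = quot a r"
proof -
  have ab: "a \<otimes>\<^bsub>A\<^esub> b \<in> nz" using assms nz_mult by blast
  have "quot (a \<otimes>\<^bsub>A\<^esub> b) (b \<odot>\<^bsub>R\<^esub> r) = TK.pure (b \<odot>\<^bsub>K\<^esub> fraction A \<one>\<^bsub>A\<^esub> (a \<otimes>\<^bsub>A\<^esub> b)) r"
    unfolding quot_def using assms ab by (intro TK.pure_balanced[symmetric] A.fraction_closed) auto
  also have "b \<odot>\<^bsub>K\<^esub> fraction A \<one>\<^bsub>A\<^esub> (a \<otimes>\<^bsub>A\<^esub> b) = fraction A (b \<otimes>\<^bsub>A\<^esub> \<one>\<^bsub>A\<^esub>) (a \<otimes>\<^bsub>A\<^esub> b)"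
    using assms ab by (intro A.fraction_smult) auto
  also have "\<dots> = fraction A \<one>\<^bsub>A\<^esub> a" using assms ab by (intro A.fraction_eqI) (auto simp: A.m_comm)
  finally show ?thesis by (simp add: quot_def)
qed

lemma quot_add_same:
  assumes "a \<in> nz" "r \<in> carrier R" "r' \<in> carrier R"
  shows "quot a (r \<oplus>\<^bsub>R\<^esub> r') = quot a r \<otimes>\<^bsub>TK.T\<^esub> quot a r'"
  unfolding quot_def using assms by (intro TK.pure_add_right A.fraction_closed) auto

lemma quot_add:
  assumes "a \<in> nz" "r \<in> carrier R" "b \<in> nz" "r' \<in> carrier R"
  shows "quot a r \<otimes>\<^bsub>TK.T\<^esub> quot b r' = quot (a \<otimes>\<^bsub>A\<^esub> b) (b \<odot>\<^bsub>R\<^esub> r \<oplus>\<^bsub>R\<^esub> a \<odot>\<^bsub>R\<^esub> r')"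
proof -
  have "quot (a \<otimes>\<^bsub>A\<^esub> b) (b \<odot>\<^bsub>R\<^esub> r) = quot a r" using assms by (intro quot_expand)
  moreover have "quot (b \<otimes>\<^bsub>A\<^esub> a) (a \<odot>\<^bsub>R\<^esub> r') = quot b r'" using assms by (intro quot_expand)
  moreover have "b \<otimes>\<^bsub>A\<^esub> a = a \<otimes>\<^bsub>A\<^esub> b" using assms by (intro A.m_comm) auto
  moreover have "a \<otimes>\<^bsub>A\<^esub> b \<in> nz" using assms nz_mult by blast
  ultimately show ?thesis using assms by (simp add: quot_add_same del: mult_FactGroup)
qed

lemma quot_zero: assumes "a \<in> nz" shows "quot a \<zero>\<^bsub>R\<^esub> = \<one>\<^bsub>TK.T\<^esub>"
proof -
  have c: "quot a \<zero>\<^bsub>R\<^esub> \<in> carrier TK.T" using assms by (intro quot_closed) simp_all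
  have "quot a \<zero>\<^bsub>R\<^esub> \<otimes>\<^bsub>TK.T\<^esub> quot a \<zero>\<^bsub>R\<^esub> = quot a \<zero>\<^bsub>R\<^esub>" using quot_add_same[OF assms, of "\<zero>\<^bsub>R\<^esub>" "\<zero>\<^bsub>R\<^esub>"] by simp
  then show ?thesis using TK.T.l_cancel_one[OF c c] by (simp only:)
qed

lemma quot_neg: assumes "a \<in> nz" "r \<in> carrier R" shows "inv\<^bsub>TK.T\<^esub> (quot a r) = quot a (\<ominus>\<^bsub>R\<^esub> r)"
proof (rule TK.T.inv_equality)
  have "quot a (\<ominus>\<^bsub>R\<^esub> r) \<otimes>\<^bsub>TK.T\<^esub> quot a r = quot a (\<ominus>\<^bsub>R\<^esub> r \<oplus>\<^bsub>R\<^esub> r)"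
    using assms by (intro quot_add_same[symmetric]) simp_all
  also have "\<dots> = quot a \<zero>\<^bsub>R\<^esub>" using assms by (simp add: alg.l_neg)
  also have "\<dots> = \<one>\<^bsub>TK.T\<^esub>" using assms(1) by (rule quot_zero)
  finally show "quot a (\<ominus>\<^bsub>R\<^esub> r) \<otimes>\<^bsub>TK.T\<^esub> quot a r = \<one>\<^bsub>TK.T\<^esub>" .
qed (use assms in simp_all)

lemma quot_cases:
  assumes "z \<in> carrier TK.T" obtains a r where "a \<in> nz" "r \<in> carrier R" "z = quot a r"
proof -
  have "\<exists>a\<in>nz. \<exists>r\<in>carrier R. z = quot a r"
    using assms
  proof (induction z rule: TK.T_induct)
    case 1 show ?case using assms .
  next
    case 2
    have "\<one>\<^bsub>TK.T\<^esub> = quot \<one>\<^bsub>A\<^esub> \<zero>\<^bsub>R\<^esub>" by (rule quot_zero[symmetric]) simp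
    then show ?case by (intro bexI[of _ "\<one>\<^bsub>A\<^esub>"] bexI[of _ "\<zero>\<^bsub>R\<^esub>"]) simp_all
  next
    case (3 x r)
    then obtain c d where x: "c \<in> carrier A" "d \<in> carrier A" "d \<noteq> \<zero>\<^bsub>A\<^esub>" "x = fraction A c d"
      by (auto elim: A.fraction_carrierE)
    have "x = c \<odot>\<^bsub>K\<^esub> fraction A \<one>\<^bsub>A\<^esub> d" using x by (simp add: A.fraction_smult)
    then have "TK.pure x r = quot d (c \<odot>\<^bsub>R\<^esub> r)"
      unfolding quot_def using x 3 by (simp only:) (intro TK.pure_balanced A.fraction_closed, auto)
    then show ?case using x 3 by (intro bexI[of _ d] bexI[of _ "c \<odot>\<^bsub>R\<^esub> r"]) simp_all
  next
    case (4 X Y)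
    from 4(3)[OF 4(1)] 4(4)[OF 4(2)] obtain a r b r' where h: "a \<in> nz" "r \<in> carrier R" "X = quot a r" "b \<in> nz" "r' \<in> carrier R" "Y = quot b r'"
      by (elim bexE)
    have "X \<otimes>\<^bsub>TK.T\<^esub> inv\<^bsub>TK.T\<^esub> Y = quot (a \<otimes>\<^bsub>A\<^esub> b) (b \<odot>\<^bsub>R\<^esub> r \<oplus>\<^bsub>R\<^esub> a \<odot>\<^bsub>R\<^esub> (\<ominus>\<^bsub>R\<^esub> r'))"
      using h quot_neg[of b r'] quot_add[of a r b "\<ominus>\<^bsub>R\<^esub> r'"] by (simp del: mult_FactGroup)
    moreover have "a \<otimes>\<^bsub>A\<^esub> b \<in> nz" using h nz_mult by blast
    ultimately show ?case using h by (intro bexI[of _ "a \<otimes>\<^bsub>A\<^esub> b"] bexI[of _ "b \<odot>\<^bsub>R\<^esub> r \<oplus>\<^bsub>R\<^esub> a \<odot>\<^bsub>R\<^esub> (\<ominus>\<^bsub>R\<^esub> r')"]) simp_all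
  qed
  then show ?thesis using that by (elim bexE)
qed

lemma quot_mult:
  assumes "a \<in> nz" "r \<in> carrier R" "b \<in> nz" "r' \<in> carrier R"
  shows "mul.bimap (quot a r) (quot b r') = quot (a \<otimes>\<^bsub>A\<^esub> b) (r \<otimes>\<^bsub>R\<^esub> r')"
proof -
  have "mul.bimap (quot a r) (quot b r') = TK.pure (fraction A \<one>\<^bsub>A\<^esub> a \<otimes>\<^bsub>K\<^esub> fraction A \<one>\<^bsub>A\<^esub> b) (r \<otimes>\<^bsub>R\<^esub> r')"
    unfolding quot_def using assms by (intro mul.bimap_pure A.fraction_closed) auto
  also have "fraction A \<one>\<^bsub>A\<^esub> a \<otimes>\<^bsub>K\<^esub> fraction A \<one>\<^bsub>A\<^esub> b = fraction A \<one>\<^bsub>A\<^esub> (a \<otimes>\<^bsub>A\<^esub> b)"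
    using assms by (subst A.fraction_mult) auto
  finally show ?thesis by (simp add: quot_def)
qed

text \<open>R is free over the domain A, so coordinates with values in K are defined on K \<otimes>
  R and turn an equality of tensors into equalities of fractions. In particular R embeds into K
  \<otimes> R.\<close>

lemma quot_eq_iff:
  assumes "a \<in> nz" "r \<in> carrier R" "b \<in> nz" "r' \<in> carrier R"
  shows "quot a r = quot b r' \<longleftrightarrow> b \<odot>\<^bsub>R\<^esub> r = a \<odot>\<^bsub>R\<^esub> r'"
proof
  assume eq: "quot a r = quot b r'"
  interpret Kc: cring K by (rule A.cring_fraction_field)
  show "b \<odot>\<^bsub>R\<^esub> r = a \<odot>\<^bsub>R\<^esub> r'"
  proof (rule coord_eqI)
    fix s assume s: "s \<in> S"
    obtain h where h: "h \<in> hom TK.T (add_monoid K)"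
      "\<And>k r. \<lbrakk>k \<in> carrier K; r \<in> carrier R\<rbrakk> \<Longrightarrow> h (TK.pure k r) = coord r s \<odot>\<^bsub>K\<^esub> k"
    proof (rule TK.universal_property[of "add_monoid K" "\<lambda>k r. coord r s \<odot>\<^bsub>K\<^esub> k"])
      show "comm_group (add_monoid K)" by (rule K.M.a_comm_group)
      fix a k r assume "a \<in> carrier A" "k \<in> carrier K" "r \<in> carrier R"
      then show "coord r s \<odot>\<^bsub>K\<^esub> (a \<odot>\<^bsub>K\<^esub> k) = coord (a \<odot>\<^bsub>R\<^esub> r) s \<odot>\<^bsub>K\<^esub> k"
        using s by (simp add: coord_smult K.smult_assoc1[symmetric] A.m_comm)
    qed (use s in \<open>simp_all add: K.smult_r_distr K.smult_l_distr coord_add\<close>)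
    have hf: "h (quot a r) = fraction A (coord r s) a" if "a \<in> nz" "r \<in> carrier R" for a r
    proof -
      have "h (quot a r) = coord r s \<odot>\<^bsub>K\<^esub> fraction A \<one>\<^bsub>A\<^esub> a"
        unfolding quot_def using that by (intro h(2) A.fraction_closed) auto
      then show ?thesis using that s by (simp add: A.fraction_smult)
    qed
    have "fraction A (coord r s) a = fraction A (coord r' s) b"
      using hf[of a r] hf[of b r'] eq assms by simp
    then have "coord r s \<otimes>\<^bsub>A\<^esub> b = coord r' s \<otimes>\<^bsub>A\<^esub> a"
      using assms s by (subst (asm) A.fraction_eq_iff) simp_all
    then show "coord (b \<odot>\<^bsub>R\<^esub> r) s = coord (a \<odot>\<^bsub>R\<^esub> r') s"
      using assms s by (simp add: coord_smult A.m_comm)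
  qed (use assms in simp_all)
next
  assume eq: "b \<odot>\<^bsub>R\<^esub> r = a \<odot>\<^bsub>R\<^esub> r'"
  have "quot a r = quot (a \<otimes>\<^bsub>A\<^esub> b) (b \<odot>\<^bsub>R\<^esub> r)" using assms by (intro quot_expand[symmetric])
  also have "\<dots> = quot (b \<otimes>\<^bsub>A\<^esub> a) (a \<odot>\<^bsub>R\<^esub> r')" using assms eq by (simp add: A.m_comm)
  also have "\<dots> = quot b r'" using assms by (intro quot_expand)
  finally show "quot a r = quot b r'" .
qed

text \<open>
  Saturated left ideals of \<open>R\<close> correspond to left ideals of \<open>K \<otimes> R\<close>.
\<close>

definition saturated_ideal where
  "saturated_ideal W \<longleftrightarrow> W \<subseteq> carrier R \<and> \<zero>\<^bsub>R\<^esub> \<in> W \<and> (\<forall>r\<in>W. \<forall>r'\<in>W. r \<oplus>\<^bsub>R\<^esub> r' \<in> W) \<and>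
    (\<forall>t\<in>carrier R. \<forall>r\<in>W. t \<otimes>\<^bsub>R\<^esub> r \<in> W) \<and> (\<forall>a\<in>nz. \<forall>r\<in>carrier R. a \<odot>\<^bsub>R\<^esub> r \<in> W \<longrightarrow> r \<in> W)"

abbreviation RK where "RK \<equiv> tensor_ring A K R"
abbreviation RKmod where "RKmod \<equiv> regular_module RK"

lemma RKmod_simps [simp]:
  "carrier RKmod = carrier TK.T" "add RKmod = monoid.mult TK.T" "zero RKmod = \<one>\<^bsub>TK.T\<^esub>" "smult RKmod = mul.bimap"
  by (simp_all add: regular_module_def ring.defs module.defs tensor_ring_def)

lemma abelian_group_RKmod: "abelian_group RKmod"
proof (rule abelian_groupI)
  show "\<exists>y\<in>carrier RKmod. y \<oplus>\<^bsub>RKmod\<^esub> x = \<zero>\<^bsub>RKmod\<^esub>" if "x \<in> carrier RKmod" for x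
    using that by (intro bexI[of _ "inv\<^bsub>TK.T\<^esub> x"]) (simp_all del: mult_FactGroup one_FactGroup)
qed (simp_all add: TK.T.m_ac del: mult_FactGroup one_FactGroup)

text \<open>For a saturated ideal \<open>W\<close> this is the left ideal of K \<otimes> R that it
  generates; \<open>contraction\<close> leads back.\<close>

definition fibre where "fibre W = {quot a r | a r. a \<in> nz \<and> r \<in> W}"

lemma fibreI: "\<lbrakk>a \<in> nz; r \<in> W\<rbrakk> \<Longrightarrow> quot a r \<in> fibre W"
  unfolding fibre_def by blast

lemma submodule_RKmodI:
  assumes "N \<subseteq> carrier TK.T" "\<one>\<^bsub>TK.T\<^esub> \<in> N" "\<And>x y. \<lbrakk>x \<in> N; y \<in> N\<rbrakk> \<Longrightarrow> x \<otimes>\<^bsub>TK.T\<^esub> y \<in> N"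
    "\<And>x. x \<in> N \<Longrightarrow> inv\<^bsub>TK.T\<^esub> x \<in> N" "\<And>z x. \<lbrakk>z \<in> carrier TK.T; x \<in> N\<rbrakk> \<Longrightarrow> mul.bimap z x \<in> N"
  shows "submodule N RK RKmod"
proof -
  interpret G: abelian_group RKmod by (rule abelian_group_RKmod)
  have inv: "inv\<^bsub>add_monoid RKmod\<^esub> x = inv\<^bsub>TK.T\<^esub> x" if "x \<in> carrier TK.T" for x
  proof (rule group.inv_equality)
    show "group (add_monoid RKmod)" using G.a_comm_group by (rule comm_group.axioms)
  qed (use that in \<open>simp_all del: mult_FactGroup one_FactGroup\<close>)
  have "subgroup N (add_monoid RKmod)"
  proof (rule subgroup.intro)
    show "inv\<^bsub>add_monoid RKmod\<^esub> x \<in> N" if "x \<in> N" for x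
      using inv[of x] assms(1,4) that by (simp add: subset_iff)
  qed (use assms(1-3) in \<open>simp_all del: mult_FactGroup one_FactGroup\<close>)
  then show ?thesis
    by (rule submodule.intro) (use assms(5) in \<open>simp add: submodule_axioms_def\<close>)
qed

lemma submodule_RKmodD:
  assumes "submodule N RK RKmod"
  shows "N \<subseteq> carrier TK.T" "\<one>\<^bsub>TK.T\<^esub> \<in> N" "\<And>x y. \<lbrakk>x \<in> N; y \<in> N\<rbrakk> \<Longrightarrow> x \<otimes>\<^bsub>TK.T\<^esub> y \<in> N"
    "\<And>z x. \<lbrakk>z \<in> carrier TK.T; x \<in> N\<rbrakk> \<Longrightarrow> mul.bimap z x \<in> N"
proof -
  interpret N: submodule N RK RKmod by fact
  show "N \<subseteq> carrier TK.T" "\<one>\<^bsub>TK.T\<^esub> \<in> N" "\<And>x y. \<lbrakk>x \<in> N; y \<in> N\<rbrakk> \<Longrightarrow> x \<otimes>\<^bsub>TK.T\<^esub> y \<in> N"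
    "\<And>z x. \<lbrakk>z \<in> carrier TK.T; x \<in> N\<rbrakk> \<Longrightarrow> mul.bimap z x \<in> N"
    using N.subset N.one_closed N.m_closed N.smult_closed by (simp_all del: mult_FactGroup one_FactGroup)
qed

lemma saturated_ideal_neg:
  assumes "saturated_ideal W" "r \<in> W" shows "\<ominus>\<^bsub>R\<^esub> r \<in> W"
proof -
  have r: "r \<in> carrier R" using assms by (auto simp: saturated_ideal_def)
  have "(\<ominus>\<^bsub>R\<^esub> \<one>\<^bsub>R\<^esub>) \<otimes>\<^bsub>R\<^esub> r \<in> W" using assms by (simp add: saturated_ideal_def)
  then show ?thesis using r by (simp add: alg.l_minus)
qed

lemma saturated_ideal_smult:
  assumes "saturated_ideal W" "r \<in> W" "a \<in> carrier A" shows "a \<odot>\<^bsub>R\<^esub> r \<in> W"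
proof -
  have r: "r \<in> carrier R" using assms by (auto simp: saturated_ideal_def)
  have "(a \<odot>\<^bsub>R\<^esub> \<one>\<^bsub>R\<^esub>) \<otimes>\<^bsub>R\<^esub> r \<in> W" using assms by (simp add: saturated_ideal_def)
  then show ?thesis using r assms(3) by (simp add: alg.smult_assoc2)
qed

lemma submodule_fibre:
  assumes W: "saturated_ideal W" shows "submodule (fibre W) RK RKmod"
proof (rule submodule_RKmodI)
  have WR: "r \<in> carrier R" if "r \<in> W" for r using W that by (auto simp: saturated_ideal_def)
  show "fibre W \<subseteq> carrier TK.T" using WR quot_closed by (auto simp: fibre_def)
  have "quot \<one>\<^bsub>A\<^esub> \<zero>\<^bsub>R\<^esub> \<in> fibre W" by (rule fibreI) (use W in \<open>simp_all add: saturated_ideal_def\<close>)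
  then show "\<one>\<^bsub>TK.T\<^esub> \<in> fibre W" using quot_zero[of "\<one>\<^bsub>A\<^esub>"] by simp
  fix x assume "x \<in> fibre W"
  then obtain a r where x: "a \<in> nz" "r \<in> W" "x = quot a r" by (auto simp: fibre_def)
  have "quot a (\<ominus>\<^bsub>R\<^esub> r) \<in> fibre W" using x saturated_ideal_neg[OF W] unfolding fibre_def by blast
  then show "inv\<^bsub>TK.T\<^esub> x \<in> fibre W" using quot_neg[of a r] x WR[of r] by simp
  { fix y assume "y \<in> fibre W"
    then obtain b r' where y: "b \<in> nz" "r' \<in> W" "y = quot b r'" by (auto simp: fibre_def)
    have "b \<odot>\<^bsub>R\<^esub> r \<oplus>\<^bsub>R\<^esub> a \<odot>\<^bsub>R\<^esub> r' \<in> W"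
      using saturated_ideal_smult[OF W x(2), of b] saturated_ideal_smult[OF W y(2), of a] W x(1) y(1)
      by (simp add: saturated_ideal_def)
    moreover have "a \<otimes>\<^bsub>A\<^esub> b \<in> nz" using x y nz_mult by blast
    ultimately have "quot (a \<otimes>\<^bsub>A\<^esub> b) (b \<odot>\<^bsub>R\<^esub> r \<oplus>\<^bsub>R\<^esub> a \<odot>\<^bsub>R\<^esub> r') \<in> fibre W" unfolding fibre_def by blast
    then show "x \<otimes>\<^bsub>TK.T\<^esub> y \<in> fibre W" using quot_add[of a r b r'] x y WR by (simp del: mult_FactGroup) }
  fix z assume "z \<in> carrier TK.T"
  then obtain b t where z: "b \<in> nz" "t \<in> carrier R" "z = quot b t" by (rule quot_cases)
  have "t \<otimes>\<^bsub>R\<^esub> r \<in> W" using W z x by (simp add: saturated_ideal_def)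
  moreover have "b \<otimes>\<^bsub>A\<^esub> a \<in> nz" using x z nz_mult by blast
  ultimately have "quot (b \<otimes>\<^bsub>A\<^esub> a) (t \<otimes>\<^bsub>R\<^esub> r) \<in> fibre W" unfolding fibre_def by blast
  then show "mul.bimap z x \<in> fibre W" using quot_mult[of b t a r] x z WR by simp
qed

definition contraction where "contraction N = {r \<in> carrier R. quot \<one>\<^bsub>A\<^esub> r \<in> N}"

text \<open>Both \<open>a\<close> and its inverse act on the submodule, so the denominator has no
  influence on membership.\<close>

lemma quot_mem_iff:
  assumes N: "submodule N RK RKmod" and "a \<in> nz" "r \<in> carrier R"
  shows "quot a r \<in> N \<longleftrightarrow> r \<in> contraction N"
proof
  assume "quot a r \<in> N"
  then have "mul.bimap (quot \<one>\<^bsub>A\<^esub> (a \<odot>\<^bsub>R\<^esub> \<one>\<^bsub>R\<^esub>)) (quot a r) \<in> N"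
    using assms(2) by (intro submodule_RKmodD(4)[OF N] quot_closed) simp_all
  moreover have "mul.bimap (quot \<one>\<^bsub>A\<^esub> (a \<odot>\<^bsub>R\<^esub> \<one>\<^bsub>R\<^esub>)) (quot a r) = quot \<one>\<^bsub>A\<^esub> r"
    using assms quot_mult[of "\<one>\<^bsub>A\<^esub>" "a \<odot>\<^bsub>R\<^esub> \<one>\<^bsub>R\<^esub>" a r] quot_expand[of "\<one>\<^bsub>A\<^esub>" a r] by (simp add: alg.smult_assoc2)
  ultimately show "r \<in> contraction N" using assms by (simp add: contraction_def)
next
  assume "r \<in> contraction N"
  then have "mul.bimap (quot a \<one>\<^bsub>R\<^esub>) (quot \<one>\<^bsub>A\<^esub> r) \<in> N"
    using assms(2) by (intro submodule_RKmodD(4)[OF N] quot_closed) (simp_all add: contraction_def)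
  then show "quot a r \<in> N" using assms quot_mult[of a "\<one>\<^bsub>R\<^esub>" "\<one>\<^bsub>A\<^esub>" r] by simp
qed

lemma saturated_contraction:
  assumes N: "submodule N RK RKmod" shows "saturated_ideal (contraction N)"
  unfolding saturated_ideal_def
proof (intro conjI ballI impI)
  show "contraction N \<subseteq> carrier R" by (auto simp: contraction_def)
  show "\<zero>\<^bsub>R\<^esub> \<in> contraction N"
    using quot_zero[of "\<one>\<^bsub>A\<^esub>"] submodule_RKmodD(2)[OF N] by (simp add: contraction_def)
  show "r \<oplus>\<^bsub>R\<^esub> r' \<in> contraction N" if "r \<in> contraction N" "r' \<in> contraction N" for r r'
    using that quot_add_same[of "\<one>\<^bsub>A\<^esub>" r r'] submodule_RKmodD(3)[OF N, of "quot \<one>\<^bsub>A\<^esub> r" "quot \<one>\<^bsub>A\<^esub> r'"]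
    by (simp add: contraction_def)
  show "t \<otimes>\<^bsub>R\<^esub> r \<in> contraction N" if "t \<in> carrier R" "r \<in> contraction N" for t r
    using that quot_mult[of "\<one>\<^bsub>A\<^esub>" t "\<one>\<^bsub>A\<^esub>" r] submodule_RKmodD(4)[OF N, of "quot \<one>\<^bsub>A\<^esub> t" "quot \<one>\<^bsub>A\<^esub> r"]
    by (simp add: contraction_def)
  show "r \<in> contraction N" if "a \<in> nz" "r \<in> carrier R" "a \<odot>\<^bsub>R\<^esub> r \<in> contraction N" for a r
  proof -
    have "quot a (a \<odot>\<^bsub>R\<^esub> r) \<in> N" using that quot_mem_iff[OF N, of a "a \<odot>\<^bsub>R\<^esub> r"] by simp
    moreover have "quot a (a \<odot>\<^bsub>R\<^esub> r) = quot \<one>\<^bsub>A\<^esub> r" using that quot_expand[of "\<one>\<^bsub>A\<^esub>" a r] by simp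
    ultimately show ?thesis using that by (simp add: contraction_def)
  qed
qed

text \<open>Semisimplicity restated without fractions. Contractions of simple left ideals contain no
  saturated ideal strictly between zero and themselves, and no proper saturated ideal contains them
  all. These are the two facts that the construction of complements consumes.\<close>

theorem semisimple_generic_fibre:
  assumes "semisimple_ring RK"
  obtains LL where "\<And>L. L \<in> LL \<Longrightarrow> saturated_ideal L"
    and "\<And>L W. \<lbrakk>L \<in> LL; saturated_ideal W; W \<subseteq> L\<rbrakk> \<Longrightarrow> W = {\<zero>\<^bsub>R\<^esub>} \<or> W = L"
    and "\<And>W. \<lbrakk>saturated_ideal W; \<Union>LL \<subseteq> W\<rbrakk> \<Longrightarrow> \<one>\<^bsub>R\<^esub> \<in> W"
proof -
  obtain SS where S1: "\<forall>N\<in>SS. simple_submodule N RK RKmod"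
    and S2: "\<forall>x\<in>carrier RKmod. \<exists>!f. f \<in> (\<Pi>\<^sub>E N\<in>SS. N) \<and> finite {N \<in> SS. f N \<noteq> \<zero>\<^bsub>RKmod\<^esub>} \<and>
        x = (\<Oplus>\<^bsub>RKmod\<^esub>N\<in>{N \<in> SS. f N \<noteq> \<zero>\<^bsub>RKmod\<^esub>}. f N)"
    using assms unfolding semisimple_ring_def semisimple_module_def by (elim exE conjE)
  have sub: "submodule N RK RKmod" if "N \<in> SS" for N using S1 that by (simp add: simple_submodule_def)
  show ?thesis
  proof (rule that[of "contraction ` SS"])
    show "saturated_ideal L" if L: "L \<in> contraction ` SS" for L
      using L saturated_contraction sub by blast
    show "W = {\<zero>\<^bsub>R\<^esub>} \<or> W = L" if L: "L \<in> contraction ` SS" and W: "saturated_ideal W" and WL: "W \<subseteq> L" for L W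
    proof -
      obtain N where N: "N \<in> SS" "L = contraction N" using L by blast
      have WR: "r \<in> carrier R" if "r \<in> W" for r using W that by (auto simp: saturated_ideal_def)
      have "fibre W \<subseteq> N"
      proof
        fix x assume "x \<in> fibre W"
        then obtain a r where x: "a \<in> nz" "r \<in> W" "x = quot a r" by (auto simp: fibre_def)
        then have "r \<in> contraction N" using WL N by blast
        then show "x \<in> N" using quot_mem_iff[OF sub[OF N(1)] x(1) WR[OF x(2)]] x(3) by simp
      qed
      moreover have "\<forall>L. submodule L RK RKmod \<and> L \<subseteq> N \<longrightarrow> L = {\<zero>\<^bsub>RKmod\<^esub>} \<or> L = N"
        using bspec[OF S1 N(1)] unfolding simple_submodule_def by (elim conjE)
      ultimately have "fibre W = {\<zero>\<^bsub>RKmod\<^esub>} \<or> fibre W = N"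
        using submodule_fibre[OF W] by (elim allE[of _ "fibre W"] impE) (rule conjI)
      then have "fibre W = {\<one>\<^bsub>TK.T\<^esub>} \<or> fibre W = N" unfolding RKmod_simps .
      then show ?thesis
      proof
        assume z: "fibre W = {\<one>\<^bsub>TK.T\<^esub>}"
        have "r = \<zero>\<^bsub>R\<^esub>" if "r \<in> W" for r
        proof -
          have "quot \<one>\<^bsub>A\<^esub> r \<in> fibre W" using that by (intro fibreI) simp_all
          then have "quot \<one>\<^bsub>A\<^esub> r = quot \<one>\<^bsub>A\<^esub> \<zero>\<^bsub>R\<^esub>" using z quot_zero[of "\<one>\<^bsub>A\<^esub>"] by simp
          then show ?thesis using WR[OF that] by (subst (asm) quot_eq_iff) simp_all
        qed
        moreover have "\<zero>\<^bsub>R\<^esub> \<in> W" using W by (simp add: saturated_ideal_def)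
        ultimately show ?thesis by blast
      next
        assume z: "fibre W = N"
        have "L \<subseteq> W"
        proof
          fix r assume "r \<in> L"
          then have r: "r \<in> carrier R" "quot \<one>\<^bsub>A\<^esub> r \<in> fibre W" using N z by (simp_all add: contraction_def)
          then obtain a r' where ar: "a \<in> nz" "r' \<in> W" "quot \<one>\<^bsub>A\<^esub> r = quot a r'" by (auto simp: fibre_def)
          then have "a \<odot>\<^bsub>R\<^esub> r = r'" using r(1) WR[OF ar(2)] by (subst (asm) quot_eq_iff) simp_all
          then show "r \<in> W" using W ar r(1) by (auto simp: saturated_ideal_def)
        qed
        then show ?thesis using WL by blast
      qed
    qed
    show "\<one>\<^bsub>R\<^esub> \<in> W" if W: "saturated_ideal W" and LW: "\<Union>(contraction ` SS) \<subseteq> W" for W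
    proof -
      have NW: "N \<subseteq> fibre W" if N: "N \<in> SS" for N
      proof
        fix x assume x: "x \<in> N"
        then have "x \<in> carrier TK.T" using submodule_RKmodD(1)[OF sub[OF N]] by blast
        then obtain a r where ar: "a \<in> nz" "r \<in> carrier R" "x = quot a r" by (rule quot_cases)
        then have "r \<in> contraction N" using quot_mem_iff[OF sub[OF N] ar(1,2)] x by simp
        then have "r \<in> W" using LW N by blast
        then show "x \<in> fibre W" unfolding ar(3) by (rule fibreI[OF ar(1)])
      qed
      interpret G: abelian_group RKmod by (rule abelian_group_RKmod)
      note fW = submodule_RKmodD[OF submodule_fibre[OF W]]
      have one: "quot \<one>\<^bsub>A\<^esub> \<one>\<^bsub>R\<^esub> \<in> carrier RKmod" using quot_closed[of "\<one>\<^bsub>A\<^esub>" "\<one>\<^bsub>R\<^esub>"] by simp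
      obtain f where f: "f \<in> (\<Pi>\<^sub>E N\<in>SS. N)" "finite {N \<in> SS. f N \<noteq> \<zero>\<^bsub>RKmod\<^esub>}"
          "quot \<one>\<^bsub>A\<^esub> \<one>\<^bsub>R\<^esub> = (\<Oplus>\<^bsub>RKmod\<^esub>N\<in>{N \<in> SS. f N \<noteq> \<zero>\<^bsub>RKmod\<^esub>}. f N)"
        using ex1_implies_ex[OF S2[rule_format, OF one]] by (elim exE conjE)
      have "(\<Oplus>\<^bsub>RKmod\<^esub>N\<in>F. f N) \<in> fibre W" if "finite F" "F \<subseteq> SS" for F
        using that
      proof (induction F)
        case empty
        show ?case using fW(2) by simp
      next
        case (insert N F)
        have fN: "f M \<in> fibre W" if "M \<in> SS" for M using NW[OF that] PiE_mem[OF f(1) that] by blast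
        have c: "f \<in> F \<rightarrow> carrier RKmod" "f N \<in> carrier RKmod" using fN insert.prems fW(1) by auto
        have "(\<Oplus>\<^bsub>RKmod\<^esub>N\<in>insert N F. f N) = f N \<otimes>\<^bsub>TK.T\<^esub> (\<Oplus>\<^bsub>RKmod\<^esub>N\<in>F. f N)"
          using G.finsum_insert[OF insert.hyps c] by (simp only: RKmod_simps)
        also have "\<dots> \<in> fibre W" using fN insert by (intro fW(3)) auto
        finally show ?case .
      qed
      then have "quot \<one>\<^bsub>A\<^esub> \<one>\<^bsub>R\<^esub> \<in> fibre W" using f(2,3) by (metis (no_types, lifting) mem_Collect_eq subsetI)
      \<comment> \<open>The unit is a finite sum of elements of simple pieces, hence a fraction with
        numerator in \<open>W\<close>. So a nonzero multiple of one lies in \<open>W\<close>, and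
        saturation gives one itself.\<close>
      then obtain a r where ar: "a \<in> nz" "r \<in> W" "quot \<one>\<^bsub>A\<^esub> \<one>\<^bsub>R\<^esub> = quot a r" by (auto simp: fibre_def)
      have "r \<in> carrier R" using W ar(2) by (auto simp: saturated_ideal_def)
      then have "a \<odot>\<^bsub>R\<^esub> \<one>\<^bsub>R\<^esub> = r" using ar by (subst (asm) quot_eq_iff) simp_all
      then show ?thesis using W ar by (auto simp: saturated_ideal_def)
    qed
  qed
qed

end

section \<open>Complements of submodules up to torsion\<close>

context left_module
begin

text \<open>Closure under negation is left to multiplication by minus one.\<close>

definition submod where
  "submod C \<longleftrightarrow> C \<subseteq> carrier M \<and> \<zero>\<^bsub>M\<^esub> \<in> C \<and> (\<forall>x\<in>C. \<forall>y\<in>C. x \<oplus>\<^bsub>M\<^esub> y \<in> C) \<and> (\<forall>r\<in>carrier R. \<forall>x\<in>C. r \<odot>\<^bsub>M\<^esub> x \<in> C)"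

lemma smult_zero_right [simp]: "r \<in> carrier R \<Longrightarrow> r \<odot>\<^bsub>M\<^esub> \<zero>\<^bsub>M\<^esub> = \<zero>\<^bsub>M\<^esub>"
  using smult_r_distr[of r "\<zero>\<^bsub>M\<^esub>" "\<zero>\<^bsub>M\<^esub>"] by simp

lemma smult_zero_left [simp]: "x \<in> carrier M \<Longrightarrow> \<zero>\<^bsub>R\<^esub> \<odot>\<^bsub>M\<^esub> x = \<zero>\<^bsub>M\<^esub>"
  using smult_l_distr[of "\<zero>\<^bsub>R\<^esub>" "\<zero>\<^bsub>R\<^esub>" x] by simp

lemma smult_minus_one: "x \<in> carrier M \<Longrightarrow> (\<ominus>\<^bsub>R\<^esub> \<one>\<^bsub>R\<^esub>) \<odot>\<^bsub>M\<^esub> x = \<ominus>\<^bsub>M\<^esub> x"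
  using smult_l_distr[of "\<ominus>\<^bsub>R\<^esub> \<one>\<^bsub>R\<^esub>" "\<one>\<^bsub>R\<^esub>" x] by (intro M.minus_equality[symmetric]) (simp_all add: R.l_neg)

lemma submod_closed: "\<lbrakk>submod C; x \<in> C\<rbrakk> \<Longrightarrow> x \<in> carrier M"
  by (auto simp: submod_def)

lemma submod_add: "\<lbrakk>submod C; x \<in> C; y \<in> C\<rbrakk> \<Longrightarrow> x \<oplus>\<^bsub>M\<^esub> y \<in> C"
  by (simp add: submod_def)

lemma submod_zero: "submod C \<Longrightarrow> \<zero>\<^bsub>M\<^esub> \<in> C"
  by (simp add: submod_def)

lemma submod_smult: "\<lbrakk>submod C; r \<in> carrier R; x \<in> C\<rbrakk> \<Longrightarrow> r \<odot>\<^bsub>M\<^esub> x \<in> C"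
  by (simp add: submod_def)

lemma submod_neg: "\<lbrakk>submod C; x \<in> C\<rbrakk> \<Longrightarrow> \<ominus>\<^bsub>M\<^esub> x \<in> C"
  using submod_smult[of C "\<ominus>\<^bsub>R\<^esub> \<one>\<^bsub>R\<^esub>" x] smult_minus_one[OF submod_closed[of C x]] by simp

text \<open>Zorn's lemma supplies the candidate for a complement; semisimplicity will show that its
  sum with \<open>N\<close> fills the module up to torsion.\<close>

lemma maximal_disjoint_submod:
  assumes "submod N"
  obtains C where "submod C" "N \<inter> C = {\<zero>\<^bsub>M\<^esub>}"
    "\<And>C'. \<lbrakk>submod C'; N \<inter> C' = {\<zero>\<^bsub>M\<^esub>}; C \<subseteq> C'\<rbrakk> \<Longrightarrow> C' = C"
proof -
  let ?F = "{C. submod C \<and> N \<inter> C = {\<zero>\<^bsub>M\<^esub>}}"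
  have "\<exists>C\<in>?F. \<forall>X\<in>?F. C \<subseteq> X \<longrightarrow> X = C"
  proof (rule subset_Zorn_nonempty)
    have "{\<zero>\<^bsub>M\<^esub>} \<in> ?F" using submod_zero[OF assms] by (simp add: submod_def)
    then show "?F \<noteq> {}" by blast
    fix CC assume ne: "CC \<noteq> {}" and ch: "subset.chain ?F CC"
    have F: "X \<in> ?F" if "X \<in> CC" for X using ch that by (auto simp: subset_chain_def)
    then have F1: "submod X" and F2: "N \<inter> X = {\<zero>\<^bsub>M\<^esub>}" if "X \<in> CC" for X using that by simp_all
    have "submod (\<Union>CC)"
      unfolding submod_def
    proof (intro conjI ballI)
      show "\<Union>CC \<subseteq> carrier M" using F1 submod_closed by blast
      show "\<zero>\<^bsub>M\<^esub> \<in> \<Union>CC" using ne F1 submod_zero by blast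
      fix x assume "x \<in> \<Union>CC"
      then obtain X where X: "X \<in> CC" "x \<in> X" by blast
      show "r \<odot>\<^bsub>M\<^esub> x \<in> \<Union>CC" if "r \<in> carrier R" for r using submod_smult[OF F1[OF X(1)] that X(2)] X(1) by blast
      fix y assume "y \<in> \<Union>CC"
      then obtain Y where Y: "Y \<in> CC" "y \<in> Y" by blast
      have "X \<subseteq> Y \<or> Y \<subseteq> X" using ch X(1) Y(1) by (auto simp: subset_chain_def)
      then obtain Z where "Z \<in> CC" "x \<in> Z" "y \<in> Z" using X Y by blast
      then show "x \<oplus>\<^bsub>M\<^esub> y \<in> \<Union>CC" using submod_add[OF F1] by blast
    qed
    moreover have "N \<inter> \<Union>CC = {\<zero>\<^bsub>M\<^esub>}" using ne F2 by blast
    ultimately show "\<Union>CC \<in> ?F" by simp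
  qed
  then obtain C where C: "C \<in> ?F" "\<forall>X\<in>?F. C \<subseteq> X \<longrightarrow> X = C" by (rule bexE)
  show ?thesis by (rule that[of C]) (use C in auto)
qed

end

context generic_fibre
begin

text \<open>The elements of R that carry a given \<open>v\<close> into the saturation
  \<open>Q\<close> of N + C form a saturated ideal \<open>W\<close>. A minimal ideal
  \<open>L\<close> not inside \<open>W\<close> would meet it in zero only; then C + L v would still
  be disjoint from N, and maximality of C would put L v into C, hence L into \<open>W\<close>. So
  every \<open>L\<close> lies in \<open>W\<close>, which then contains one, that is,
  \<open>v\<close> lies in \<open>Q\<close>.\<close>

theorem submod_complement_up_to_torsion:
  assumes ss: "semisimple_ring RK" and "left_module R M"
    and torsion_free: "\<And>a v. \<lbrakk>a \<in> nz; v \<in> carrier M; (a \<odot>\<^bsub>R\<^esub> \<one>\<^bsub>R\<^esub>) \<odot>\<^bsub>M\<^esub> v = \<zero>\<^bsub>M\<^esub>\<rbrakk> \<Longrightarrow> v = \<zero>\<^bsub>M\<^esub>"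
    and N: "left_module.submod R M N"
  obtains C where "left_module.submod R M C" "N \<inter> C = {\<zero>\<^bsub>M\<^esub>}"
    "\<And>v. v \<in> carrier M \<Longrightarrow> \<exists>a\<in>nz. \<exists>n\<in>N. \<exists>c\<in>C. (a \<odot>\<^bsub>R\<^esub> \<one>\<^bsub>R\<^esub>) \<odot>\<^bsub>M\<^esub> v = n \<oplus>\<^bsub>M\<^esub> c"
proof -
  interpret M: left_module R M by fact
  obtain LL where L1: "\<And>L. L \<in> LL \<Longrightarrow> saturated_ideal L"
    and L2: "\<And>L W. \<lbrakk>L \<in> LL; saturated_ideal W; W \<subseteq> L\<rbrakk> \<Longrightarrow> W = {\<zero>\<^bsub>R\<^esub>} \<or> W = L"
    and L3: "\<And>W. \<lbrakk>saturated_ideal W; \<Union>LL \<subseteq> W\<rbrakk> \<Longrightarrow> \<one>\<^bsub>R\<^esub> \<in> W"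
    using semisimple_generic_fibre[OF ss] by blast
  obtain C where C: "M.submod C" and NC: "N \<inter> C = {\<zero>\<^bsub>M\<^esub>}"
    and max: "\<And>C'. \<lbrakk>M.submod C'; N \<inter> C' = {\<zero>\<^bsub>M\<^esub>}; C \<subseteq> C'\<rbrakk> \<Longrightarrow> C' = C"
    using M.maximal_disjoint_submod[OF N] by blast
  note cN = M.submod_closed[OF N] and cC = M.submod_closed[OF C]
  define Q where "Q = {w \<in> carrier M. \<exists>a\<in>nz. \<exists>n\<in>N. \<exists>c\<in>C. (a \<odot>\<^bsub>R\<^esub> \<one>\<^bsub>R\<^esub>) \<odot>\<^bsub>M\<^esub> w = n \<oplus>\<^bsub>M\<^esub> c}"
  have sc: "a \<odot>\<^bsub>R\<^esub> \<one>\<^bsub>R\<^esub> \<in> carrier R" if "a \<in> carrier A" for a using that by simp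
  have comm: "(a \<odot>\<^bsub>R\<^esub> \<one>\<^bsub>R\<^esub>) \<odot>\<^bsub>M\<^esub> (r \<odot>\<^bsub>M\<^esub> w) = r \<odot>\<^bsub>M\<^esub> ((a \<odot>\<^bsub>R\<^esub> \<one>\<^bsub>R\<^esub>) \<odot>\<^bsub>M\<^esub> w)"
    if "a \<in> carrier A" "r \<in> carrier R" "w \<in> carrier M" for a r w
    using that by (simp add: M.smult_assoc1[symmetric] alg.smult_assoc2 alg.smult_assoc3)
  have mult: "((a \<otimes>\<^bsub>A\<^esub> b) \<odot>\<^bsub>R\<^esub> \<one>\<^bsub>R\<^esub>) \<odot>\<^bsub>M\<^esub> w = (a \<odot>\<^bsub>R\<^esub> \<one>\<^bsub>R\<^esub>) \<odot>\<^bsub>M\<^esub> ((b \<odot>\<^bsub>R\<^esub> \<one>\<^bsub>R\<^esub>) \<odot>\<^bsub>M\<^esub> w)"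
    if "a \<in> carrier A" "b \<in> carrier A" "w \<in> carrier M" for a b w
    using that by (simp add: M.smult_assoc1[symmetric] alg.smult_assoc2 alg.smult_assoc1)
  have sumQ: "n \<oplus>\<^bsub>M\<^esub> c \<in> Q" if "n \<in> N" "c \<in> C" for n c
  proof -
    have "(\<one>\<^bsub>A\<^esub> \<odot>\<^bsub>R\<^esub> \<one>\<^bsub>R\<^esub>) \<odot>\<^bsub>M\<^esub> (n \<oplus>\<^bsub>M\<^esub> c) = n \<oplus>\<^bsub>M\<^esub> c" using that cN cC by simp
    then show ?thesis using that cN[of n] cC[of c] unfolding Q_def
      by (intro CollectI conjI bexI[of _ "\<one>\<^bsub>A\<^esub>"] bexI[of _ n] bexI[of _ c]) simp_all
  qed
  have Qadd: "w \<oplus>\<^bsub>M\<^esub> w' \<in> Q" if "w \<in> Q" "w' \<in> Q" for w w'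
  proof -
    obtain a n c where h: "w \<in> carrier M" "a \<in> nz" "n \<in> N" "c \<in> C" "(a \<odot>\<^bsub>R\<^esub> \<one>\<^bsub>R\<^esub>) \<odot>\<^bsub>M\<^esub> w = n \<oplus>\<^bsub>M\<^esub> c"
      using \<open>w \<in> Q\<close> unfolding Q_def by blast
    obtain a' n' c' where h': "w' \<in> carrier M" "a' \<in> nz" "n' \<in> N" "c' \<in> C" "(a' \<odot>\<^bsub>R\<^esub> \<one>\<^bsub>R\<^esub>) \<odot>\<^bsub>M\<^esub> w' = n' \<oplus>\<^bsub>M\<^esub> c'"
      using \<open>w' \<in> Q\<close> unfolding Q_def by blast
    let ?s = "\<lambda>a. a \<odot>\<^bsub>R\<^esub> \<one>\<^bsub>R\<^esub>"
    have aA: "a \<in> carrier A" "a' \<in> carrier A" using h h' by auto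
    have cl: "n \<in> carrier M" "c \<in> carrier M" "n' \<in> carrier M" "c' \<in> carrier M" using h h' cN cC by auto
    have "?s (a \<otimes>\<^bsub>A\<^esub> a') \<odot>\<^bsub>M\<^esub> (w \<oplus>\<^bsub>M\<^esub> w') = ?s a' \<odot>\<^bsub>M\<^esub> (?s a \<odot>\<^bsub>M\<^esub> w) \<oplus>\<^bsub>M\<^esub> ?s a \<odot>\<^bsub>M\<^esub> (?s a' \<odot>\<^bsub>M\<^esub> w')"
      using h(1) h'(1) aA mult[of a' a w] mult[of a a' w'] by (simp add: M.smult_r_distr A.m_comm)
    also have "\<dots> = (?s a' \<odot>\<^bsub>M\<^esub> n \<oplus>\<^bsub>M\<^esub> ?s a \<odot>\<^bsub>M\<^esub> n') \<oplus>\<^bsub>M\<^esub> (?s a' \<odot>\<^bsub>M\<^esub> c \<oplus>\<^bsub>M\<^esub> ?s a \<odot>\<^bsub>M\<^esub> c')"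
      unfolding h(5) h'(5) using cl aA by (simp add: M.smult_r_distr M.M.a_ac)
    finally have "?s (a \<otimes>\<^bsub>A\<^esub> a') \<odot>\<^bsub>M\<^esub> (w \<oplus>\<^bsub>M\<^esub> w') = (?s a' \<odot>\<^bsub>M\<^esub> n \<oplus>\<^bsub>M\<^esub> ?s a \<odot>\<^bsub>M\<^esub> n') \<oplus>\<^bsub>M\<^esub> (?s a' \<odot>\<^bsub>M\<^esub> c \<oplus>\<^bsub>M\<^esub> ?s a \<odot>\<^bsub>M\<^esub> c')" .
    moreover have "?s a' \<odot>\<^bsub>M\<^esub> n \<oplus>\<^bsub>M\<^esub> ?s a \<odot>\<^bsub>M\<^esub> n' \<in> N" "?s a' \<odot>\<^bsub>M\<^esub> c \<oplus>\<^bsub>M\<^esub> ?s a \<odot>\<^bsub>M\<^esub> c' \<in> C"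
      using h h' aA N C by (simp_all add: M.submod_add M.submod_smult)
    moreover have "a \<otimes>\<^bsub>A\<^esub> a' \<in> nz" using h h' nz_mult by blast
    ultimately show ?thesis using h(1) h'(1) unfolding Q_def by blast
  qed
  have Qsm: "t \<odot>\<^bsub>M\<^esub> w \<in> Q" if "t \<in> carrier R" "w \<in> Q" for t w
  proof -
    obtain a n c where h: "w \<in> carrier M" "a \<in> nz" "n \<in> N" "c \<in> C" "(a \<odot>\<^bsub>R\<^esub> \<one>\<^bsub>R\<^esub>) \<odot>\<^bsub>M\<^esub> w = n \<oplus>\<^bsub>M\<^esub> c"
      using \<open>w \<in> Q\<close> unfolding Q_def by blast
    have "(a \<odot>\<^bsub>R\<^esub> \<one>\<^bsub>R\<^esub>) \<odot>\<^bsub>M\<^esub> (t \<odot>\<^bsub>M\<^esub> w) = t \<odot>\<^bsub>M\<^esub> n \<oplus>\<^bsub>M\<^esub> t \<odot>\<^bsub>M\<^esub> c"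
      using h that(1) comm[of a t w] cN cC by (simp add: M.smult_r_distr)
    moreover have "t \<odot>\<^bsub>M\<^esub> n \<in> N" "t \<odot>\<^bsub>M\<^esub> c \<in> C" using h that(1) N C by (simp_all add: M.submod_smult)
    ultimately show ?thesis using h(1,2) that(1) unfolding Q_def by blast
  qed
  have Qsat: "w \<in> Q" if bw: "b \<in> nz" "w \<in> carrier M" "(b \<odot>\<^bsub>R\<^esub> \<one>\<^bsub>R\<^esub>) \<odot>\<^bsub>M\<^esub> w \<in> Q" for b w
  proof -
    obtain a n c where h: "a \<in> nz" "n \<in> N" "c \<in> C" "(a \<odot>\<^bsub>R\<^esub> \<one>\<^bsub>R\<^esub>) \<odot>\<^bsub>M\<^esub> ((b \<odot>\<^bsub>R\<^esub> \<one>\<^bsub>R\<^esub>) \<odot>\<^bsub>M\<^esub> w) = n \<oplus>\<^bsub>M\<^esub> c"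
      using bw(3) unfolding Q_def by blast
    have "((a \<otimes>\<^bsub>A\<^esub> b) \<odot>\<^bsub>R\<^esub> \<one>\<^bsub>R\<^esub>) \<odot>\<^bsub>M\<^esub> w = n \<oplus>\<^bsub>M\<^esub> c" using h that mult[of a b w] by simp
    moreover have "a \<otimes>\<^bsub>A\<^esub> b \<in> nz" using h that nz_mult by blast
    ultimately show ?thesis using h that unfolding Q_def by blast
  qed
  have zeroQ: "\<zero>\<^bsub>M\<^esub> \<in> Q" using sumQ[OF M.submod_zero[OF N] M.submod_zero[OF C]] by simp
  have "v \<in> Q" if v: "v \<in> carrier M" for v
  proof -
    define W where "W = {r \<in> carrier R. r \<odot>\<^bsub>M\<^esub> v \<in> Q}"
    have W: "saturated_ideal W"
      unfolding saturated_ideal_def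
    proof (intro conjI ballI impI)
      show "W \<subseteq> carrier R" by (auto simp: W_def)
      show "\<zero>\<^bsub>R\<^esub> \<in> W" using v zeroQ by (simp add: W_def)
      show "r \<oplus>\<^bsub>R\<^esub> r' \<in> W" if "r \<in> W" "r' \<in> W" for r r'
        using that v Qadd[of "r \<odot>\<^bsub>M\<^esub> v" "r' \<odot>\<^bsub>M\<^esub> v"] by (simp add: W_def M.smult_l_distr)
      show "t \<otimes>\<^bsub>R\<^esub> r \<in> W" if "t \<in> carrier R" "r \<in> W" for t r
        using that v Qsm[of t "r \<odot>\<^bsub>M\<^esub> v"] by (simp add: W_def M.smult_assoc1)
      show "r \<in> W" if "a \<in> nz" "r \<in> carrier R" "a \<odot>\<^bsub>R\<^esub> r \<in> W" for a r
      proof -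
        have "(a \<odot>\<^bsub>R\<^esub> r) \<odot>\<^bsub>M\<^esub> v = (a \<odot>\<^bsub>R\<^esub> \<one>\<^bsub>R\<^esub>) \<odot>\<^bsub>M\<^esub> (r \<odot>\<^bsub>M\<^esub> v)"
          using that v by (simp add: M.smult_assoc1[symmetric] alg.smult_assoc2)
        then show ?thesis using that v Qsat[of a "r \<odot>\<^bsub>M\<^esub> v"] by (simp add: W_def)
      qed
    qed
    have "L \<subseteq> W" if L: "L \<in> LL" for L
    proof (rule ccontr)
      assume LW: "\<not> L \<subseteq> W"
      note sL = L1[OF L]
      have LR: "r \<in> carrier R" if "r \<in> L" for r using sL that by (auto simp: saturated_ideal_def)
      have "saturated_ideal (L \<inter> W)" using sL W by (auto simp: saturated_ideal_def)
      then have LW0: "L \<inter> W = {\<zero>\<^bsub>R\<^esub>}" using L2[OF L, of "L \<inter> W"] LW by blast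
      define C' where "C' = {c \<oplus>\<^bsub>M\<^esub> r \<odot>\<^bsub>M\<^esub> v | c r. c \<in> C \<and> r \<in> L}"
      have C'I: "c \<oplus>\<^bsub>M\<^esub> r \<odot>\<^bsub>M\<^esub> v \<in> C'" if "c \<in> C" "r \<in> L" for c r using that unfolding C'_def by blast
      have L0: "\<zero>\<^bsub>R\<^esub> \<in> L" using sL by (simp add: saturated_ideal_def)
      have CC': "C \<subseteq> C'"
      proof
        fix c assume "c \<in> C"
        then show "c \<in> C'" using C'I[of c "\<zero>\<^bsub>R\<^esub>"] L0 v cC by simp
      qed
      have "M.submod C'"
        unfolding M.submod_def
      proof (intro conjI ballI)
        show "C' \<subseteq> carrier M" using cC LR v by (auto simp: C'_def)
        show "\<zero>\<^bsub>M\<^esub> \<in> C'" using CC' M.submod_zero[OF C] by blast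
        fix x assume "x \<in> C'"
        then obtain c r where x: "c \<in> C" "r \<in> L" "x = c \<oplus>\<^bsub>M\<^esub> r \<odot>\<^bsub>M\<^esub> v" by (auto simp: C'_def)
        show "t \<odot>\<^bsub>M\<^esub> x \<in> C'" if t: "t \<in> carrier R" for t
        proof -
          have "t \<odot>\<^bsub>M\<^esub> x = t \<odot>\<^bsub>M\<^esub> c \<oplus>\<^bsub>M\<^esub> (t \<otimes>\<^bsub>R\<^esub> r) \<odot>\<^bsub>M\<^esub> v"
            using t x v cC[of c] LR[of r] by (simp add: M.smult_r_distr M.smult_assoc1)
          moreover have "t \<odot>\<^bsub>M\<^esub> c \<in> C" using M.submod_smult[OF C t x(1)] .
          moreover have "t \<otimes>\<^bsub>R\<^esub> r \<in> L" using sL t x by (simp add: saturated_ideal_def)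
          ultimately show ?thesis using C'I by simp
        qed
        fix y assume "y \<in> C'"
        then obtain c' r' where y: "c' \<in> C" "r' \<in> L" "y = c' \<oplus>\<^bsub>M\<^esub> r' \<odot>\<^bsub>M\<^esub> v" by (auto simp: C'_def)
        have "x \<oplus>\<^bsub>M\<^esub> y = (c \<oplus>\<^bsub>M\<^esub> c') \<oplus>\<^bsub>M\<^esub> (r \<oplus>\<^bsub>R\<^esub> r') \<odot>\<^bsub>M\<^esub> v"
          using x y v cC[of c] cC[of c'] LR[of r] LR[of r'] by (simp add: M.smult_l_distr M.M.a_ac)
        moreover have "c \<oplus>\<^bsub>M\<^esub> c' \<in> C" using M.submod_add[OF C x(1) y(1)] .
        moreover have "r \<oplus>\<^bsub>R\<^esub> r' \<in> L" using sL x y by (simp add: saturated_ideal_def)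
        ultimately show "x \<oplus>\<^bsub>M\<^esub> y \<in> C'" using C'I by simp
      qed
      moreover have "N \<inter> C' = {\<zero>\<^bsub>M\<^esub>}"
      proof -
        have "w = \<zero>\<^bsub>M\<^esub>" if w: "w \<in> N" "w \<in> C'" for w
        proof -
          obtain c r where cr: "c \<in> C" "r \<in> L" "w = c \<oplus>\<^bsub>M\<^esub> r \<odot>\<^bsub>M\<^esub> v" using w(2) by (auto simp: C'_def)
          \<comment> \<open>If \<open>w = c + r v\<close> lies in N, then \<open>r v\<close> lies in
            N + C, so \<open>r\<close> belongs to both \<open>L\<close> and \<open>W\<close> and
            vanishes.\<close>
          have "r \<odot>\<^bsub>M\<^esub> v = w \<oplus>\<^bsub>M\<^esub> (\<ominus>\<^bsub>M\<^esub> c)"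
            using cr v cC[of c] LR[of r] by (simp add: M.M.a_ac M.M.r_neg2)
          also have "\<dots> \<in> Q" using sumQ[OF w(1) M.submod_neg[OF C cr(1)]] .
          finally have "r \<in> L \<inter> W" using cr LR by (simp add: W_def)
          then have "r = \<zero>\<^bsub>R\<^esub>" using LW0 by blast
          then have "w = c" using cr v cC[of c] by simp
          then show ?thesis using w cr NC by blast
        qed
        then show ?thesis using M.submod_zero[OF N] M.submod_zero[OF C] CC' by blast
      qed
      ultimately have "C' = C" using max CC' by blast
      have "L \<subseteq> W"
      proof
        fix r assume r: "r \<in> L"
        have "\<zero>\<^bsub>M\<^esub> \<oplus>\<^bsub>M\<^esub> r \<odot>\<^bsub>M\<^esub> v \<in> C" using C'I[OF M.submod_zero[OF C] r] \<open>C' = C\<close> by simp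
        then have "\<zero>\<^bsub>M\<^esub> \<oplus>\<^bsub>M\<^esub> (r \<odot>\<^bsub>M\<^esub> v) \<in> Q" using LR[OF r] v by (intro sumQ M.submod_zero[OF N]) simp
        then show "r \<in> W" using LR[OF r] v by (simp add: W_def)
      qed
      then show False using LW by blast
    qed
    then have "\<one>\<^bsub>R\<^esub> \<in> W" by (intro L3[OF W]) blast
    then show ?thesis using v by (simp add: W_def)
  qed
  then show ?thesis by (intro that[OF C NC]) (auto simp: Q_def)
qed

end

section \<open>Double centralisers up to a denominator\<close>

text \<open>Used with \<open>S\<close> a basis of P over A: the tuple of all basis elements is then
  a single vector, and its image under an A-linear map, applied slot by slot, determines that
  map.\<close>

definition power_module :: "'s set \<Rightarrow> ('r, 'p, 'f) module_scheme \<Rightarrow> ('r, 's \<Rightarrow> 'p) module" where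
  "power_module S P =
    \<lparr>carrier = S \<rightarrow>\<^sub>E carrier P, monoid.mult = undefined, one = undefined, zero = (\<lambda>s\<in>S. \<zero>\<^bsub>P\<^esub>),
     add = (\<lambda>u v. \<lambda>s\<in>S. u s \<oplus>\<^bsub>P\<^esub> v s), smult = (\<lambda>r u. \<lambda>s\<in>S. r \<odot>\<^bsub>P\<^esub> u s)\<rparr>"

lemma power_module_simps [simp]:
  "carrier (power_module S P) = (S \<rightarrow>\<^sub>E carrier P)" "\<zero>\<^bsub>power_module S P\<^esub> = (\<lambda>s\<in>S. \<zero>\<^bsub>P\<^esub>)"
  "u \<oplus>\<^bsub>power_module S P\<^esub> v = (\<lambda>s\<in>S. u s \<oplus>\<^bsub>P\<^esub> v s)" "r \<odot>\<^bsub>power_module S P\<^esub> u = (\<lambda>s\<in>S. r \<odot>\<^bsub>P\<^esub> u s)"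
  by (simp_all add: power_module_def)

lemma power_module_eqI:
  assumes "u \<in> carrier (power_module S P)" "v \<in> carrier (power_module S P)" "\<And>s. s \<in> S \<Longrightarrow> u s = v s"
  shows "u = v"
  using assms by (auto intro: PiE_ext)

lemma (in left_module) left_module_power: "left_module R (power_module S M)"
proof (intro left_module.intro left_module_axioms.intro)
  show "ring R" ..
  let ?V = "power_module S M"
  have app: "u s \<in> carrier M" if "u \<in> carrier ?V" "s \<in> S" for u s using that by auto
  show "abelian_group ?V"
  proof (rule abelian_groupI)
    fix u assume u: "u \<in> carrier ?V"
    show "\<exists>w\<in>carrier ?V. w \<oplus>\<^bsub>?V\<^esub> u = \<zero>\<^bsub>?V\<^esub>"
      by (intro bexI[of _ "\<lambda>s\<in>S. \<ominus>\<^bsub>M\<^esub> u s"] power_module_eqI[of _ S M]) (use app[OF u] in \<open>auto simp: M.l_neg\<close>)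
    show "\<zero>\<^bsub>?V\<^esub> \<oplus>\<^bsub>?V\<^esub> u = u" by (rule power_module_eqI[of _ S M]) (use u app[OF u] in auto)
    fix v assume v: "v \<in> carrier ?V"
    show "u \<oplus>\<^bsub>?V\<^esub> v \<in> carrier ?V" using app[OF u] app[OF v] by auto
    show "u \<oplus>\<^bsub>?V\<^esub> v = v \<oplus>\<^bsub>?V\<^esub> u" using app[OF u] app[OF v] by (auto simp: fun_eq_iff M.a_comm)
    fix w assume w: "w \<in> carrier ?V"
    show "u \<oplus>\<^bsub>?V\<^esub> v \<oplus>\<^bsub>?V\<^esub> w = u \<oplus>\<^bsub>?V\<^esub> (v \<oplus>\<^bsub>?V\<^esub> w)"
      using app[OF u] app[OF v] app[OF w] by (auto simp: fun_eq_iff M.a_assoc)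
  qed auto
  fix r u assume r: "r \<in> carrier R" and u: "u \<in> carrier ?V"
  show "r \<odot>\<^bsub>?V\<^esub> u \<in> carrier ?V" using r app[OF u] by auto
  { fix t assume t: "t \<in> carrier R"
    show "(r \<oplus>\<^bsub>R\<^esub> t) \<odot>\<^bsub>?V\<^esub> u = r \<odot>\<^bsub>?V\<^esub> u \<oplus>\<^bsub>?V\<^esub> t \<odot>\<^bsub>?V\<^esub> u"
      using r t app[OF u] by (auto simp: fun_eq_iff smult_l_distr)
    show "r \<otimes>\<^bsub>R\<^esub> t \<odot>\<^bsub>?V\<^esub> u = r \<odot>\<^bsub>?V\<^esub> (t \<odot>\<^bsub>?V\<^esub> u)"
      using r t app[OF u] by (auto simp: fun_eq_iff smult_assoc1) }
  fix v assume v: "v \<in> carrier ?V"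
  show "r \<odot>\<^bsub>?V\<^esub> (u \<oplus>\<^bsub>?V\<^esub> v) = r \<odot>\<^bsub>?V\<^esub> u \<oplus>\<^bsub>?V\<^esub> r \<odot>\<^bsub>?V\<^esub> v"
    using r app[OF u] app[OF v] by (auto simp: fun_eq_iff smult_r_distr)
next
  fix u assume u: "u \<in> carrier (power_module S M)"
  show "\<one>\<^bsub>R\<^esub> \<odot>\<^bsub>power_module S M\<^esub> u = u" by (rule power_module_eqI[of _ S M]) (use u in \<open>auto simp: PiE_iff\<close>)
qed

text \<open>Two decompositions of one vector along two submodules differ by an element lying in
  both; this is behind the uniqueness of the projection below.\<close>

lemma (in abelian_group) diff_eq_diff_if_add_eq_add:
  assumes cl: "p \<in> carrier G" "n \<in> carrier G" "c \<in> carrier G" "c' \<in> carrier G" and eq: "p \<oplus> c' = n \<oplus> c"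
  shows "p \<oplus> (\<ominus> n) = c \<oplus> (\<ominus> c')"
proof -
  have "n \<oplus> (c \<oplus> (\<ominus> c')) = (n \<oplus> c) \<oplus> (\<ominus> c')" using cl by (simp add: a_assoc)
  also have "\<dots> = (p \<oplus> c') \<oplus> (\<ominus> c')" by (simp only: eq)
  also have "\<dots> = p" using cl by (simp add: a_assoc r_neg)
  finally have p: "n \<oplus> (c \<oplus> (\<ominus> c')) = p" .
  have "c \<oplus> (\<ominus> c') = (c \<oplus> (\<ominus> c')) \<oplus> (n \<oplus> (\<ominus> n))" using cl by (simp add: r_neg)
  also have "\<dots> = ((c \<oplus> (\<ominus> c')) \<oplus> n) \<oplus> (\<ominus> n)" using cl by (intro a_assoc[symmetric]) simp_all
  also have "(c \<oplus> (\<ominus> c')) \<oplus> n = p" unfolding p[symmetric] using cl by (intro a_comm) simp_all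
  finally show ?thesis ..
qed

locale lattice_representation =
  G: generic_fibre A R SR + algebra_module A R P + FP: free_module A "restrict_scalars R P" S
  for A :: "('a, 'e) ring_scheme" and R :: "('a, 'r, 'd) module_scheme" and SR
    and P :: "('r, 'p, 'f) module_scheme" and S
begin

abbreviation sc (infixr "\<star>" 75) where "a \<star> p \<equiv> (a \<odot>\<^bsub>R\<^esub> \<one>\<^bsub>R\<^esub>) \<odot>\<^bsub>P\<^esub> p"

abbreviation V where "V \<equiv> power_module S P"

sublocale V: left_module R V by (rule P.left_module_power)

lemma S_closed_P [simp]: "s \<in> S \<Longrightarrow> s \<in> carrier P"
  using FP.S_closed[of s] by simp

lemma torsion_free:
  assumes "a \<in> G.nz" "p \<in> carrier P" "a \<star> p = \<zero>\<^bsub>P\<^esub>" shows "p = \<zero>\<^bsub>P\<^esub>"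
proof (rule FP.coord_eqI[simplified])
  fix s assume s: "s \<in> S"
  have "a \<otimes>\<^bsub>A\<^esub> FP.coord p s = FP.coord \<zero>\<^bsub>P\<^esub> s"
    using FP.coord_smult[of a p s] assms s by simp
  also have "\<dots> = \<zero>\<^bsub>A\<^esub>" using FP.coord_zero[OF s] by simp
  finally have "FP.coord p s = \<zero>\<^bsub>A\<^esub>"
    using assms s FP.coord_closed[of p s] by (simp add: G.A.integral_iff)
  then show "FP.coord p s = FP.coord \<zero>\<^bsub>P\<^esub> s" using FP.coord_zero[OF s] by simp
qed (use assms in simp_all)

definition unit where "unit i p = (\<lambda>s\<in>S. if s = i then p else \<zero>\<^bsub>P\<^esub>)"

lemma unit_closed [simp]: "p \<in> carrier P \<Longrightarrow> unit i p \<in> carrier V"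
  by (auto simp: unit_def)

lemma power_induct:
  assumes "v \<in> carrier V" "Z \<zero>\<^bsub>V\<^esub>" "\<And>i p. \<lbrakk>i \<in> S; p \<in> carrier P\<rbrakk> \<Longrightarrow> Z (unit i p)"
    "\<And>u v. \<lbrakk>u \<in> carrier V; v \<in> carrier V; Z u; Z v\<rbrakk> \<Longrightarrow> Z (u \<oplus>\<^bsub>V\<^esub> v)"
  shows "Z v"
proof -
  define cut where "cut F = (\<lambda>s\<in>S. if s \<in> F then v s else \<zero>\<^bsub>P\<^esub>)" for F
  have vs: "v s \<in> carrier P" if "s \<in> S" for s using assms(1) that by auto
  have cut: "cut F \<in> carrier V" for F using vs by (auto simp: cut_def)
  have "Z (cut F)" if "F \<subseteq> S" for F
    using finite_subset[OF that FP.finite_S] that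
  proof (induction F)
    case empty
    have "cut {} = \<zero>\<^bsub>V\<^esub>" by (simp add: cut_def)
    then show ?case using assms(2) by (simp only:)
  next
    case (insert i F)
    have "cut (insert i F) = unit i (v i) \<oplus>\<^bsub>V\<^esub> cut F"
      by (rule power_module_eqI[of _ S P])
        (use insert.hyps insert.prems vs cut in \<open>auto simp: cut_def unit_def\<close>)
    moreover have "Z (unit i (v i) \<oplus>\<^bsub>V\<^esub> cut F)"
    proof (rule assms(4))
      show "Z (unit i (v i))" by (rule assms(3)) (use insert.prems vs in auto)
      show "Z (cut F)" using insert by blast
    qed (use cut insert.prems vs unit_closed in \<open>auto simp del: power_module_simps\<close>)
    ultimately show ?case by (simp only:)
  qed
  moreover have "cut S = v" by (rule power_module_eqI[of _ S P]) (use assms(1) vs in \<open>auto simp: cut_def\<close>)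
  ultimately show ?thesis by (metis order_refl)
qed

text \<open>The product of the individual denominators serves all of \<open>F\<close>, since
  \<open>Q\<close> survives multiplication of its first argument.\<close>

lemma common_denominator:
  assumes "finite F" "\<And>x. x \<in> F \<Longrightarrow> \<exists>a\<in>G.nz. Q a x"
    and "\<And>a b x. \<lbrakk>a \<in> G.nz; b \<in> G.nz; x \<in> F; Q a x\<rbrakk> \<Longrightarrow> Q (a \<otimes>\<^bsub>A\<^esub> b) x"
  shows "\<exists>a\<in>G.nz. \<forall>x\<in>F. Q a x"
  using assms
proof (induction F)
  case empty
  show ?case by (intro bexI[of _ "\<one>\<^bsub>A\<^esub>"]) simp_all
next
  case (insert x F)
  have "\<exists>a\<in>G.nz. \<forall>x\<in>F. Q a x"
  proof (rule insert.IH)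
    show "\<exists>a\<in>G.nz. Q a y" if "y \<in> F" for y using insert.prems(1)[of y] that by blast
    show "Q (a \<otimes>\<^bsub>A\<^esub> b) y" if "a \<in> G.nz" "b \<in> G.nz" "y \<in> F" "Q a y" for a b y
      using insert.prems(2)[of a b y] that by blast
  qed
  then obtain a where a: "a \<in> G.nz" "\<forall>x\<in>F. Q a x" by blast
  obtain b where b: "b \<in> G.nz" "Q b x" using insert.prems(1)[of x] by blast
  have "Q (a \<otimes>\<^bsub>A\<^esub> b) y" if "y \<in> insert x F" for y
  proof (cases "y = x")
    case True
    have "Q (b \<otimes>\<^bsub>A\<^esub> a) x" using insert.prems(2)[of b a x] a b by blast
    moreover have "b \<otimes>\<^bsub>A\<^esub> a = a \<otimes>\<^bsub>A\<^esub> b" using a b by (intro G.A.m_comm) auto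
    ultimately show ?thesis using True by simp
  next
    case False
    then show ?thesis using insert.prems(2)[of a b y] a b that by blast
  qed
  moreover have "a \<otimes>\<^bsub>A\<^esub> b \<in> G.nz" using a b G.nz_mult by blast
  ultimately show ?case by blast
qed

text \<open>
  For the tuple \<open>e\<close> of basis elements of \<open>P\<close>, a complement up to torsion of \<open>Re\<close> in \<open>P\<^sup>S\<close> yields an
  \<open>R\<close>-linear \<open>\<pi> : P\<^sup>S \<rightarrow> Re\<close> that is multiplication by some \<open>a \<noteq> 0\<close> on \<open>Re\<close>. Its matrix entries lie in
  \<open>End\<^sub>R(P)\<close>, so \<open>\<pi>\<close> commutes with \<open>\<sigma>\<close> and \<open>a \<sigma>(e) = \<pi>(\<sigma>(e)) \<in> Re\<close>.
\<close>

theorem DEnd_uniform_denominator: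
  assumes ss: "semisimple_ring G.RK"
  shows "\<exists>a\<in>G.nz. \<forall>\<sigma>\<in>carrier (DEnd_ring R P). \<exists>r\<in>carrier R. \<forall>p\<in>carrier P. a \<star> \<sigma> p = r \<odot>\<^bsub>P\<^esub> p"
proof -
  define e where "e r = (\<lambda>s\<in>S. r \<odot>\<^bsub>P\<^esub> s)" for r
  define N where "N = e ` carrier R"
  have e_closed: "e r \<in> carrier V" if "r \<in> carrier R" for r using that by (auto simp: e_def)
  have subN: "V.submod N"
    unfolding V.submod_def N_def
  proof (intro conjI ballI)
    show "e ` carrier R \<subseteq> carrier V" using e_closed by blast
    have "\<zero>\<^bsub>V\<^esub> = e \<zero>\<^bsub>R\<^esub>" by (auto simp: e_def fun_eq_iff)
    then show "\<zero>\<^bsub>V\<^esub> \<in> e ` carrier R" by (rule image_eqI) simp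
    fix x assume "x \<in> e ` carrier R"
    then obtain r where r: "r \<in> carrier R" "x = e r" by blast
    show "t \<odot>\<^bsub>V\<^esub> x \<in> e ` carrier R" if t: "t \<in> carrier R" for t
    proof (rule image_eqI)
      show "t \<odot>\<^bsub>V\<^esub> x = e (t \<otimes>\<^bsub>R\<^esub> r)" using t r by (auto simp: e_def fun_eq_iff P.smult_assoc1)
    qed (use r t in simp)
    fix y assume "y \<in> e ` carrier R"
    then obtain r' where r': "r' \<in> carrier R" "y = e r'" by blast
    show "x \<oplus>\<^bsub>V\<^esub> y \<in> e ` carrier R"
    proof (rule image_eqI)
      show "x \<oplus>\<^bsub>V\<^esub> y = e (r \<oplus>\<^bsub>R\<^esub> r')" using r r' by (auto simp: e_def fun_eq_iff P.smult_l_distr)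
    qed (use r r' in simp)
  qed
  have scV: "(a \<odot>\<^bsub>R\<^esub> \<one>\<^bsub>R\<^esub>) \<odot>\<^bsub>V\<^esub> v = (\<lambda>s\<in>S. a \<star> v s)" for a v by simp
  have tf: "v = \<zero>\<^bsub>V\<^esub>" if "a \<in> G.nz" "v \<in> carrier V" "(a \<odot>\<^bsub>R\<^esub> \<one>\<^bsub>R\<^esub>) \<odot>\<^bsub>V\<^esub> v = \<zero>\<^bsub>V\<^esub>" for a v
  proof (rule power_module_eqI[of _ S P])
    fix s assume s: "s \<in> S"
    have "a \<star> v s = \<zero>\<^bsub>P\<^esub>" using fun_cong[OF that(3), of s] s by simp
    then show "v s = \<zero>\<^bsub>V\<^esub> s" using torsion_free[OF that(1), of "v s"] that(2) s by auto
  qed (use that V.M.zero_closed in \<open>simp_all del: power_module_simps\<close>)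
  obtain C where C: "V.submod C" "N \<inter> C = {\<zero>\<^bsub>V\<^esub>}"
    and compl: "\<And>v. v \<in> carrier V \<Longrightarrow> \<exists>a\<in>G.nz. \<exists>n\<in>N. \<exists>c\<in>C. (a \<odot>\<^bsub>R\<^esub> \<one>\<^bsub>R\<^esub>) \<odot>\<^bsub>V\<^esub> v = n \<oplus>\<^bsub>V\<^esub> c"
  proof (rule G.submod_complement_up_to_torsion[OF ss V.left_module_axioms _ subN])
    show "v = \<zero>\<^bsub>V\<^esub>" if "a \<in> G.nz" "v \<in> carrier V" "(a \<odot>\<^bsub>R\<^esub> \<one>\<^bsub>R\<^esub>) \<odot>\<^bsub>V\<^esub> v = \<zero>\<^bsub>V\<^esub>" for a v
      using that by (rule tf)
  qed (rule that)
  note cN = V.submod_closed[OF subN] and cC = V.submod_closed[OF C(1)]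
  \<comment> \<open>For fixed \<open>a\<close>, the vectors \<open>v\<close> with \<open>a v\<close>
    in N + C are closed under addition and scalars from A, so generators decide.\<close>
  define Z where "Z a v \<longleftrightarrow> (\<exists>n\<in>N. \<exists>c\<in>C. (a \<odot>\<^bsub>R\<^esub> \<one>\<^bsub>R\<^esub>) \<odot>\<^bsub>V\<^esub> v = n \<oplus>\<^bsub>V\<^esub> c)" for a v
  have Z_add: "Z a (u \<oplus>\<^bsub>V\<^esub> v)" if "a \<in> carrier A" "u \<in> carrier V" "v \<in> carrier V" and Zu: "Z a u" and Zv: "Z a v" for a u v
  proof -
    obtain n c where n: "n \<in> N" "c \<in> C" "(a \<odot>\<^bsub>R\<^esub> \<one>\<^bsub>R\<^esub>) \<odot>\<^bsub>V\<^esub> u = n \<oplus>\<^bsub>V\<^esub> c" using Zu unfolding Z_def by blast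
    obtain n' c' where n': "n' \<in> N" "c' \<in> C" "(a \<odot>\<^bsub>R\<^esub> \<one>\<^bsub>R\<^esub>) \<odot>\<^bsub>V\<^esub> v = n' \<oplus>\<^bsub>V\<^esub> c'" using Zv unfolding Z_def by blast
    have "(a \<odot>\<^bsub>R\<^esub> \<one>\<^bsub>R\<^esub>) \<odot>\<^bsub>V\<^esub> (u \<oplus>\<^bsub>V\<^esub> v) = (n \<oplus>\<^bsub>V\<^esub> c) \<oplus>\<^bsub>V\<^esub> (n' \<oplus>\<^bsub>V\<^esub> c')"
      using that(1-3) V.smult_r_distr[of "a \<odot>\<^bsub>R\<^esub> \<one>\<^bsub>R\<^esub>" u v] n(3) n'(3) by (simp del: power_module_simps)
    also have "\<dots> = (n \<oplus>\<^bsub>V\<^esub> n') \<oplus>\<^bsub>V\<^esub> (c \<oplus>\<^bsub>V\<^esub> c')"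
      using cN[OF n(1)] cN[OF n'(1)] cC[OF n(2)] cC[OF n'(2)] by (simp add: V.M.a_ac del: power_module_simps)
    finally show ?thesis
      using V.submod_add[OF subN n(1) n'(1)] V.submod_add[OF C(1) n(2) n'(2)] unfolding Z_def by blast
  qed
  have Z_smult: "Z a ((b \<odot>\<^bsub>R\<^esub> \<one>\<^bsub>R\<^esub>) \<odot>\<^bsub>V\<^esub> v)" and Z_mult: "Z (a \<otimes>\<^bsub>A\<^esub> b) v"
    if "a \<in> carrier A" "b \<in> carrier A" "v \<in> carrier V" and Zv: "Z a v" for a b v
  proof -
    obtain n c where n: "n \<in> N" "c \<in> C" "(a \<odot>\<^bsub>R\<^esub> \<one>\<^bsub>R\<^esub>) \<odot>\<^bsub>V\<^esub> v = n \<oplus>\<^bsub>V\<^esub> c" using Zv unfolding Z_def by blast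
    let ?a = "a \<odot>\<^bsub>R\<^esub> \<one>\<^bsub>R\<^esub>" and ?b = "b \<odot>\<^bsub>R\<^esub> \<one>\<^bsub>R\<^esub>"
    have ab: "?a \<in> carrier R" "?b \<in> carrier R" using that by simp_all
    have 1: "?b \<odot>\<^bsub>V\<^esub> (?a \<odot>\<^bsub>V\<^esub> v) = ?b \<odot>\<^bsub>V\<^esub> n \<oplus>\<^bsub>V\<^esub> ?b \<odot>\<^bsub>V\<^esub> c"
      unfolding n(3) using ab cN[OF n(1)] cC[OF n(2)] by (intro V.smult_r_distr)
    have 2: "?b \<odot>\<^bsub>V\<^esub> (?a \<odot>\<^bsub>V\<^esub> v) = (?b \<otimes>\<^bsub>R\<^esub> ?a) \<odot>\<^bsub>V\<^esub> v" using V.smult_assoc1[of ?b ?a v] ab that by (simp del: power_module_simps)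
    have 3: "?a \<odot>\<^bsub>V\<^esub> (?b \<odot>\<^bsub>V\<^esub> v) = (?b \<otimes>\<^bsub>R\<^esub> ?a) \<odot>\<^bsub>V\<^esub> v"
      using V.smult_assoc1[of ?a ?b v] ab that scalar_central[of a ?b] by (simp del: power_module_simps)
    have 4: "?b \<otimes>\<^bsub>R\<^esub> ?a = (a \<otimes>\<^bsub>A\<^esub> b) \<odot>\<^bsub>R\<^esub> \<one>\<^bsub>R\<^esub>" using that scalar_mult[of b a] by (simp add: G.A.m_comm)
    have "?b \<odot>\<^bsub>V\<^esub> n \<in> N" "?b \<odot>\<^bsub>V\<^esub> c \<in> C"
      using V.submod_smult[OF subN ab(2) n(1)] V.submod_smult[OF C(1) ab(2) n(2)] .
    then show "Z a (?b \<odot>\<^bsub>V\<^esub> v)" "Z (a \<otimes>\<^bsub>A\<^esub> b) v" unfolding Z_def using 1 2 3 4 by metis+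
  qed
  have Z_zero: "Z a \<zero>\<^bsub>V\<^esub>" if "a \<in> carrier A" for a
  proof -
    have "(a \<odot>\<^bsub>R\<^esub> \<one>\<^bsub>R\<^esub>) \<odot>\<^bsub>V\<^esub> \<zero>\<^bsub>V\<^esub> = \<zero>\<^bsub>V\<^esub> \<oplus>\<^bsub>V\<^esub> \<zero>\<^bsub>V\<^esub>"
      using that V.smult_zero_right[of "a \<odot>\<^bsub>R\<^esub> \<one>\<^bsub>R\<^esub>"] V.M.zero_closed by (simp del: power_module_simps)
    then show ?thesis using V.submod_zero[OF subN] V.submod_zero[OF C(1)] unfolding Z_def by blast
  qed
  \<comment> \<open>The vectors with one basis element in one slot generate \<open>P\<^sup>S\<close>
    over A. There are finitely many, so they have a common denominator, which then works for every
    vector.\<close>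
  have "\<exists>a\<in>G.nz. \<forall>x\<in>S \<times> S. Z a (unit (fst x) (snd x))"
  proof (rule common_denominator)
    show "finite (S \<times> S)" using FP.finite_S by simp
    show "\<exists>a\<in>G.nz. Z a (unit (fst x) (snd x))" if "x \<in> S \<times> S" for x
      unfolding Z_def by (rule compl[OF unit_closed]) (use that in auto)
    show "Z (a \<otimes>\<^bsub>A\<^esub> b) (unit (fst x) (snd x))"
      if "a \<in> G.nz" "b \<in> G.nz" "x \<in> S \<times> S" "Z a (unit (fst x) (snd x))" for a b x
      by (rule Z_mult) (use that unit_closed in \<open>auto simp del: power_module_simps\<close>)
  qed
  then obtain a where a: "a \<in> G.nz" and Zunit: "\<And>i t. \<lbrakk>i \<in> S; t \<in> S\<rbrakk> \<Longrightarrow> Z a (unit i t)" by auto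
  have aA: "a \<in> carrier A" using a by blast
  have Zp: "Z a (unit i p)" if i: "i \<in> S" and p: "p \<in> carrier P" for i p
  proof (rule FP.span_induct[of p "\<lambda>p. Z a (unit i p)"])
    have "unit i \<zero>\<^bsub>P\<^esub> = \<zero>\<^bsub>V\<^esub>" by (auto simp: unit_def fun_eq_iff)
    then show "Z a (unit i \<zero>\<^bsub>RP\<^esub>)" using Z_zero[OF aA] by simp
    fix x y assume xy: "x \<in> carrier RP" "y \<in> carrier RP" "Z a (unit i x)" "Z a (unit i y)"
    have "unit i (x \<oplus>\<^bsub>RP\<^esub> y) = unit i x \<oplus>\<^bsub>V\<^esub> unit i y" using xy(1,2) by (auto simp: unit_def fun_eq_iff)
    then show "Z a (unit i (x \<oplus>\<^bsub>RP\<^esub> y))"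
      using Z_add[OF aA unit_closed unit_closed xy(3,4)] xy(1,2) by simp
  next
    fix b s assume bs: "b \<in> carrier A" "s \<in> S"
    have "unit i (b \<odot>\<^bsub>RP\<^esub> s) = (b \<odot>\<^bsub>R\<^esub> \<one>\<^bsub>R\<^esub>) \<odot>\<^bsub>V\<^esub> unit i s" using bs by (auto simp: unit_def fun_eq_iff)
    then show "Z a (unit i (b \<odot>\<^bsub>RP\<^esub> s))"
      using Z_smult[OF aA bs(1) unit_closed Zunit[OF i bs(2)]] bs(2) by simp
  qed (use p in simp)
  have Zall: "Z a v" if "v \<in> carrier V" for v
    using that Z_zero[OF aA] Zp Z_add[OF aA] by (rule power_induct)
  then have "\<forall>v\<in>carrier V. \<exists>n. n \<in> N \<and> (\<exists>c\<in>C. (a \<odot>\<^bsub>R\<^esub> \<one>\<^bsub>R\<^esub>) \<odot>\<^bsub>V\<^esub> v = n \<oplus>\<^bsub>V\<^esub> c)"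
    unfolding Z_def by blast
  \<comment> \<open>The component in N of \<open>a v\<close>. It is unique because N and C meet in
    zero only, so linearity follows each time by exhibiting a suitable decomposition.\<close>
  from bchoice[OF this] obtain \<pi> where
    \<pi>': "\<forall>v\<in>carrier V. \<pi> v \<in> N \<and> (\<exists>c\<in>C. (a \<odot>\<^bsub>R\<^esub> \<one>\<^bsub>R\<^esub>) \<odot>\<^bsub>V\<^esub> v = \<pi> v \<oplus>\<^bsub>V\<^esub> c)" by (rule exE)
  have \<pi>N: "\<pi> v \<in> N" if "v \<in> carrier V" for v using \<pi>' that by blast
  have \<pi>V: "\<pi> v \<in> carrier V" if "v \<in> carrier V" for v using cN \<pi>N[OF that] by blast
  have \<pi>_eq: "\<pi> v = n" if v: "v \<in> carrier V" and n: "n \<in> N" and c: "c \<in> C" and eq: "(a \<odot>\<^bsub>R\<^esub> \<one>\<^bsub>R\<^esub>) \<odot>\<^bsub>V\<^esub> v = n \<oplus>\<^bsub>V\<^esub> c" for v n c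
  proof -
    obtain c' where c': "c' \<in> C" "(a \<odot>\<^bsub>R\<^esub> \<one>\<^bsub>R\<^esub>) \<odot>\<^bsub>V\<^esub> v = \<pi> v \<oplus>\<^bsub>V\<^esub> c'" using \<pi>' v by blast
    have cl: "\<pi> v \<in> carrier V" "n \<in> carrier V" "c \<in> carrier V" "c' \<in> carrier V"
      using cN cC \<pi>N[OF v] n c c'(1) by blast+
    have e: "\<pi> v \<oplus>\<^bsub>V\<^esub> c' = n \<oplus>\<^bsub>V\<^esub> c" using eq c'(2) by simp
    have d: "\<pi> v \<oplus>\<^bsub>V\<^esub> (\<ominus>\<^bsub>V\<^esub> n) = c \<oplus>\<^bsub>V\<^esub> (\<ominus>\<^bsub>V\<^esub> c')"
      by (rule V.M.diff_eq_diff_if_add_eq_add[OF cl e])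
    have "\<pi> v \<oplus>\<^bsub>V\<^esub> (\<ominus>\<^bsub>V\<^esub> n) \<in> N" using V.submod_add[OF subN \<pi>N[OF v] V.submod_neg[OF subN n]] .
    moreover have "\<pi> v \<oplus>\<^bsub>V\<^esub> (\<ominus>\<^bsub>V\<^esub> n) \<in> C"
      unfolding d using V.submod_add[OF C(1) c V.submod_neg[OF C(1) c'(1)]] .
    ultimately have "\<pi> v \<oplus>\<^bsub>V\<^esub> (\<ominus>\<^bsub>V\<^esub> n) = \<zero>\<^bsub>V\<^esub>" using C(2) by blast
    then have "\<ominus>\<^bsub>V\<^esub> (\<ominus>\<^bsub>V\<^esub> n) = \<pi> v" by (rule V.M.minus_equality) (use cl in \<open>simp_all del: power_module_simps\<close>)
    then show ?thesis using V.M.minus_minus[OF cl(2)] by simp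
  qed
  have \<pi>_add: "\<pi> (u \<oplus>\<^bsub>V\<^esub> v) = \<pi> u \<oplus>\<^bsub>V\<^esub> \<pi> v" if u: "u \<in> carrier V" and v: "v \<in> carrier V" for u v
  proof -
    obtain c where c: "c \<in> C" "(a \<odot>\<^bsub>R\<^esub> \<one>\<^bsub>R\<^esub>) \<odot>\<^bsub>V\<^esub> u = \<pi> u \<oplus>\<^bsub>V\<^esub> c" using \<pi>' u by blast
    obtain c' where c': "c' \<in> C" "(a \<odot>\<^bsub>R\<^esub> \<one>\<^bsub>R\<^esub>) \<odot>\<^bsub>V\<^esub> v = \<pi> v \<oplus>\<^bsub>V\<^esub> c'" using \<pi>' v by blast
    have "(a \<odot>\<^bsub>R\<^esub> \<one>\<^bsub>R\<^esub>) \<odot>\<^bsub>V\<^esub> (u \<oplus>\<^bsub>V\<^esub> v) = (\<pi> u \<oplus>\<^bsub>V\<^esub> c) \<oplus>\<^bsub>V\<^esub> (\<pi> v \<oplus>\<^bsub>V\<^esub> c')"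
      using V.smult_r_distr[of "a \<odot>\<^bsub>R\<^esub> \<one>\<^bsub>R\<^esub>" u v] u v aA c(2) c'(2) by (simp del: power_module_simps)
    also have "\<dots> = (\<pi> u \<oplus>\<^bsub>V\<^esub> \<pi> v) \<oplus>\<^bsub>V\<^esub> (c \<oplus>\<^bsub>V\<^esub> c')"
      using \<pi>V[OF u] \<pi>V[OF v] cC[OF c(1)] cC[OF c'(1)] by (simp add: V.M.a_ac del: power_module_simps)
    finally show ?thesis
      by (rule \<pi>_eq[OF V.M.a_closed[OF u v] V.submod_add[OF subN \<pi>N[OF u] \<pi>N[OF v]] V.submod_add[OF C(1) c(1) c'(1)]])
  qed
  have \<pi>_smult: "\<pi> (r \<odot>\<^bsub>V\<^esub> v) = r \<odot>\<^bsub>V\<^esub> \<pi> v" if r: "r \<in> carrier R" and v: "v \<in> carrier V" for r v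
  proof -
    obtain c where c: "c \<in> C" "(a \<odot>\<^bsub>R\<^esub> \<one>\<^bsub>R\<^esub>) \<odot>\<^bsub>V\<^esub> v = \<pi> v \<oplus>\<^bsub>V\<^esub> c" using \<pi>' v by blast
    have "(a \<odot>\<^bsub>R\<^esub> \<one>\<^bsub>R\<^esub>) \<odot>\<^bsub>V\<^esub> (r \<odot>\<^bsub>V\<^esub> v) = ((a \<odot>\<^bsub>R\<^esub> \<one>\<^bsub>R\<^esub>) \<otimes>\<^bsub>R\<^esub> r) \<odot>\<^bsub>V\<^esub> v"
      using V.smult_assoc1[of "a \<odot>\<^bsub>R\<^esub> \<one>\<^bsub>R\<^esub>" r v] r v aA by (simp del: power_module_simps)
    also have "\<dots> = r \<odot>\<^bsub>V\<^esub> ((a \<odot>\<^bsub>R\<^esub> \<one>\<^bsub>R\<^esub>) \<odot>\<^bsub>V\<^esub> v)"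
      unfolding scalar_central[OF aA r] using V.smult_assoc1[of r "a \<odot>\<^bsub>R\<^esub> \<one>\<^bsub>R\<^esub>" v] r v aA by (simp del: power_module_simps)
    also have "\<dots> = r \<odot>\<^bsub>V\<^esub> \<pi> v \<oplus>\<^bsub>V\<^esub> r \<odot>\<^bsub>V\<^esub> c"
      unfolding c(2) using r \<pi>V[OF v] cC[OF c(1)] by (rule V.smult_r_distr)
    finally show ?thesis
      by (rule \<pi>_eq[OF V.smult_closed[OF r v] V.submod_smult[OF subN r \<pi>N[OF v]] V.submod_smult[OF C(1) r c(1)]])
  qed
  have \<pi>_on_N: "\<pi> n = (a \<odot>\<^bsub>R\<^esub> \<one>\<^bsub>R\<^esub>) \<odot>\<^bsub>V\<^esub> n" if n: "n \<in> N" for n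
  proof (rule \<pi>_eq[OF cN[OF n] _ V.submod_zero[OF C(1)]])
    show aN: "(a \<odot>\<^bsub>R\<^esub> \<one>\<^bsub>R\<^esub>) \<odot>\<^bsub>V\<^esub> n \<in> N" using n aA by (intro V.submod_smult[OF subN]) simp_all
    show "(a \<odot>\<^bsub>R\<^esub> \<one>\<^bsub>R\<^esub>) \<odot>\<^bsub>V\<^esub> n = (a \<odot>\<^bsub>R\<^esub> \<one>\<^bsub>R\<^esub>) \<odot>\<^bsub>V\<^esub> n \<oplus>\<^bsub>V\<^esub> \<zero>\<^bsub>V\<^esub>"
      using cN[OF aN] by (simp only: V.M.r_zero)
  qed
  have comp: "(\<lambda>p\<in>carrier P. \<pi> (unit i p) j) \<in> carrier (End_ring R P)" if i: "i \<in> S" and j: "j \<in> S" for i j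
    unfolding End_ring_mem
  proof (intro conjI ballI)
    have cl: "\<pi> (unit i p) j \<in> carrier P" if "p \<in> carrier P" for p
      using \<pi>V[OF unit_closed[OF that]] j by auto
    then show "(\<lambda>p\<in>carrier P. \<pi> (unit i p) j) \<in> carrier P \<rightarrow>\<^sub>E carrier P" by simp
    fix x assume x: "x \<in> carrier P"
    { fix y assume y: "y \<in> carrier P"
      have "unit i (x \<oplus>\<^bsub>P\<^esub> y) = unit i x \<oplus>\<^bsub>V\<^esub> unit i y" using x y by (auto simp: unit_def fun_eq_iff)
      then have "\<pi> (unit i (x \<oplus>\<^bsub>P\<^esub> y)) = \<pi> (unit i x) \<oplus>\<^bsub>V\<^esub> \<pi> (unit i y)"
        using \<pi>_add[OF unit_closed[OF x] unit_closed[OF y]] by simp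
      then show "(\<lambda>p\<in>carrier P. \<pi> (unit i p) j) (x \<oplus>\<^bsub>P\<^esub> y)
          = (\<lambda>p\<in>carrier P. \<pi> (unit i p) j) x \<oplus>\<^bsub>P\<^esub> (\<lambda>p\<in>carrier P. \<pi> (unit i p) j) y"
        using x y j by simp }
    fix r assume r: "r \<in> carrier R"
    have "unit i (r \<odot>\<^bsub>P\<^esub> x) = r \<odot>\<^bsub>V\<^esub> unit i x" using x r by (auto simp: unit_def fun_eq_iff)
    then have "\<pi> (unit i (r \<odot>\<^bsub>P\<^esub> x)) = r \<odot>\<^bsub>V\<^esub> \<pi> (unit i x)"
      using \<pi>_smult[OF r unit_closed[OF x]] by simp
    then show "(\<lambda>p\<in>carrier P. \<pi> (unit i p) j) (r \<odot>\<^bsub>P\<^esub> x) = r \<odot>\<^bsub>P\<^esub> (\<lambda>p\<in>carrier P. \<pi> (unit i p) j) x"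
      using x r j by simp
  qed
  \<comment> \<open>The multiplier \<open>a\<close> has been fixed before \<sigma> enters, which is
    what makes it uniform.\<close>
  have "\<exists>r\<in>carrier R. \<forall>p\<in>carrier P. a \<star> \<sigma> p = r \<odot>\<^bsub>P\<^esub> p" if \<sigma>: "\<sigma> \<in> carrier (DEnd_ring R P)" for \<sigma>
  proof -
    have \<sigma>P: "\<sigma> p \<in> carrier P" if "p \<in> carrier P" for p using \<sigma> that by (auto simp: DEnd_ring_mem)
    have \<sigma>_add: "\<sigma> (x \<oplus>\<^bsub>P\<^esub> y) = \<sigma> x \<oplus>\<^bsub>P\<^esub> \<sigma> y" if "x \<in> carrier P" "y \<in> carrier P" for x y
      using \<sigma> that by (auto simp: DEnd_ring_mem)
    have \<sigma>_zero: "\<sigma> \<zero>\<^bsub>P\<^esub> = \<zero>\<^bsub>P\<^esub>"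
    proof -
      have "\<sigma> \<zero>\<^bsub>P\<^esub> \<oplus>\<^bsub>P\<^esub> \<sigma> \<zero>\<^bsub>P\<^esub> = \<sigma> \<zero>\<^bsub>P\<^esub>" using \<sigma>_add[of "\<zero>\<^bsub>P\<^esub>" "\<zero>\<^bsub>P\<^esub>"] by simp
      then show ?thesis using \<sigma>P[of "\<zero>\<^bsub>P\<^esub>"] by simp
    qed
    define \<sigma>s where "\<sigma>s v = (\<lambda>s\<in>S. \<sigma> (v s))" for v
    have \<sigma>sV: "\<sigma>s v \<in> carrier V" if "v \<in> carrier V" for v using that \<sigma>P by (auto simp: \<sigma>s_def)
    have \<sigma>s_add: "\<sigma>s (u \<oplus>\<^bsub>V\<^esub> v) = \<sigma>s u \<oplus>\<^bsub>V\<^esub> \<sigma>s v" if "u \<in> carrier V" "v \<in> carrier V" for u v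
    proof (rule power_module_eqI[of _ S P])
      fix s assume "s \<in> S"
      then show "\<sigma>s (u \<oplus>\<^bsub>V\<^esub> v) s = (\<sigma>s u \<oplus>\<^bsub>V\<^esub> \<sigma>s v) s"
        using that \<sigma>_add[of "u s" "v s"] by (auto simp: \<sigma>s_def)
    next
      show "\<sigma>s (u \<oplus>\<^bsub>V\<^esub> v) \<in> carrier V" using \<sigma>sV[OF V.M.a_closed[OF that]] .
      show "\<sigma>s u \<oplus>\<^bsub>V\<^esub> \<sigma>s v \<in> carrier V" using V.M.a_closed[OF \<sigma>sV[OF that(1)] \<sigma>sV[OF that(2)]] .
    qed
    \<comment> \<open>By additivity it suffices to test vectors concentrated in one slot, where the
      claim says that \<sigma> commutes with the matrix entries of \<pi>.\<close>
    have key: "\<pi> (\<sigma>s v) = \<sigma>s (\<pi> v)" if "v \<in> carrier V" for v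
      using that
    proof (rule power_induct)
      have "\<sigma>s \<zero>\<^bsub>V\<^esub> = \<zero>\<^bsub>V\<^esub>" using \<sigma>_zero by (auto simp: \<sigma>s_def)
      moreover have "\<pi> \<zero>\<^bsub>V\<^esub> = \<zero>\<^bsub>V\<^esub>"
        using \<pi>_on_N[OF V.submod_zero[OF subN]] V.smult_zero_right[of "a \<odot>\<^bsub>R\<^esub> \<one>\<^bsub>R\<^esub>"] aA by (simp del: power_module_simps)
      ultimately show "\<pi> (\<sigma>s \<zero>\<^bsub>V\<^esub>) = \<sigma>s (\<pi> \<zero>\<^bsub>V\<^esub>)" by simp
    next
      fix i p assume i: "i \<in> S" and p: "p \<in> carrier P"
      have "\<sigma>s (unit i p) = unit i (\<sigma> p)" using \<sigma>_zero by (auto simp: \<sigma>s_def unit_def fun_eq_iff)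
      moreover have "\<pi> (unit i (\<sigma> p)) = \<sigma>s (\<pi> (unit i p))"
      proof (rule power_module_eqI[of _ S P])
        fix j assume j: "j \<in> S"
        have "\<forall>x\<in>carrier P. \<sigma> ((\<lambda>p\<in>carrier P. \<pi> (unit i p) j) x) = (\<lambda>p\<in>carrier P. \<pi> (unit i p) j) (\<sigma> x)"
          using \<sigma> comp[OF i j] unfolding DEnd_ring_mem by blast
        from bspec[OF this p] show "\<pi> (unit i (\<sigma> p)) j = \<sigma>s (\<pi> (unit i p)) j"
          using p j \<sigma>P[OF p] by (simp add: \<sigma>s_def)
      qed (use \<pi>V[OF unit_closed[OF \<sigma>P[OF p]]] \<sigma>sV[OF \<pi>V[OF unit_closed[OF p]]] in \<open>simp_all del: power_module_simps\<close>)
      ultimately show "\<pi> (\<sigma>s (unit i p)) = \<sigma>s (\<pi> (unit i p))" by simp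
    next
      fix u v assume uv: "u \<in> carrier V" "v \<in> carrier V" "\<pi> (\<sigma>s u) = \<sigma>s (\<pi> u)" "\<pi> (\<sigma>s v) = \<sigma>s (\<pi> v)"
      then show "\<pi> (\<sigma>s (u \<oplus>\<^bsub>V\<^esub> v)) = \<sigma>s (\<pi> (u \<oplus>\<^bsub>V\<^esub> v))"
        by (simp only: \<sigma>s_add \<pi>_add \<sigma>sV \<pi>V)
    qed
    have e1N: "e \<one>\<^bsub>R\<^esub> \<in> N" unfolding N_def by simp
    have "\<pi> (\<sigma>s (e \<one>\<^bsub>R\<^esub>)) \<in> N" using \<pi>N[OF \<sigma>sV[OF cN[OF e1N]]] .
    then have "\<sigma>s ((a \<odot>\<^bsub>R\<^esub> \<one>\<^bsub>R\<^esub>) \<odot>\<^bsub>V\<^esub> e \<one>\<^bsub>R\<^esub>) \<in> N" using key[OF cN[OF e1N]] \<pi>_on_N[OF e1N] by simp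
    then obtain r where r: "r \<in> carrier R" "\<sigma>s ((a \<odot>\<^bsub>R\<^esub> \<one>\<^bsub>R\<^esub>) \<odot>\<^bsub>V\<^esub> e \<one>\<^bsub>R\<^esub>) = e r" unfolding N_def by blast
    have \<sigma>_sc: "\<sigma> (b \<star> p) = b \<star> \<sigma> p" if "b \<in> carrier A" "p \<in> carrier P" for b p
      using DEnd_scalar[OF \<sigma> that] .
    have on_S: "a \<star> \<sigma> s = r \<odot>\<^bsub>P\<^esub> s" if s: "s \<in> S" for s
    proof -
      have "\<sigma> (a \<star> s) = r \<odot>\<^bsub>P\<^esub> s" using fun_cong[OF r(2), of s] s by (simp add: \<sigma>s_def e_def)
      then show ?thesis using \<sigma>_sc[OF aA, of s] s by simp
    qed
    have "a \<star> \<sigma> p = r \<odot>\<^bsub>P\<^esub> p" if p: "p \<in> carrier P" for p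
    proof (rule FP.span_induct[of p "\<lambda>p. a \<star> \<sigma> p = r \<odot>\<^bsub>P\<^esub> p"])
      show "a \<star> \<sigma> \<zero>\<^bsub>RP\<^esub> = r \<odot>\<^bsub>P\<^esub> \<zero>\<^bsub>RP\<^esub>" using \<sigma>_zero aA r(1) by simp
      fix x y assume xy: "x \<in> carrier RP" "y \<in> carrier RP" "a \<star> \<sigma> x = r \<odot>\<^bsub>P\<^esub> x" "a \<star> \<sigma> y = r \<odot>\<^bsub>P\<^esub> y"
      then show "a \<star> \<sigma> (x \<oplus>\<^bsub>RP\<^esub> y) = r \<odot>\<^bsub>P\<^esub> (x \<oplus>\<^bsub>RP\<^esub> y)"
        using \<sigma>_add[of x y] \<sigma>P[of x] \<sigma>P[of y] aA r(1) by (simp add: P.smult_r_distr)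
    next
      fix b s assume bs: "b \<in> carrier A" "s \<in> S"
      have "a \<star> \<sigma> (b \<star> s) = a \<star> (b \<star> \<sigma> s)" using \<sigma>_sc[of b s] bs by simp
      also have "\<dots> = b \<star> (a \<star> \<sigma> s)"
        using scalar_commute[of a "b \<odot>\<^bsub>R\<^esub> \<one>\<^bsub>R\<^esub>" "\<sigma> s"] bs aA \<sigma>P[of s] by simp
      also have "\<dots> = r \<odot>\<^bsub>P\<^esub> (b \<star> s)"
        unfolding on_S[OF bs(2)] using scalar_commute[of b r s] bs r(1) by simp
      finally show "a \<star> \<sigma> (b \<odot>\<^bsub>RP\<^esub> s) = r \<odot>\<^bsub>P\<^esub> (b \<odot>\<^bsub>RP\<^esub> s)" by simp
    qed (use p in simp)
    then show ?thesis using r(1) by blast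
  qed
  then show ?thesis using a by blast
qed

end

section \<open>From residue fields to the Dedekind domain\<close>

lemma (in left_module) homothety_DEnd: "r \<in> carrier R \<Longrightarrow> homothety M r \<in> carrier (DEnd_ring R M)"
  by (auto simp: DEnd_ring_mem homothety_def End_ring_mem smult_r_distr PiE_iff)

lemma (in left_module) double_centraliser_propertyI:
  assumes "\<And>\<sigma>. \<sigma> \<in> carrier (DEnd_ring R M) \<Longrightarrow> \<exists>r\<in>carrier R. \<forall>p\<in>carrier M. \<sigma> p = r \<odot>\<^bsub>M\<^esub> p"
  shows "double_centraliser_property R M"
  unfolding double_centraliser_property_def
proof
  show "homothety M ` carrier R \<subseteq> carrier (DEnd_ring R M)" using homothety_DEnd by blast
  show "carrier (DEnd_ring R M) \<subseteq> homothety M ` carrier R"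
  proof
    fix \<sigma> assume \<sigma>: "\<sigma> \<in> carrier (DEnd_ring R M)"
    obtain r where r: "r \<in> carrier R" "\<forall>p\<in>carrier M. \<sigma> p = r \<odot>\<^bsub>M\<^esub> p" using assms[OF \<sigma>] by blast
    have "\<sigma> \<in> carrier M \<rightarrow>\<^sub>E carrier M" using \<sigma> unfolding DEnd_ring_mem by blast
    then have "\<sigma> = homothety M r" using r(2) by (auto simp: homothety_def fun_eq_iff PiE_iff extensional_def)
    then show "\<sigma> \<in> homothety M ` carrier R" using r(1) by blast
  qed
qed

lemma a_inv_restrict_scalars [simp]: "\<ominus>\<^bsub>restrict_scalars R P\<^esub> x = \<ominus>\<^bsub>P\<^esub> x"
  by (simp add: a_inv_def m_inv_def)

context lattice_representation
begin

lemma sc_closed [simp]: "\<lbrakk>a \<in> carrier A; p \<in> carrier P\<rbrakk> \<Longrightarrow> a \<star> p \<in> carrier P" by simp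

lemma sc_mult: "\<lbrakk>a \<in> carrier A; b \<in> carrier A; p \<in> carrier P\<rbrakk> \<Longrightarrow> (a \<otimes>\<^bsub>A\<^esub> b) \<star> p = a \<star> (b \<star> p)"
  by (simp add: scalar_mult P.smult_assoc1)

lemma sc_add: "\<lbrakk>a \<in> carrier A; p \<in> carrier P; q \<in> carrier P\<rbrakk> \<Longrightarrow> a \<star> (p \<oplus>\<^bsub>P\<^esub> q) = a \<star> p \<oplus>\<^bsub>P\<^esub> a \<star> q"
  by (simp add: P.smult_r_distr)

lemma sc_cancel:
  assumes "a \<in> G.nz" "p \<in> carrier P" "q \<in> carrier P" "a \<star> p = a \<star> q" shows "p = q"
proof -
  have aA: "a \<in> carrier A" using assms by blast
  have "a \<star> (\<ominus>\<^bsub>P\<^esub> q) = \<ominus>\<^bsub>P\<^esub> (a \<star> q)"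
    using scalar_commute[of a "\<ominus>\<^bsub>R\<^esub> \<one>\<^bsub>R\<^esub>" q] assms(3) aA by (simp add: P.smult_minus_one)
  then have "a \<star> (p \<oplus>\<^bsub>P\<^esub> (\<ominus>\<^bsub>P\<^esub> q)) = a \<star> q \<oplus>\<^bsub>P\<^esub> (\<ominus>\<^bsub>P\<^esub> (a \<star> q))"
    using sc_add[OF aA assms(2), of "\<ominus>\<^bsub>P\<^esub> q"] assms(3,4) by simp
  also have "\<dots> = \<zero>\<^bsub>P\<^esub>" using assms(3) aA by (intro P.M.r_neg) simp
  finally have z: "a \<star> (p \<oplus>\<^bsub>P\<^esub> (\<ominus>\<^bsub>P\<^esub> q)) = \<zero>\<^bsub>P\<^esub>" .
  have "p \<oplus>\<^bsub>P\<^esub> (\<ominus>\<^bsub>P\<^esub> q) \<in> carrier P" using assms(2,3) by simp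
  from torsion_free[OF assms(1) this z] have "p \<oplus>\<^bsub>P\<^esub> (\<ominus>\<^bsub>P\<^esub> q) = \<zero>\<^bsub>P\<^esub>" .
  then have "\<ominus>\<^bsub>P\<^esub> (\<ominus>\<^bsub>P\<^esub> q) = p" by (rule P.M.minus_equality) (use assms(2,3) in simp_all)
  then show ?thesis using assms(3) by simp
qed

text \<open>The annihilator in A of the cokernel of the natural map from R to the double centraliser
  ring.\<close>

definition denominators where
  "denominators = {a \<in> carrier A. \<forall>\<sigma>\<in>carrier (DEnd_ring R P). \<exists>r\<in>carrier R. \<forall>p\<in>carrier P. a \<star> \<sigma> p = r \<odot>\<^bsub>P\<^esub> p}"

lemma DEnd_closed: "\<lbrakk>\<sigma> \<in> carrier (DEnd_ring R P); p \<in> carrier P\<rbrakk> \<Longrightarrow> \<sigma> p \<in> carrier P"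
  by (auto simp: DEnd_ring_mem)

lemma denominators_mult:
  assumes "a \<in> denominators" "b \<in> carrier A" shows "b \<otimes>\<^bsub>A\<^esub> a \<in> denominators"
  unfolding denominators_def
proof (intro CollectI conjI ballI)
  have a: "a \<in> carrier A" using assms by (simp add: denominators_def)
  then show "b \<otimes>\<^bsub>A\<^esub> a \<in> carrier A" using assms by simp
  fix \<sigma> assume \<sigma>: "\<sigma> \<in> carrier (DEnd_ring R P)"
  then obtain r where r: "r \<in> carrier R" "\<forall>p\<in>carrier P. a \<star> \<sigma> p = r \<odot>\<^bsub>P\<^esub> p"
    using assms(1) by (auto simp: denominators_def)
  show "\<exists>r\<in>carrier R. \<forall>p\<in>carrier P. (b \<otimes>\<^bsub>A\<^esub> a) \<star> \<sigma> p = r \<odot>\<^bsub>P\<^esub> p"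
  proof (intro bexI[of _ "(b \<odot>\<^bsub>R\<^esub> \<one>\<^bsub>R\<^esub>) \<otimes>\<^bsub>R\<^esub> r"] ballI)
    fix p assume p: "p \<in> carrier P"
    have "(b \<otimes>\<^bsub>A\<^esub> a) \<star> \<sigma> p = b \<star> (a \<star> \<sigma> p)" using a assms(2) DEnd_closed[OF \<sigma> p] by (rule_tac sc_mult)
    also have "\<dots> = b \<star> (r \<odot>\<^bsub>P\<^esub> p)" using r(2) p by simp
    also have "\<dots> = ((b \<odot>\<^bsub>R\<^esub> \<one>\<^bsub>R\<^esub>) \<otimes>\<^bsub>R\<^esub> r) \<odot>\<^bsub>P\<^esub> p" using r(1) p assms(2) by (intro P.smult_assoc1[symmetric]) simp_all
    finally show "(b \<otimes>\<^bsub>A\<^esub> a) \<star> \<sigma> p = ((b \<odot>\<^bsub>R\<^esub> \<one>\<^bsub>R\<^esub>) \<otimes>\<^bsub>R\<^esub> r) \<odot>\<^bsub>P\<^esub> p" .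
  qed (use r(1) assms(2) in simp)
qed

lemma ideal_denominators: "ideal denominators A"
proof (rule idealI)
  show "ring A" ..
  have sub: "denominators \<subseteq> carrier A" by (auto simp: denominators_def)
  show "subgroup denominators (add_monoid A)"
  proof (rule G.A.add.subgroupI[OF sub])
    have "\<zero>\<^bsub>A\<^esub> \<in> denominators"
      unfolding denominators_def
    proof (intro CollectI conjI ballI)
      fix \<sigma> assume \<sigma>: "\<sigma> \<in> carrier (DEnd_ring R P)"
      show "\<exists>r\<in>carrier R. \<forall>p\<in>carrier P. \<zero>\<^bsub>A\<^esub> \<star> \<sigma> p = r \<odot>\<^bsub>P\<^esub> p"
        by (intro bexI[of _ "\<zero>\<^bsub>R\<^esub>"] ballI) (use DEnd_closed[OF \<sigma>] in simp_all)
    qed simp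
    then show "denominators \<noteq> {}" by blast
    fix a assume a: "a \<in> denominators"
    have aA: "a \<in> carrier A" using a sub by blast
    have "(\<ominus>\<^bsub>A\<^esub> \<one>\<^bsub>A\<^esub>) \<otimes>\<^bsub>A\<^esub> a \<in> denominators" by (rule denominators_mult[OF a]) simp
    then show "\<ominus>\<^bsub>A\<^esub> a \<in> denominators" using aA by (simp add: G.A.l_minus)
    fix b assume b: "b \<in> denominators"
    have bA: "b \<in> carrier A" using b sub by blast
    show "a \<oplus>\<^bsub>A\<^esub> b \<in> denominators"
      unfolding denominators_def
    proof (intro CollectI conjI ballI)
      fix \<sigma> assume \<sigma>: "\<sigma> \<in> carrier (DEnd_ring R P)"
      obtain r where r: "r \<in> carrier R" "\<forall>p\<in>carrier P. a \<star> \<sigma> p = r \<odot>\<^bsub>P\<^esub> p"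
        using a \<sigma> by (auto simp: denominators_def)
      obtain r' where r': "r' \<in> carrier R" "\<forall>p\<in>carrier P. b \<star> \<sigma> p = r' \<odot>\<^bsub>P\<^esub> p"
        using b \<sigma> by (auto simp: denominators_def)
      show "\<exists>r\<in>carrier R. \<forall>p\<in>carrier P. (a \<oplus>\<^bsub>A\<^esub> b) \<star> \<sigma> p = r \<odot>\<^bsub>P\<^esub> p"
      proof (intro bexI[of _ "r \<oplus>\<^bsub>R\<^esub> r'"] ballI)
        fix p assume p: "p \<in> carrier P"
        have "(a \<oplus>\<^bsub>A\<^esub> b) \<star> \<sigma> p = a \<star> \<sigma> p \<oplus>\<^bsub>P\<^esub> b \<star> \<sigma> p"
          using aA bA DEnd_closed[OF \<sigma> p] by (simp add: G.alg.smult_l_distr P.smult_l_distr)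
        then show "(a \<oplus>\<^bsub>A\<^esub> b) \<star> \<sigma> p = (r \<oplus>\<^bsub>R\<^esub> r') \<odot>\<^bsub>P\<^esub> p"
          using r r' p by (simp add: P.smult_l_distr)
      qed (use r r' in simp)
    qed (use aA bA in simp)
  qed
  fix a x assume a: "a \<in> denominators" and x: "x \<in> carrier A"
  have aA: "a \<in> carrier A" using a sub by blast
  show "x \<otimes>\<^bsub>A\<^esub> a \<in> denominators" by (rule denominators_mult[OF a x])
  then show "a \<otimes>\<^bsub>A\<^esub> x \<in> denominators" using G.A.m_comm[OF aA x] by simp
qed

text \<open>Multiplication by b/a carries I into A, so dividing coordinatewise gives (b/a)(\<sigma>
  - r) as a map from P to P. Torsion-freeness makes the quotient unique, so additivity and
  commutation with endomorphisms are inherited from \<sigma> - r.\<close>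

lemma divisible_DEnd:
  assumes \<sigma>: "\<sigma> \<in> carrier (DEnd_ring R P)" and r: "r \<in> carrier R"
    and a: "a \<in> G.nz" and b: "b \<in> carrier A"
    and I: "\<And>z. z \<in> I \<Longrightarrow> \<exists>w\<in>carrier A. b \<otimes>\<^bsub>A\<^esub> z = a \<otimes>\<^bsub>A\<^esub> w"
    and cong: "\<And>p s. \<lbrakk>p \<in> carrier P; s \<in> S\<rbrakk> \<Longrightarrow> FP.coord (\<sigma> p \<ominus>\<^bsub>RP\<^esub> r \<odot>\<^bsub>P\<^esub> p) s \<in> I"
  shows "\<exists>\<sigma>'\<in>carrier (DEnd_ring R P). \<forall>p\<in>carrier P. a \<star> \<sigma>' p = b \<star> (\<sigma> p \<ominus>\<^bsub>RP\<^esub> r \<odot>\<^bsub>P\<^esub> p)"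
proof -
  define u where "u p = \<sigma> p \<ominus>\<^bsub>RP\<^esub> r \<odot>\<^bsub>P\<^esub> p" for p
  have aA: "a \<in> carrier A" using a by blast
  have u_eq: "u p = \<sigma> p \<oplus>\<^bsub>P\<^esub> (\<ominus>\<^bsub>R\<^esub> \<one>\<^bsub>R\<^esub>) \<odot>\<^bsub>P\<^esub> (r \<odot>\<^bsub>P\<^esub> p)" if "p \<in> carrier P" for p
    using that r by (simp add: u_def a_minus_def P.smult_minus_one)
  have uP: "u p \<in> carrier P" if "p \<in> carrier P" for p
    using that r DEnd_closed[OF \<sigma> that] by (simp add: u_eq)
  have "\<exists>q. q \<in> carrier P \<and> a \<star> q = b \<star> u p" if p: "p \<in> carrier P" for p
  proof -
    have "\<forall>s\<in>S. \<exists>w. w \<in> carrier A \<and> b \<otimes>\<^bsub>A\<^esub> FP.coord (u p) s = a \<otimes>\<^bsub>A\<^esub> w"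
      using I[OF cong[OF p]] unfolding u_def by blast
    from bchoice[OF this] obtain d where
      d: "\<forall>s\<in>S. d s \<in> carrier A \<and> b \<otimes>\<^bsub>A\<^esub> FP.coord (u p) s = a \<otimes>\<^bsub>A\<^esub> d s" by (rule exE)
    define q where "q = (\<Oplus>\<^bsub>RP\<^esub>s\<in>S. d s \<odot>\<^bsub>RP\<^esub> s)"
    have dA: "d \<in> S \<rightarrow> carrier A" using d by blast
    have q: "q \<in> carrier RP"
      unfolding q_def by (rule RP.M.finsum_closed) (use d in \<open>auto simp del: restrict_scalars_simps intro!: RP.smult_closed FP.S_closed\<close>)
    have "a \<odot>\<^bsub>RP\<^esub> q = b \<odot>\<^bsub>RP\<^esub> u p"
    proof (rule FP.coord_eqI)
      fix s assume s: "s \<in> S"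
      have "FP.coord (a \<odot>\<^bsub>RP\<^esub> q) s = a \<otimes>\<^bsub>A\<^esub> FP.coord q s" by (rule FP.coord_smult[OF aA q s])
      also have "FP.coord q s = d s" unfolding q_def by (rule FP.coord_unique[OF dA s])
      also have "a \<otimes>\<^bsub>A\<^esub> d s = b \<otimes>\<^bsub>A\<^esub> FP.coord (u p) s" using d s by simp
      also have "\<dots> = FP.coord (b \<odot>\<^bsub>RP\<^esub> u p) s"
        using uP[OF p] by (intro FP.coord_smult[symmetric] b s) simp
      finally show "FP.coord (a \<odot>\<^bsub>RP\<^esub> q) s = FP.coord (b \<odot>\<^bsub>RP\<^esub> u p) s" .
    qed (use q uP[OF p] aA b in simp_all)
    then show ?thesis using q by auto
  qed
  then have "\<forall>p\<in>carrier P. \<exists>q. q \<in> carrier P \<and> a \<star> q = b \<star> u p" by blast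
  \<comment> \<open>The values are chosen pointwise; each law for \<open>t\<close> is proved after
    multiplication by \<open>a\<close>, which is then cancelled.\<close>
  from bchoice[OF this] obtain t where t: "\<forall>p\<in>carrier P. t p \<in> carrier P \<and> a \<star> t p = b \<star> u p" by (rule exE)
  have tP: "t p \<in> carrier P" and t_eq: "a \<star> t p = b \<star> u p" if "p \<in> carrier P" for p using t that by blast+
  have \<sigma>_add: "\<sigma> (x \<oplus>\<^bsub>P\<^esub> y) = \<sigma> x \<oplus>\<^bsub>P\<^esub> \<sigma> y" if "x \<in> carrier P" "y \<in> carrier P" for x y
    using \<sigma> that by (auto simp: DEnd_ring_mem)
  have "(\<lambda>p\<in>carrier P. t p) \<in> carrier (DEnd_ring R P)"
    unfolding DEnd_ring_mem
  proof (intro conjI ballI)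
    show "(\<lambda>p\<in>carrier P. t p) \<in> carrier P \<rightarrow>\<^sub>E carrier P" using tP by simp
    fix x y assume x: "x \<in> carrier P" and y: "y \<in> carrier P"
    have uadd: "u (x \<oplus>\<^bsub>P\<^esub> y) = u x \<oplus>\<^bsub>P\<^esub> u y"
      using x y r DEnd_closed[OF \<sigma> x] DEnd_closed[OF \<sigma> y] by (simp add: u_eq \<sigma>_add P.smult_r_distr P.M.a_ac)
    have xy: "x \<oplus>\<^bsub>P\<^esub> y \<in> carrier P" using x y by simp
    have "a \<star> t (x \<oplus>\<^bsub>P\<^esub> y) = b \<star> u x \<oplus>\<^bsub>P\<^esub> b \<star> u y"
      unfolding t_eq[OF xy] uadd by (rule sc_add[OF b uP[OF x] uP[OF y]])
    also have "\<dots> = a \<star> (t x \<oplus>\<^bsub>P\<^esub> t y)"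
      unfolding t_eq[OF x, symmetric] t_eq[OF y, symmetric] by (rule sc_add[OF aA tP[OF x] tP[OF y], symmetric])
    finally have "t (x \<oplus>\<^bsub>P\<^esub> y) = t x \<oplus>\<^bsub>P\<^esub> t y"
      by (rule sc_cancel[OF a tP[OF xy] P.M.a_closed[OF tP[OF x] tP[OF y]]])
    then show "(\<lambda>p\<in>carrier P. t p) (x \<oplus>\<^bsub>P\<^esub> y) = (\<lambda>p\<in>carrier P. t p) x \<oplus>\<^bsub>P\<^esub> (\<lambda>p\<in>carrier P. t p) y"
      using x y by simp
  next
    fix \<alpha> x assume \<alpha>: "\<alpha> \<in> carrier (End_ring R P)" and x: "x \<in> carrier P"
    have \<alpha>P: "\<alpha> p \<in> carrier P" if "p \<in> carrier P" for p using \<alpha> that by (auto simp: End_ring_mem)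
    have \<alpha>_add: "\<alpha> (p \<oplus>\<^bsub>P\<^esub> q) = \<alpha> p \<oplus>\<^bsub>P\<^esub> \<alpha> q" if "p \<in> carrier P" "q \<in> carrier P" for p q
      using \<alpha> that by (auto simp: End_ring_mem)
    have \<alpha>_sm: "\<alpha> (c \<odot>\<^bsub>P\<^esub> p) = c \<odot>\<^bsub>P\<^esub> \<alpha> p" if "c \<in> carrier R" "p \<in> carrier P" for c p
      using \<alpha> that by (auto simp: End_ring_mem)
    have \<sigma>\<alpha>: "\<sigma> (\<alpha> x) = \<alpha> (\<sigma> x)" using \<sigma> \<alpha> x by (auto simp: DEnd_ring_mem)
    have "\<alpha> (u x) = \<alpha> (\<sigma> x) \<oplus>\<^bsub>P\<^esub> (\<ominus>\<^bsub>R\<^esub> \<one>\<^bsub>R\<^esub>) \<odot>\<^bsub>P\<^esub> (r \<odot>\<^bsub>P\<^esub> \<alpha> x)"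
      using x r DEnd_closed[OF \<sigma> x] by (simp add: u_eq \<alpha>_add \<alpha>_sm)
    then have u\<alpha>: "u (\<alpha> x) = \<alpha> (u x)" using \<alpha>P[OF x] by (simp add: u_eq \<sigma>\<alpha>)
    have "a \<star> t (\<alpha> x) = b \<star> \<alpha> (u x)" using t_eq[OF \<alpha>P[OF x]] u\<alpha> by simp
    also have "\<dots> = \<alpha> (b \<star> u x)" using b uP[OF x] by (simp add: \<alpha>_sm)
    also have "\<dots> = \<alpha> (a \<star> t x)" using t_eq[OF x] by simp
    also have "\<dots> = a \<star> \<alpha> (t x)" using aA tP[OF x] by (simp add: \<alpha>_sm)
    finally have "t (\<alpha> x) = \<alpha> (t x)" by (rule sc_cancel[OF a tP[OF \<alpha>P[OF x]] \<alpha>P[OF tP[OF x]]])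
    then show "(\<lambda>p\<in>carrier P. t p) (\<alpha> x) = \<alpha> ((\<lambda>p\<in>carrier P. t p) x)" using x \<alpha>P[OF x] by simp
  qed
  then show ?thesis by (intro bexI[of _ "\<lambda>p\<in>carrier P. t p"] ballI) (simp_all add: t_eq u_def[symmetric])
qed

theorem double_centraliser_if_residually:
  assumes A: "dedekind_domain A \<or> field A"
    and ss: "semisimple_ring G.RK"
    and residual: "\<And>\<mm> \<sigma>. \<lbrakk>maximalideal \<mm> A; \<sigma> \<in> carrier (DEnd_ring R P)\<rbrakk> \<Longrightarrow>
      \<exists>r\<in>carrier R. \<forall>p\<in>carrier P. \<forall>s\<in>S. FP.coord (\<sigma> p \<ominus>\<^bsub>RP\<^esub> r \<odot>\<^bsub>P\<^esub> p) s \<in> \<mm>"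
  shows "double_centraliser_property R P"
proof -
  obtain a where a: "a \<in> G.nz" "a \<in> denominators"
    using DEnd_uniform_denominator[OF ss] unfolding denominators_def by blast
  have aA: "a \<in> carrier A" using a by blast
  interpret J: ideal denominators A by (rule ideal_denominators)
  have "\<one>\<^bsub>A\<^esub> \<in> denominators"
  proof (cases "field A")
    case True
    \<comment> \<open>Over a field the nonzero denominator is invertible, and denominators are
      closed under multiples.\<close>
    then have "a \<in> Units A" using field.field_Units[OF True] a(1) by simp
    then show ?thesis using denominators_mult[OF a(2), of "inv\<^bsub>A\<^esub> a"] by simp
  next
    case False
    then have ded: "dedekind_domain A" using A by blast
    then interpret N: noetherian_domain A by (simp add: dedekind_domain_def)
    show ?thesis
    proof (rule ccontr)
      assume n1: "\<one>\<^bsub>A\<^esub> \<notin> denominators"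
      \<comment> \<open>Avoiding the set consisting of one means being proper. The prime obtained is
        the annihilator of the class of \<open>b\<close> modulo the ideal of denominators.\<close>
      obtain b where b: "b \<in> carrier A" "primeideal {c \<in> carrier A. c \<otimes>\<^bsub>A\<^esub> b \<in> denominators} A"
        by (rule N.prime_colon_ideal[OF ideal_denominators, of "{\<one>\<^bsub>A\<^esub>}"]) (use n1 in auto)
      define \<mm> where "\<mm> = {c \<in> carrier A. c \<otimes>\<^bsub>A\<^esub> b \<in> denominators}"
      have pr: "primeideal \<mm> A" using b(2) by (simp only: \<mm>_def)
      have "a \<in> \<mm>" using aA b(1) J.I_r_closed[OF a(2) b(1)] by (simp add: \<mm>_def)
      then have nz: "\<mm> \<noteq> {\<zero>\<^bsub>A\<^esub>}" using a(1) by blast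
      have dim1: "maximalideal I A" if "primeideal I A" "I \<noteq> {\<zero>\<^bsub>A\<^esub>}" for I
        using ded that unfolding dedekind_domain_def by blast
      have max: "maximalideal \<mm> A" by (rule dim1[OF pr nz])
      have ic: "integrally_closed A" using ded unfolding dedekind_domain_def by blast
      \<comment> \<open>The fraction b'/a' belongs to the inverse of \<mm>, and \<open>y\<close> is
        its product with \<open>x\<close>.\<close>
      obtain a' b' x y where h: "a' \<in> carrier A" "a' \<noteq> \<zero>\<^bsub>A\<^esub>" "b' \<in> carrier A" "x \<in> \<mm>" "y \<in> carrier A" "y \<notin> \<mm>"
        "b' \<otimes>\<^bsub>A\<^esub> x = a' \<otimes>\<^bsub>A\<^esub> y" and div: "\<And>z. z \<in> \<mm> \<Longrightarrow> \<exists>w\<in>carrier A. b' \<otimes>\<^bsub>A\<^esub> z = a' \<otimes>\<^bsub>A\<^esub> w"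
      proof (rule N.maximal_ideal_invertible[OF ic _ max nz])
        show "maximalideal I A" if "primeideal I A" "I \<noteq> {\<zero>\<^bsub>A\<^esub>}" for I by (rule dim1[OF that])
      qed (rule that)
      have a': "a' \<in> G.nz" using h(1,2) by blast
      have xA: "x \<in> carrier A" and xb: "x \<otimes>\<^bsub>A\<^esub> b \<in> denominators" using h(4) by (simp_all add: \<mm>_def)
      have ybA: "y \<otimes>\<^bsub>A\<^esub> b \<in> carrier A" "x \<otimes>\<^bsub>A\<^esub> b \<in> carrier A" using h(5) b(1) xA by simp_all
      have "y \<otimes>\<^bsub>A\<^esub> b \<in> denominators"
        unfolding denominators_def
      proof (intro CollectI conjI ballI)
        fix \<sigma> assume \<sigma>: "\<sigma> \<in> carrier (DEnd_ring R P)"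
        obtain r where r: "r \<in> carrier R"
          and cong: "\<forall>p\<in>carrier P. \<forall>s\<in>S. FP.coord (\<sigma> p \<ominus>\<^bsub>RP\<^esub> r \<odot>\<^bsub>P\<^esub> p) s \<in> \<mm>"
          using residual[OF max \<sigma>] by blast
        have "\<exists>\<sigma>'\<in>carrier (DEnd_ring R P). \<forall>p\<in>carrier P. a' \<star> \<sigma>' p = b' \<star> (\<sigma> p \<ominus>\<^bsub>RP\<^esub> r \<odot>\<^bsub>P\<^esub> p)"
        proof (rule divisible_DEnd[OF \<sigma> r a' h(3), of \<mm>])
          show "\<exists>w\<in>carrier A. b' \<otimes>\<^bsub>A\<^esub> z = a' \<otimes>\<^bsub>A\<^esub> w" if "z \<in> \<mm>" for z using that by (rule div)
        qed (rule cong[rule_format])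
        then obtain \<sigma>' where \<sigma>': "\<sigma>' \<in> carrier (DEnd_ring R P)"
          "\<forall>p\<in>carrier P. a' \<star> \<sigma>' p = b' \<star> (\<sigma> p \<ominus>\<^bsub>RP\<^esub> r \<odot>\<^bsub>P\<^esub> p)" by (rule bexE)
        obtain t where t: "t \<in> carrier R" "\<forall>p\<in>carrier P. (x \<otimes>\<^bsub>A\<^esub> b) \<star> \<sigma>' p = t \<odot>\<^bsub>P\<^esub> p"
          using xb \<sigma>'(1) unfolding denominators_def by blast
        show "\<exists>r\<in>carrier R. \<forall>p\<in>carrier P. (y \<otimes>\<^bsub>A\<^esub> b) \<star> \<sigma> p = r \<odot>\<^bsub>P\<^esub> p"
        \<comment> \<open>Below \<open>(y b) u = t p\<close> is shown for
          \<open>u = \<sigma> p - r p\<close>, so \<open>y b\<close> times \<sigma> acts as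
          \<open>t\<close> plus \<open>y b\<close> times \<open>r\<close>.\<close>
        proof (intro bexI[of _ "t \<oplus>\<^bsub>R\<^esub> ((y \<otimes>\<^bsub>A\<^esub> b) \<odot>\<^bsub>R\<^esub> \<one>\<^bsub>R\<^esub>) \<otimes>\<^bsub>R\<^esub> r"] ballI)
          fix p assume p: "p \<in> carrier P"
          define u where "u = \<sigma> p \<ominus>\<^bsub>RP\<^esub> r \<odot>\<^bsub>P\<^esub> p"
          have \<sigma>p: "\<sigma> p \<in> carrier P" and rp: "r \<odot>\<^bsub>P\<^esub> p \<in> carrier P" and \<sigma>'p: "\<sigma>' p \<in> carrier P"
            using DEnd_closed \<sigma> \<sigma>'(1) r p by simp_all
          have u: "u \<in> carrier P" using RP.M.minus_closed[of "\<sigma> p" "r \<odot>\<^bsub>P\<^esub> p"] \<sigma>p rp by (simp add: u_def)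
          \<comment> \<open>After multiplication by \<open>a'\<close>, the factor
            \<open>a' y\<close> becomes \<open>b' x\<close>, and \<open>b' u\<close> equals
            \<open>a'\<close> times the value of \<sigma>'; the factor \<open>a'\<close> then
            cancels.\<close>
          have eq: "a' \<otimes>\<^bsub>A\<^esub> (y \<otimes>\<^bsub>A\<^esub> b) = (x \<otimes>\<^bsub>A\<^esub> b) \<otimes>\<^bsub>A\<^esub> b'"
          proof -
            have "a' \<otimes>\<^bsub>A\<^esub> (y \<otimes>\<^bsub>A\<^esub> b) = (b' \<otimes>\<^bsub>A\<^esub> x) \<otimes>\<^bsub>A\<^esub> b"
              unfolding h(7) using h(1,5) b(1) by (rule G.A.m_assoc[symmetric])
            then show ?thesis using h(3) xA b(1) by (simp add: G.A.m_ac)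
          qed
          have "a' \<star> ((y \<otimes>\<^bsub>A\<^esub> b) \<star> u) = (a' \<otimes>\<^bsub>A\<^esub> (y \<otimes>\<^bsub>A\<^esub> b)) \<star> u" by (rule sc_mult[OF h(1) ybA(1) u, symmetric])
          also have "\<dots> = (x \<otimes>\<^bsub>A\<^esub> b) \<star> (b' \<star> u)" unfolding eq by (rule sc_mult[OF ybA(2) h(3) u])
          also have "b' \<star> u = a' \<star> \<sigma>' p" using \<sigma>'(2) p by (simp add: u_def)
          also have "(x \<otimes>\<^bsub>A\<^esub> b) \<star> (a' \<star> \<sigma>' p) = a' \<star> ((x \<otimes>\<^bsub>A\<^esub> b) \<star> \<sigma>' p)"
            using scalar_commute[of a' "(x \<otimes>\<^bsub>A\<^esub> b) \<odot>\<^bsub>R\<^esub> \<one>\<^bsub>R\<^esub>" "\<sigma>' p"] h(1) ybA(2) \<sigma>'p by simp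
          also have "\<dots> = a' \<star> (t \<odot>\<^bsub>P\<^esub> p)" using t(2) p by simp
          finally have yu: "(y \<otimes>\<^bsub>A\<^esub> b) \<star> u = t \<odot>\<^bsub>P\<^esub> p"
            by (rule sc_cancel[OF a' sc_closed[OF ybA(1) u] P.smult_closed[OF t(1) p]])
          have \<sigma>_eq: "\<sigma> p = u \<oplus>\<^bsub>P\<^esub> r \<odot>\<^bsub>P\<^esub> p"
            using \<sigma>p rp by (simp add: u_def a_minus_def P.M.a_assoc P.M.l_neg)
          have "(y \<otimes>\<^bsub>A\<^esub> b) \<star> \<sigma> p = (y \<otimes>\<^bsub>A\<^esub> b) \<star> u \<oplus>\<^bsub>P\<^esub> (y \<otimes>\<^bsub>A\<^esub> b) \<star> (r \<odot>\<^bsub>P\<^esub> p)"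
            unfolding \<sigma>_eq by (rule sc_add[OF ybA(1) u rp])
          also have "\<dots> = (t \<oplus>\<^bsub>R\<^esub> ((y \<otimes>\<^bsub>A\<^esub> b) \<odot>\<^bsub>R\<^esub> \<one>\<^bsub>R\<^esub>) \<otimes>\<^bsub>R\<^esub> r) \<odot>\<^bsub>P\<^esub> p"
            unfolding yu using t(1) ybA(1) r p by (simp add: P.smult_l_distr P.smult_assoc1)
          finally show "(y \<otimes>\<^bsub>A\<^esub> b) \<star> \<sigma> p = (t \<oplus>\<^bsub>R\<^esub> ((y \<otimes>\<^bsub>A\<^esub> b) \<odot>\<^bsub>R\<^esub> \<one>\<^bsub>R\<^esub>) \<otimes>\<^bsub>R\<^esub> r) \<odot>\<^bsub>P\<^esub> p" .
        qed (use t(1) ybA(1) r in simp)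
      qed (rule ybA)
      then have "y \<in> \<mm>" using h(5) by (simp add: \<mm>_def)
      then show False using h(6) by contradiction
    qed
  qed
  then have one: "\<forall>\<sigma>\<in>carrier (DEnd_ring R P). \<exists>r\<in>carrier R. \<forall>p\<in>carrier P. \<one>\<^bsub>A\<^esub> \<star> \<sigma> p = r \<odot>\<^bsub>P\<^esub> p"
    unfolding denominators_def by blast
  show ?thesis
  proof (rule P.double_centraliser_propertyI)
    fix \<sigma> assume \<sigma>: "\<sigma> \<in> carrier (DEnd_ring R P)"
    then obtain r where "r \<in> carrier R" "\<forall>p\<in>carrier P. \<one>\<^bsub>A\<^esub> \<star> \<sigma> p = r \<odot>\<^bsub>P\<^esub> p" using one by blast
    then show "\<exists>r\<in>carrier R. \<forall>p\<in>carrier P. \<sigma> p = r \<odot>\<^bsub>P\<^esub> p"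
      using DEnd_closed[OF \<sigma>] by (intro bexI[of _ r]) simp_all
  qed
qed

end

text \<open>Bases of R and P over A are chosen here: they turn congruences modulo \<mm> into
  conditions on coordinates, which is the form in which the descent from the residue fields needs
  them.\<close>

theorem double_centraliser_dedekind:
  fixes A :: "'a ring" and R :: "('a, 'r) module" and P :: "('r, 'p) module"
  assumes A: "dedekind_domain A \<or> field A" and R: "assoc_algebra A R" and P: "left_module R P"
    and std: "standard_hypotheses TYPE(('a \<times> 'a) set) A R P"
    and ss: "semisimple_ring (tensor_ring A (fraction_field A) R)"
    and dcp: "\<And>\<mm>. maximalideal \<mm> A \<Longrightarrow> double_centraliser_property
          (tensor_ring A (residue_algebra A \<mm>) R) (base_change_module A (residue_algebra A \<mm>) R P)"
  shows "double_centraliser_property R P"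
proof -
  interpret algebra_module A R P using R P by (rule algebra_module.intro)
  have dom: "domain A"
    using A field.axioms(1)[of A] unfolding dedekind_domain_def noetherian_domain_def by blast
  obtain SR where SR: "free_module A R SR"
    using std R unfolding standard_hypotheses_def assoc_algebra_def by (blast elim: free_of_finite_rankE)
  obtain S where S: "free_module A RP S"
    using std module_restrict_scalars unfolding standard_hypotheses_def by (blast elim: free_of_finite_rankE)
  interpret L: lattice_representation A R SR P S
    by (intro lattice_representation.intro generic_fibre.intro dom R SR S algebra_module_axioms)
  show ?thesis
  proof (rule L.double_centraliser_if_residually[OF A ss])
    fix \<mm> \<sigma> assume m: "maximalideal \<mm> A" and \<sigma>: "\<sigma> \<in> carrier (DEnd_ring R P)"
    let ?F = "residue_algebra A \<mm>"
    \<comment> \<open>The hypothesis on \<open>\<Psi>\<close> only speaks of algebras with elements in \<^typ>\<open>('a \<times> 'a) set\<close>.\<close>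
    let ?B = "transport_algebra (\<lambda>X. X \<times> {\<zero>\<^bsub>A\<^esub>}) ((`) fst) ?F"
    have F: "quotient_algebra A ?F \<mm>"
      by (rule residue_quotient_algebra[OF maximalideal.axioms(1)[OF m]]) (rule domain.axioms(1)[OF dom])
    have B: "quotient_algebra A ?B \<mm>"
      by (rule transport_quotient_algebra[OF F]) (rule fst_image_times[THEN trans], simp)
    have "Psi A ?B R P \<in> ring_iso (tensor_ring A (op_algebra ?B) (End_algebra R P))
        (End_ring (tensor_ring A ?B R) (base_change_module A ?B R P))"
      using std quotient_algebra.axioms(1)[OF B] unfolding standard_hypotheses_def by blast
    then have surj: "carrier (End_ring (tensor_ring A ?B R) (base_change_module A ?B R P))
        \<subseteq> Psi A ?B R P ` carrier (tensor_ring A (op_algebra ?B) (End_algebra R P))"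
      unfolding ring_iso_def bij_betw_def by blast
    show "\<exists>r\<in>carrier R. \<forall>p\<in>carrier P. \<forall>s\<in>S. L.FP.coord (\<sigma> p \<ominus>\<^bsub>RP\<^esub> r \<odot>\<^bsub>P\<^esub> p) s \<in> \<mm>"
    proof (rule DEnd_congruent_homothety[OF _ _ surj dcp[OF m] \<sigma>])
      show "reduction A R P ?F \<mm> S" by (rule reduction.intro[OF algebra_module_axioms F S])
      show "reduction A R P ?B \<mm> S" by (rule reduction.intro[OF algebra_module_axioms B S])
    qed
  qed
qed

section \<open>Permutation modules\<close>

text \<open>
  Gram--Schmidt without divisions; the multiplier \<open>n\<close> does not depend on the projected vector \<open>M\<close>.
\<close>

lemma common_orthogonal_multiplier:
  fixes v :: "'g \<Rightarrow> 'i \<Rightarrow> int"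
  assumes "finite F" "finite I"
  shows "\<exists>n::int. n \<noteq> 0 \<and> (\<forall>M. \<exists>c. \<forall>h\<in>F. (\<Sum>i\<in>I. (n * M i - (\<Sum>g\<in>F. c g * v g i)) * v h i) = 0)"
  using assms(1)
proof (induction F)
  case empty
  show ?case by (intro exI[of _ 1]) simp
next
  case (insert f F)
  obtain n where n: "n \<noteq> 0" and proj: "\<And>M. \<exists>c. \<forall>h\<in>F. (\<Sum>i\<in>I. (n * M i - (\<Sum>g\<in>F. c g * v g i)) * v h i) = 0"
    using insert.IH by blast
  obtain d where d: "\<forall>h\<in>F. (\<Sum>i\<in>I. (n * v f i - (\<Sum>g\<in>F. d g * v g i)) * v h i) = 0" using proj[of "v f"] by blast
  \<comment> \<open>A multiple of \<open>v f\<close> with its component in the span of the earlier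
    vectors removed; \<open>l\<close> is its squared length.\<close>
  define f' where "f' i = n * v f i - (\<Sum>g\<in>F. d g * v g i)" for i
  define l where "l = (\<Sum>i\<in>I. f' i * f' i)"
  have f'_perp: "(\<Sum>i\<in>I. f' i * v h i) = 0" if "h \<in> F" for h using d that by (simp add: f'_def)
  \<comment> \<open>For vectors orthogonal to \<open>F\<close>, orthogonality to \<open>v f\<close>
    may thus be tested against \<open>f'\<close>.\<close>
  have f'_comb: "(\<Sum>i\<in>I. N i * f' i) = n * (\<Sum>i\<in>I. N i * v f i)" if "\<forall>h\<in>F. (\<Sum>i\<in>I. N i * v h i) = 0" for N
  proof -
    have "(\<Sum>i\<in>I. N i * f' i) = n * (\<Sum>i\<in>I. N i * v f i) - (\<Sum>i\<in>I. \<Sum>g\<in>F. d g * (N i * v g i))"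
      by (simp add: f'_def right_diff_distrib sum_subtractf sum_distrib_left mult.left_commute)
    also have "(\<Sum>i\<in>I. \<Sum>g\<in>F. d g * (N i * v g i)) = (\<Sum>g\<in>F. d g * (\<Sum>i\<in>I. N i * v g i))"
      by (subst sum.swap) (simp add: sum_distrib_left)
    also have "\<dots> = 0" using that by simp
    finally show ?thesis by simp
  qed
  show ?case
  \<comment> \<open>If \<open>l\<close> vanishes then so does \<open>f'\<close>, which means that
    \<open>v f\<close> depends linearly on the earlier vectors and the old multiplier still works.
    Otherwise removing the component along \<open>f'\<close> costs a factor
    \<open>l\<close>.\<close>
  proof (intro exI[of _ "if l = 0 then n else l * n"] conjI allI)
    show "(if l = 0 then n else l * n) \<noteq> 0" using n by simp
    fix M
    obtain c where c: "\<forall>h\<in>F. (\<Sum>i\<in>I. (n * M i - (\<Sum>g\<in>F. c g * v g i)) * v h i) = 0" using proj[of M] by blast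
    define N where "N i = n * M i - (\<Sum>g\<in>F. c g * v g i)" for i
    have N: "\<forall>h\<in>F. (\<Sum>i\<in>I. N i * v h i) = 0" using c by (simp add: N_def)
    show "\<exists>c. \<forall>h\<in>insert f F. (\<Sum>i\<in>I. ((if l = 0 then n else l * n) * M i - (\<Sum>g\<in>insert f F. c g * v g i)) * v h i) = 0"
    proof (cases "l = 0")
      case True
      then have "f' i * f' i = 0" if "i \<in> I" for i
        using that assms(2) unfolding l_def by (subst (asm) sum_nonneg_eq_0_iff) auto
      then have "(\<Sum>i\<in>I. N i * f' i) = 0" by (intro sum.neutral) auto
      then have "(\<Sum>i\<in>I. N i * v f i) = 0" using f'_comb[OF N] n by simp
      then have "\<forall>h\<in>insert f F. (\<Sum>i\<in>I. N i * v h i) = 0" using N by simp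
      moreover have "n * M i - (\<Sum>g\<in>insert f F. (c(f := 0)) g * v g i) = N i" for i
        using insert.hyps by (auto simp: N_def intro!: sum.cong)
      ultimately show ?thesis using True by (intro exI[of _ "c(f := 0)"]) simp
    next
      case False
      define m where "m = (\<Sum>i\<in>I. N i * f' i)"
      \<comment> \<open>Read off from \<open>N' = l N - m f'\<close>, which is \<open>l N\<close>
        without its component along \<open>f'\<close>: substituting the definitions of
        \<open>N\<close> and \<open>f'\<close> leaves \<open>l c g - m d g\<close> at the old
        indices and \<open>m n\<close> at \<open>f\<close>.\<close>
      define e where "e = (\<lambda>g. l * c g - m * d g)(f := m * n)"
      define N' where "N' i = l * N i - m * f' i" for i
      have "l * n * M i - (\<Sum>g\<in>insert f F. e g * v g i) = N' i" for i
      proof -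
        have "(\<Sum>g\<in>F. e g * v g i) = (\<Sum>g\<in>F. l * (c g * v g i) - m * (d g * v g i))"
          using insert.hyps by (intro sum.cong) (auto simp: e_def algebra_simps)
        then show ?thesis using insert.hyps
          by (simp add: N'_def N_def f'_def e_def sum_subtractf sum_distrib_left[symmetric] algebra_simps)
      qed
      moreover have N'_perp: "(\<Sum>i\<in>I. N' i * v h i) = 0" if "h \<in> F" for h
      proof -
        have "(\<Sum>i\<in>I. N' i * v h i) = l * (\<Sum>i\<in>I. N i * v h i) - m * (\<Sum>i\<in>I. f' i * v h i)"
          by (simp add: N'_def left_diff_distrib sum_subtractf sum_distrib_left mult.assoc)
        then show ?thesis using N f'_perp that by simp
      qed
      moreover have "(\<Sum>i\<in>I. N' i * v f i) = 0"
      proof -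
        have "n * (\<Sum>i\<in>I. N' i * v f i) = (\<Sum>i\<in>I. N' i * f' i)" using f'_comb[of N'] N'_perp by simp
        also have "\<dots> = l * m - m * l"
          by (simp add: N'_def l_def m_def left_diff_distrib sum_subtractf sum_distrib_left mult.assoc)
        finally show ?thesis using n by simp
      qed
      ultimately show ?thesis using False by (intro exI[of _ e]) simp
    qed
  qed
qed

section \<open>Integer matrices attached to a finite group action\<close>

locale finite_action = group_action G X \<phi> for G :: "('g, 'h) monoid_scheme" and X :: "'x set" and \<phi> +
  assumes finite_G: "finite (carrier G)" and finite_X: "finite X"
begin

sublocale G: group G using group_hom by (simp add: group_hom_def)

lemma action_closed [simp]: "\<lbrakk>g \<in> carrier G; x \<in> X\<rbrakk> \<Longrightarrow> \<phi> g x \<in> X"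
  using element_image by blast

lemma action_inv [simp]: "\<lbrakk>g \<in> carrier G; x \<in> X\<rbrakk> \<Longrightarrow> \<phi> (inv\<^bsub>G\<^esub> g) (\<phi> g x) = x"
  using orbit_sym_aux by blast

lemma action_inv' [simp]: "\<lbrakk>g \<in> carrier G; x \<in> X\<rbrakk> \<Longrightarrow> \<phi> g (\<phi> (inv\<^bsub>G\<^esub> g) x) = x"
  using action_inv[of "inv\<^bsub>G\<^esub> g" x] by simp

lemma action_one [simp]: "x \<in> X \<Longrightarrow> \<phi> \<one>\<^bsub>G\<^esub> x = x"
  using id_eq_one by (metis restrict_apply')

lemma sum_reindex_action:
  fixes f :: "'x \<Rightarrow> int"
  assumes "g \<in> carrier G" shows "(\<Sum>x\<in>X. f (\<phi> g x)) = (\<Sum>x\<in>X. f x)"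
  by (rule sum.reindex_bij_witness[of _ "\<phi> (inv\<^bsub>G\<^esub> g)" "\<phi> g"]) (use assms in auto)

lemma sum_reindex_left:
  fixes f :: "'g \<Rightarrow> int"
  assumes "h \<in> carrier G" shows "(\<Sum>g\<in>carrier G. f (h \<otimes>\<^bsub>G\<^esub> g)) = (\<Sum>g\<in>carrier G. f g)"
  by (rule sum.reindex_bij_witness[of _ "\<lambda>g. inv\<^bsub>G\<^esub> h \<otimes>\<^bsub>G\<^esub> g" "\<lambda>g. h \<otimes>\<^bsub>G\<^esub> g"])
    (use assms in \<open>auto simp: G.m_assoc[symmetric]\<close>)

text \<open>Equivalently \<open>B\<close> is constant on the orbits of G on X \<times> X; these are
  the matrices of the endomorphisms of the integral permutation module.\<close>

definition invariant :: "('x \<Rightarrow> 'x \<Rightarrow> int) \<Rightarrow> bool" where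
  "invariant B \<longleftrightarrow> (\<forall>g\<in>carrier G. \<forall>x\<in>X. \<forall>y\<in>X. B (\<phi> g x) (\<phi> g y) = B x y)"

text \<open>The double centraliser in matrix form. Quantifying over integer matrices allows the same
  predicate to be used modulo \<open>p\<close>, where endomorphisms lift to invariant integer
  matrices.\<close>

definition bicentral :: "('x \<Rightarrow> 'x \<Rightarrow> int) \<Rightarrow> bool" where
  "bicentral W \<longleftrightarrow> (\<forall>B. invariant B \<longrightarrow> (\<forall>x\<in>X. \<forall>y\<in>X. (\<Sum>z\<in>X. W x z * B z y) = (\<Sum>z\<in>X. B x z * W z y)))"

definition perm_matrix :: "'g \<Rightarrow> 'x \<Rightarrow> 'x \<Rightarrow> int" where
  "perm_matrix g x y = (if \<phi> g y = x then 1 else 0)"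

text \<open>The matrix by which \<open>r\<close>, read as an element of the group ring, acts on the
  permutation module.\<close>

definition group_matrix :: "('g \<Rightarrow> int) \<Rightarrow> 'x \<Rightarrow> 'x \<Rightarrow> int" where
  "group_matrix r x y = (\<Sum>g\<in>carrier G. r g * perm_matrix g x y)"

lemma perm_matrix_left: "\<lbrakk>g \<in> carrier G; x \<in> X\<rbrakk> \<Longrightarrow> (\<Sum>z\<in>X. perm_matrix g x z * f z) = f (\<phi> (inv\<^bsub>G\<^esub> g) x)"
  for f :: "'x \<Rightarrow> int"
proof -
  assume gx: "g \<in> carrier G" "x \<in> X"
  have "perm_matrix g x z * f z = (if z = \<phi> (inv\<^bsub>G\<^esub> g) x then f z else 0)" if "z \<in> X" for z
    using gx that by (auto simp: perm_matrix_def)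
  then have "(\<Sum>z\<in>X. perm_matrix g x z * f z) = (\<Sum>z\<in>X. if z = \<phi> (inv\<^bsub>G\<^esub> g) x then f z else 0)"
    by (intro sum.cong) auto
  then show ?thesis using gx finite_X by simp
qed

lemma perm_matrix_right: "\<lbrakk>g \<in> carrier G; y \<in> X\<rbrakk> \<Longrightarrow> (\<Sum>z\<in>X. f z * perm_matrix g z y) = f (\<phi> g y)"
  for f :: "'x \<Rightarrow> int"
  using finite_X by (simp add: perm_matrix_def if_distrib cong: if_cong)

lemma bicentral_perm_matrix:
  assumes g: "g \<in> carrier G" shows "bicentral (perm_matrix g)"
  unfolding bicentral_def
proof (intro allI impI ballI)
  fix B x y assume B: "invariant B" and xy: "x \<in> X" "y \<in> X"
  have "B (\<phi> g (\<phi> (inv\<^bsub>G\<^esub> g) x)) (\<phi> g y) = B (\<phi> (inv\<^bsub>G\<^esub> g) x) y"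
    using B g xy unfolding invariant_def by (metis G.inv_closed action_closed)
  then show "(\<Sum>z\<in>X. perm_matrix g x z * B z y) = (\<Sum>z\<in>X. B x z * perm_matrix g z y)"
    using g xy by (simp add: perm_matrix_left perm_matrix_right)
qed

lemma bicentral_diff:
  assumes "bicentral W" "bicentral W'" shows "bicentral (\<lambda>x y. a * W x y - b * W' x y)"
  using assms unfolding bicentral_def
  by (simp add: left_diff_distrib right_diff_distrib sum_subtractf mult.assoc mult.left_commute sum_distrib_left[symmetric])

lemma bicentral_sum:
  assumes "finite F" "\<And>g. g \<in> F \<Longrightarrow> bicentral (W g)" shows "bicentral (\<lambda>x y. \<Sum>g\<in>F. c g * W g x y)"
  using assms
proof (induction F)
  case empty
  show ?case by (simp add: bicentral_def)
next
  case (insert f F)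
  have "bicentral (\<lambda>x y. c f * W f x y - (-1) * (\<Sum>g\<in>F. c g * W g x y))"
    by (rule bicentral_diff) (use insert in auto)
  then show ?case using insert.hyps by simp
qed

lemma bicentral_group_matrix: "bicentral (group_matrix r)"
  unfolding group_matrix_def by (rule bicentral_sum[OF finite_G bicentral_perm_matrix])

text \<open>
  With \<open>w\<^sub>x\<close> the columns of \<open>w\<close>, the matrix \<open>B y x\<close> represents
  \<open>u \<mapsto> \<Sum>g. \<langle>u, g w\<^sub>x\<rangle> g w\<^sub>y\<close>. Orthogonality gives \<open>\<Sum>x. B y x e\<^sub>x = 0\<close> for the standard basis \<open>e\<close>.
  As \<open>w\<close> commutes with \<open>B y x\<close>, also \<open>\<Sum>x. B y x w\<^sub>x = 0\<close>; pairing with \<open>w\<^sub>y\<close> and summing over \<open>y\<close> leaves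
  a sum of squares.
\<close>

lemma bicentral_orthogonal_zero:
  assumes w: "bicentral w" and orth: "\<And>h. h \<in> carrier G \<Longrightarrow> (\<Sum>x\<in>X. w (\<phi> h x) x) = 0"
    and xy: "x \<in> X" "y \<in> X"
  shows "w x y = 0"
proof -
  define i where "i g = inv\<^bsub>G\<^esub> g" for g
  have iG: "i g \<in> carrier G" if "g \<in> carrier G" for g using that by (simp add: i_def)
  define B where "B y x u v = (\<Sum>g\<in>carrier G. w (\<phi> (i g) u) y * w (\<phi> (i g) v) x)" for y x u v
  have inv: "invariant (B y x)" for y x
    unfolding invariant_def
  proof (intro ballI)
    fix h u v assume h: "h \<in> carrier G" and uv: "u \<in> X" "v \<in> X"
    have "B y x (\<phi> h u) (\<phi> h v) = (\<Sum>g\<in>carrier G. w (\<phi> (i (h \<otimes>\<^bsub>G\<^esub> g)) (\<phi> h u)) y * w (\<phi> (i (h \<otimes>\<^bsub>G\<^esub> g)) (\<phi> h v)) x)"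
      unfolding B_def by (rule sum_reindex_left[OF h, symmetric])
    also have "\<dots> = B y x u v"
      unfolding B_def
    proof (rule sum.cong[OF refl])
      fix g assume g: "g \<in> carrier G"
      have "\<phi> (i (h \<otimes>\<^bsub>G\<^esub> g)) (\<phi> h u) = \<phi> (i g) u" if "u \<in> X" for u
        using g h that composition_rule[of "\<phi> h u" "inv\<^bsub>G\<^esub> g" "inv\<^bsub>G\<^esub> h"] by (simp add: i_def G.inv_mult_group)
      then show "w (\<phi> (i (h \<otimes>\<^bsub>G\<^esub> g)) (\<phi> h u)) y * w (\<phi> (i (h \<otimes>\<^bsub>G\<^esub> g)) (\<phi> h v)) x = w (\<phi> (i g) u) y * w (\<phi> (i g) v) x"
        using uv by simp
    qed
    finally show "B y x (\<phi> h u) (\<phi> h v) = B y x u v" .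
  qed
  have trace: "(\<Sum>x\<in>X. B y x u x) = 0" for y u
  proof -
    have "(\<Sum>x\<in>X. B y x u x) = (\<Sum>g\<in>carrier G. w (\<phi> (i g) u) y * (\<Sum>x\<in>X. w (\<phi> (i g) x) x))"
      unfolding B_def by (subst sum.swap) (simp add: sum_distrib_left)
    also have "\<dots> = 0" using orth iG by simp
    finally show ?thesis .
  qed
  \<comment> \<open>\<open>q g\<close> is the sum over the columns of the pairings of
    \<open>g w\<^sub>x\<close> with \<open>w\<^sub>x\<close>.\<close>
  define q where "q g = (\<Sum>x\<in>X. \<Sum>z\<in>X. w (\<phi> (i g) z) x * w z x)" for g
  have zero: "(\<Sum>g\<in>carrier G. w (\<phi> (i g) a) y * q g) = 0" if a: "a \<in> X" for a y
  proof -
    have "(\<Sum>g\<in>carrier G. w (\<phi> (i g) a) y * q g) = (\<Sum>x\<in>X. \<Sum>z\<in>X. B y x a z * w z x)"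
    proof -
      have "(\<Sum>x\<in>X. \<Sum>z\<in>X. B y x a z * w z x)
          = (\<Sum>x\<in>X. \<Sum>z\<in>X. \<Sum>g\<in>carrier G. w (\<phi> (i g) a) y * (w (\<phi> (i g) z) x * w z x))"
        by (simp add: B_def sum_distrib_right mult.assoc)
      also have "\<dots> = (\<Sum>x\<in>X. \<Sum>g\<in>carrier G. \<Sum>z\<in>X. w (\<phi> (i g) a) y * (w (\<phi> (i g) z) x * w z x))"
        by (intro sum.cong refl sum.swap)
      also have "\<dots> = (\<Sum>g\<in>carrier G. \<Sum>x\<in>X. \<Sum>z\<in>X. w (\<phi> (i g) a) y * (w (\<phi> (i g) z) x * w z x))"
        by (rule sum.swap)
      finally show ?thesis by (simp add: q_def sum_distrib_left)
    qed
    also have "\<dots> = (\<Sum>x\<in>X. \<Sum>z\<in>X. w a z * B y x z x)"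
    proof (rule sum.cong[OF refl])
      fix x assume "x \<in> X"
      then show "(\<Sum>z\<in>X. B y x a z * w z x) = (\<Sum>z\<in>X. w a z * B y x z x)"
        by (rule w[unfolded bicentral_def, rule_format, OF inv a, symmetric])
    qed
    also have "\<dots> = (\<Sum>z\<in>X. \<Sum>x\<in>X. w a z * B y x z x)" by (rule sum.swap)
    also have "\<dots> = (\<Sum>z\<in>X. w a z * (\<Sum>x\<in>X. B y x z x))" by (simp add: sum_distrib_left)
    also have "\<dots> = 0" by (simp add: trace)
    finally show ?thesis .
  qed
  have "(\<Sum>g\<in>carrier G. q g * q g) = (\<Sum>g\<in>carrier G. \<Sum>y\<in>X. \<Sum>a\<in>X. w a y * (w (\<phi> (i g) a) y * q g))"
    by (simp add: q_def[of "_"] sum_distrib_right mult_ac)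
  also have "\<dots> = (\<Sum>y\<in>X. \<Sum>g\<in>carrier G. \<Sum>a\<in>X. w a y * (w (\<phi> (i g) a) y * q g))" by (rule sum.swap)
  also have "\<dots> = (\<Sum>y\<in>X. \<Sum>a\<in>X. \<Sum>g\<in>carrier G. w a y * (w (\<phi> (i g) a) y * q g))"
    by (intro sum.cong refl sum.swap)
  also have "\<dots> = (\<Sum>y\<in>X. \<Sum>a\<in>X. w a y * (\<Sum>g\<in>carrier G. w (\<phi> (i g) a) y * q g))"
    by (simp add: sum_distrib_left)
  also have "\<dots> = 0" using zero by simp
  finally have "(\<Sum>g\<in>carrier G. q g * q g) = 0" .
  \<comment> \<open>At the identity \<open>q\<close> is itself the sum of the squares of all entries
    of \<open>w\<close>, so a second positivity argument finishes the proof.\<close>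
  then have "q \<one>\<^bsub>G\<^esub> * q \<one>\<^bsub>G\<^esub> = 0"
    using finite_G by (subst (asm) sum_nonneg_eq_0_iff) auto
  then have "(\<Sum>x\<in>X. \<Sum>z\<in>X. w z x * w z x) = 0" by (simp add: q_def i_def)
  then have "(\<Sum>z\<in>X. w z y * w z y) = 0"
    using finite_X xy by (subst (asm) sum_nonneg_eq_0_iff) (auto intro: sum_nonneg)
  then have "w x y * w x y = 0" using finite_X xy by (subst (asm) sum_nonneg_eq_0_iff) auto
  then show ?thesis by simp
qed

text \<open>Inside the space of all matrices, subtract from \<open>n W\<close> its projection to the
  span of the permutation matrices. The remainder is bicentral and orthogonal to that span, hence
  zero; \<open>n\<close> depends only on the span.\<close>

lemma bicentral_uniform_denominator:
  "\<exists>n::int. n \<noteq> 0 \<and> (\<forall>W. bicentral W \<longrightarrow> (\<exists>r. \<forall>x\<in>X. \<forall>y\<in>X. n * W x y = group_matrix r x y))"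
proof -
  obtain n :: int where n: "n \<noteq> 0"
    and proj: "\<And>M. \<exists>c. \<forall>h\<in>carrier G. (\<Sum>i\<in>X \<times> X. (n * M i - (\<Sum>g\<in>carrier G. c g * case_prod (perm_matrix g) i)) * case_prod (perm_matrix h) i) = 0"
    using common_orthogonal_multiplier[OF finite_G, of "X \<times> X" "\<lambda>g. case_prod (perm_matrix g)"] finite_X by auto
  have "\<exists>r. \<forall>x\<in>X. \<forall>y\<in>X. n * W x y = group_matrix r x y" if W: "bicentral W" for W
  proof -
    obtain c where c: "\<forall>h\<in>carrier G. (\<Sum>i\<in>X \<times> X. (n * case_prod W i - (\<Sum>g\<in>carrier G. c g * case_prod (perm_matrix g) i)) * case_prod (perm_matrix h) i) = 0"
      using proj[of "case_prod W"] by blast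
    define w where "w x y = n * W x y - 1 * group_matrix c x y" for x y
    have "bicentral w" unfolding w_def by (rule bicentral_diff[OF W bicentral_group_matrix])
    moreover have "(\<Sum>y\<in>X. w (\<phi> h y) y) = 0" if h: "h \<in> carrier G" for h
    proof -
      have "(\<Sum>y\<in>X. w (\<phi> h y) y) = (\<Sum>y\<in>X. \<Sum>x\<in>X. w x y * perm_matrix h x y)"
        using h by (simp add: perm_matrix_right)
      also have "\<dots> = (\<Sum>x\<in>X. \<Sum>y\<in>X. w x y * perm_matrix h x y)" by (rule sum.swap)
      also have "\<dots> = (\<Sum>i\<in>X \<times> X. case_prod w i * case_prod (perm_matrix h) i)"
        by (simp add: sum.cartesian_product case_prod_unfold)
      also have "\<dots> = 0" using c h by (simp add: w_def group_matrix_def case_prod_unfold)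
      finally show ?thesis .
    qed
    ultimately have "w x y = 0" if "x \<in> X" "y \<in> X" for x y using bicentral_orthogonal_zero[of w] that by blast
    then show ?thesis by (intro exI[of _ c]) (simp add: w_def)
  qed
  then show ?thesis using n by blast
qed

text \<open>Induction on a common denominator \<open>n = p m\<close>. The congruence modulo
  \<open>p\<close> gives \<open>V = r + p U\<close>, where \<open>U\<close> is again bicentral. From
  \<open>n U = r'\<close> follows \<open>m V = m r + r'\<close>, so \<open>m\<close> is a common
  denominator as well.\<close>

lemma bicentral_group_matrix_if_residually:
  assumes cong: "\<And>p W. \<lbrakk>Factorial_Ring.prime (p::nat); bicentral W\<rbrakk>
      \<Longrightarrow> \<exists>r. \<forall>x\<in>X. \<forall>y\<in>X. int p dvd W x y - group_matrix r x y"
    and W: "bicentral W"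
  shows "\<exists>r. \<forall>x\<in>X. \<forall>y\<in>X. W x y = group_matrix r x y"
proof -
  have gm_add: "group_matrix (\<lambda>g. a * r g + b * r' g) x y = a * group_matrix r x y + b * group_matrix r' x y" for a b r r' x y
    by (simp add: group_matrix_def sum.distrib sum_distrib_left distrib_right mult.assoc)
  have main: "\<exists>r. \<forall>x\<in>X. \<forall>y\<in>X. W x y = group_matrix r x y"
    if "n > 0" "\<And>W. bicentral W \<Longrightarrow> \<exists>r. \<forall>x\<in>X. \<forall>y\<in>X. int n * W x y = group_matrix r x y" "bicentral W" for n W
    using that
  proof (induction n arbitrary: W rule: less_induct)
    case (less n)
    show ?case
    proof (cases "n = 1")
      case True
      then show ?thesis using less.prems(2)[OF less.prems(3)] by simp
    next
      case False
      then obtain p where p: "Factorial_Ring.prime p" "p dvd n" using prime_factor_nat by blast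
      then obtain m where m: "n = p * m" by auto
      have p1: "p > 1" using p(1) by (rule prime_gt_1_nat)
      have m0: "m > 0" using m less.prems(1) by (cases m) auto
      have mn: "m < n" using p1 m0 m by simp
      show ?thesis
      proof (rule less.IH[OF mn m0 _ less.prems(3)])
        fix V assume V: "bicentral V"
        obtain r where r: "\<forall>x\<in>X. \<forall>y\<in>X. int p dvd V x y - group_matrix r x y" using cong[OF p(1) V] by blast
        define U where "U x y = (V x y - group_matrix r x y) div int p" for x y
        have U: "int p * U x y = V x y - group_matrix r x y" if "x \<in> X" "y \<in> X" for x y
          using r that by (simp add: U_def)
        have "bicentral U"
          unfolding bicentral_def
        proof (intro allI impI ballI)
          fix B x y assume B: "invariant B" and xy: "x \<in> X" "y \<in> X"
          have "bicentral (\<lambda>x y. 1 * V x y - 1 * group_matrix r x y)" by (rule bicentral_diff[OF V bicentral_group_matrix])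
          then have "(\<Sum>z\<in>X. (V x z - group_matrix r x z) * B z y) = (\<Sum>z\<in>X. B x z * (V z y - group_matrix r z y))"
            using B xy unfolding bicentral_def by simp
          moreover have "(\<Sum>z\<in>X. (V x z - group_matrix r x z) * B z y) = int p * (\<Sum>z\<in>X. U x z * B z y)"
            using U xy by (simp add: sum_distrib_left mult.assoc[symmetric])
          moreover have "(\<Sum>z\<in>X. B x z * (V z y - group_matrix r z y)) = int p * (\<Sum>z\<in>X. B x z * U z y)"
          proof -
            have "(\<Sum>z\<in>X. B x z * (V z y - group_matrix r z y)) = (\<Sum>z\<in>X. B x z * (int p * U z y))"
              by (intro sum.cong refl) (simp add: U xy)
            then show ?thesis by (simp add: sum_distrib_left mult.left_commute)
          qed
          ultimately show "(\<Sum>z\<in>X. U x z * B z y) = (\<Sum>z\<in>X. B x z * U z y)" using p1 by simp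
        qed
        then obtain r' where r': "\<forall>x\<in>X. \<forall>y\<in>X. int n * U x y = group_matrix r' x y" using less.prems(2) by blast
        have "int m * V x y = group_matrix (\<lambda>g. int m * r g + 1 * r' g) x y" if "x \<in> X" "y \<in> X" for x y
        proof -
          have "int n * U x y = int m * (V x y - group_matrix r x y)"
            unfolding m U[OF that, symmetric] by simp
          then show ?thesis unfolding gm_add using r' that by (simp add: right_diff_distrib)
        qed
        then show "\<exists>r. \<forall>x\<in>X. \<forall>y\<in>X. int m * V x y = group_matrix r x y" by blast
      qed
    qed
  qed
  obtain n :: int where n: "n \<noteq> 0" "\<And>W. bicentral W \<Longrightarrow> \<exists>r. \<forall>x\<in>X. \<forall>y\<in>X. n * W x y = group_matrix r x y"
    using bicentral_uniform_denominator by blast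
  show ?thesis
  proof (rule main[of "nat \<bar>n\<bar>", OF _ _ W])
    show "nat \<bar>n\<bar> > 0" using n(1) by simp
    fix V assume "bicentral V"
    then obtain r where r: "\<forall>x\<in>X. \<forall>y\<in>X. n * V x y = group_matrix r x y" using n(2) by blast
    \<comment> \<open>The sign is absorbed into the group ring element; the zero summand only brings
      it into the shape of \<open>gm_add\<close>.\<close>
    have "\<bar>n\<bar> * V x y = group_matrix (\<lambda>g. sgn n * r g + 0 * r g) x y" if "x \<in> X" "y \<in> X" for x y
      unfolding gm_add using r that by (simp add: abs_sgn mult_ac)
    then show "\<exists>r. \<forall>x\<in>X. \<forall>y\<in>X. int (nat \<bar>n\<bar>) * V x y = group_matrix r x y"
      by (intro exI[of _ "\<lambda>g. sgn n * r g + 0 * r g"]) simp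
  qed
qed

section \<open>The integral permutation module in matrix form\<close>

abbreviation ZX where "ZX \<equiv> permutation_module \<Z> G X \<phi>"
abbreviation ZG where "ZG \<equiv> group_ring \<Z> G"

definition mat :: "('x \<Rightarrow> 'x \<Rightarrow> int) \<Rightarrow> ('x \<Rightarrow> int) \<Rightarrow> 'x \<Rightarrow> int" where
  "mat B u = (\<lambda>x\<in>X. \<Sum>y\<in>X. B x y * u y)"

definition basis :: "'x \<Rightarrow> 'x \<Rightarrow> int" where "basis y = (\<lambda>x\<in>X. if x = y then 1 else 0)"

lemma ZX_simps [simp]:
  "carrier ZX = (X \<rightarrow>\<^sub>E UNIV)" "u \<oplus>\<^bsub>ZX\<^esub> v = (\<lambda>x\<in>X. u x + v x)"
  "r \<odot>\<^bsub>ZX\<^esub> u = (\<lambda>x\<in>X. \<Sum>g\<in>carrier G. r g * u (\<phi> (inv\<^bsub>G\<^esub> g) x))"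
  by (simp_all add: permutation_module_def int_finsum_eq)

lemma ZG_carrier [simp]: "carrier ZG = (carrier G \<rightarrow>\<^sub>E UNIV)"
  by (simp add: group_ring_def)

lemma mat_closed [simp]: "mat B u \<in> X \<rightarrow>\<^sub>E UNIV"
  by (simp add: mat_def)

lemma mat_apply: "x \<in> X \<Longrightarrow> mat B u x = (\<Sum>y\<in>X. B x y * u y)"
  by (simp add: mat_def)

lemma basis_closed [simp]: "basis y \<in> X \<rightarrow>\<^sub>E UNIV"
  by (simp add: basis_def)

lemma mat_basis:
  assumes "x \<in> X" "y \<in> X" shows "mat B (basis y) x = B x y"
proof -
  have "(\<Sum>z\<in>X. B x z * basis y z) = (\<Sum>z\<in>X. if z = y then B x z else 0)"
    by (intro sum.cong refl) (simp add: basis_def)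
  then show ?thesis using assms finite_X by (simp add: mat_def)
qed

text \<open>Closure under differences yields negatives, then sums, then integer multiples of basis
  vectors, and a vector is assembled from these point by point. As the clauses are purely additive,
  the rule applies to maps known only to be additive.\<close>

lemma ZX_induct:
  assumes "u \<in> X \<rightarrow>\<^sub>E UNIV" "Z (\<lambda>x\<in>X. 0)" "\<And>y. y \<in> X \<Longrightarrow> Z (basis y)"
    "\<And>u v. \<lbrakk>u \<in> X \<rightarrow>\<^sub>E UNIV; v \<in> X \<rightarrow>\<^sub>E UNIV; Z u; Z v\<rbrakk> \<Longrightarrow> Z (\<lambda>x\<in>X. u x - v x)"
  shows "Z u"
proof -
  have neg: "Z (\<lambda>x\<in>X. - v x)" if "v \<in> X \<rightarrow>\<^sub>E UNIV" "Z v" for v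
  proof -
    have "Z (\<lambda>x\<in>X. (\<lambda>x\<in>X. 0) x - v x)"
      by (rule assms(4)[of "\<lambda>x\<in>X. 0" v]) (use that assms(2) in simp_all)
    moreover have "(\<lambda>x\<in>X. (\<lambda>x\<in>X. 0) x - v x) = (\<lambda>x\<in>X. - v x)" by (auto simp: fun_eq_iff)
    ultimately show ?thesis by (simp only:)
  qed
  have plus: "Z (\<lambda>x\<in>X. u x + v x)" if "u \<in> X \<rightarrow>\<^sub>E UNIV" "v \<in> X \<rightarrow>\<^sub>E UNIV" "Z u" "Z v" for u v
  proof -
    have "Z (\<lambda>x\<in>X. u x - (\<lambda>x\<in>X. - v x) x)"
      by (rule assms(4)[of u "\<lambda>x\<in>X. - v x"]) (use that neg[OF that(2,4)] in simp_all)
    moreover have "(\<lambda>x\<in>X. u x - (\<lambda>x\<in>X. - v x) x) = (\<lambda>x\<in>X. u x + v x)" by (auto simp: fun_eq_iff)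
    ultimately show ?thesis by (simp only:)
  qed
  have mult: "Z (\<lambda>x\<in>X. k * basis y x)" if y: "y \<in> X" for k :: int and y
  proof (induction k rule: int_induct[where k = 0])
    case base
    have "(\<lambda>x\<in>X. 0 * basis y x) = (\<lambda>x\<in>X. 0)" by simp
    then show ?case using assms(2) by (simp only:)
  next
    case (step1 i)
    have "Z (\<lambda>x\<in>X. (\<lambda>x\<in>X. i * basis y x) x + basis y x)"
      by (rule plus[of "\<lambda>x\<in>X. i * basis y x" "basis y"]) (simp, simp, rule step1(2), rule assms(3)[OF y])
    moreover have "(\<lambda>x\<in>X. (\<lambda>x\<in>X. i * basis y x) x + basis y x) = (\<lambda>x\<in>X. (i + 1) * basis y x)"
      by (auto simp: fun_eq_iff distrib_right)
    ultimately show ?case by (simp only:)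
  next
    case (step2 i)
    have "Z (\<lambda>x\<in>X. (\<lambda>x\<in>X. i * basis y x) x - basis y x)"
      by (rule assms(4)[of "\<lambda>x\<in>X. i * basis y x" "basis y"]) (simp, simp, rule step2(2), rule assms(3)[OF y])
    moreover have "(\<lambda>x\<in>X. (\<lambda>x\<in>X. i * basis y x) x - basis y x) = (\<lambda>x\<in>X. (i - 1) * basis y x)"
      by (auto simp: fun_eq_iff left_diff_distrib)
    ultimately show ?case by (simp only:)
  qed
  have "Z (\<lambda>x\<in>X. if x \<in> F then u x else 0)" if "F \<subseteq> X" for F
    using finite_subset[OF that finite_X] that
  proof (induction F)
    case empty
    have "(\<lambda>x\<in>X. if x \<in> {} then u x else 0) = (\<lambda>x\<in>X. 0)" by simp
    then show ?case using assms(2) by (simp only:)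
  next
    case (insert y F)
    have "Z (\<lambda>x\<in>X. (\<lambda>x\<in>X. u y * basis y x) x + (\<lambda>x\<in>X. if x \<in> F then u x else 0) x)"

      by (rule plus[of "\<lambda>x\<in>X. u y * basis y x" "\<lambda>x\<in>X. if x \<in> F then u x else 0"]) (simp, simp, rule mult, use insert in simp, rule insert.IH, use insert in simp)
    moreover have "(\<lambda>x\<in>X. (\<lambda>x\<in>X. u y * basis y x) x + (\<lambda>x\<in>X. if x \<in> F then u x else 0) x)
        = (\<lambda>x\<in>X. if x \<in> insert y F then u x else 0)"
      using insert.hyps by (auto simp: basis_def fun_eq_iff)
    ultimately show ?case by (simp only:)
  qed
  from this[of X] have "Z (\<lambda>x\<in>X. if x \<in> X then u x else 0)" by simp
  moreover have "(\<lambda>x\<in>X. if x \<in> X then u x else 0) = u"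
    using assms(1) by (auto simp: fun_eq_iff PiE_iff extensional_def)
  ultimately show ?thesis by (simp only:)
qed

text \<open>Over the integers additivity already forces linearity, so the values on the basis
  vectors are the columns of a matrix for \<open>f\<close>.\<close>

lemma additive_eq_mat:
  assumes "f \<in> (X \<rightarrow>\<^sub>E UNIV) \<rightarrow>\<^sub>E (X \<rightarrow>\<^sub>E UNIV)"
    and add: "\<And>u v. \<lbrakk>u \<in> X \<rightarrow>\<^sub>E UNIV; v \<in> X \<rightarrow>\<^sub>E UNIV\<rbrakk> \<Longrightarrow> f (\<lambda>x\<in>X. u x + v x) = (\<lambda>x\<in>X. f u x + f v x)"
    and u: "u \<in> X \<rightarrow>\<^sub>E UNIV"
  shows "f u = mat (\<lambda>x y. f (basis y) x) u"
  using u
proof (rule ZX_induct)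
  have fE: "f v \<in> X \<rightarrow>\<^sub>E UNIV" if "v \<in> X \<rightarrow>\<^sub>E UNIV" for v using assms(1) that by (rule PiE_mem)
  have eqI: "v = w" if "v \<in> X \<rightarrow>\<^sub>E (UNIV :: int set)" "w \<in> X \<rightarrow>\<^sub>E UNIV" "\<And>x. x \<in> X \<Longrightarrow> v x = w x" for v w
    using that by (rule PiE_ext)
  define oz where "oz = (\<lambda>x\<in>X. 0 :: int)"
  have oE: "oz \<in> X \<rightarrow>\<^sub>E UNIV" and oo: "(\<lambda>x\<in>X. oz x + oz x) = oz" by (auto simp: oz_def)
  have "f oz = (\<lambda>x\<in>X. f oz x + f oz x)" using add[OF oE oE] unfolding oo .
  then have z: "f oz x = 0" if "x \<in> X" for x
  proof -
    from fun_cong[OF \<open>f oz = _\<close>, of x] have "f oz x = f oz x + f oz x" using that by (simp only: restrict_apply if_True)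
    then show ?thesis by linarith
  qed
  show "f (\<lambda>x\<in>X. 0) = mat (\<lambda>x y. f (basis y) x) (\<lambda>x\<in>X. 0)"
    unfolding oz_def[symmetric]
    by (rule eqI[OF fE[OF oE] mat_closed]) (simp add: z mat_apply, simp add: oz_def)
  show "f (basis y) = mat (\<lambda>x y. f (basis y) x) (basis y)" if "y \<in> X" for y
    by (rule eqI[OF fE[OF basis_closed] mat_closed]) (simp add: mat_basis that)
  fix u v :: "'x \<Rightarrow> int"
  assume uv: "u \<in> X \<rightarrow>\<^sub>E UNIV" "v \<in> X \<rightarrow>\<^sub>E UNIV"
    and IH: "f u = mat (\<lambda>x y. f (basis y) x) u" "f v = mat (\<lambda>x y. f (basis y) x) v"
  define d where "d = (\<lambda>x\<in>X. u x - v x)"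
  have dE: "d \<in> X \<rightarrow>\<^sub>E UNIV" by (simp add: d_def)
  have "u = (\<lambda>x\<in>X. d x + v x)" using uv by (auto simp: d_def fun_eq_iff PiE_iff extensional_def)
  then have "f u = (\<lambda>x\<in>X. f d x + f v x)" using add[OF dE uv(2)] by (simp only:)
  then have fd: "f d x = f u x - f v x" if "x \<in> X" for x using fun_cong[of "f u" _ x] that by simp
  show "f (\<lambda>x\<in>X. u x - v x) = mat (\<lambda>x y. f (basis y) x) (\<lambda>x\<in>X. u x - v x)"
    unfolding d_def[symmetric]
  proof (rule eqI[OF fE[OF dE] mat_closed])
    fix x assume x: "x \<in> X"
    have "f d x = mat (\<lambda>x y. f (basis y) x) u x - mat (\<lambda>x y. f (basis y) x) v x"
      unfolding fd[OF x] IH[symmetric] ..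
    also have "\<dots> = mat (\<lambda>x y. f (basis y) x) d x"
      using x by (simp add: mat_apply d_def right_diff_distrib sum_subtractf)
    finally show "f d x = mat (\<lambda>x y. f (basis y) x) d x" .
  qed
qed

lemma mat_add: "mat B (\<lambda>x\<in>X. u x + v x) = (\<lambda>x\<in>X. mat B u x + mat B v x)"
  by (auto simp: mat_def fun_eq_iff distrib_left sum.distrib)

text \<open>Substituting \<open>\<phi> g y\<close> for \<open>y\<close> in the matrix product and
  using invariance moves each group element past \<open>B\<close>.\<close>

lemma mat_End:
  assumes B: "invariant B" shows "(\<lambda>u\<in>X \<rightarrow>\<^sub>E UNIV. mat B u) \<in> carrier (End_ring ZG ZX)"
  unfolding End_ring_mem ZX_simps ZG_carrier
proof (intro conjI ballI)
  show "(\<lambda>u\<in>X \<rightarrow>\<^sub>E UNIV. mat B u) \<in> (X \<rightarrow>\<^sub>E UNIV) \<rightarrow>\<^sub>E (X \<rightarrow>\<^sub>E UNIV)" by simp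
  fix u :: "'x \<Rightarrow> int" assume u: "u \<in> X \<rightarrow>\<^sub>E UNIV"
  show "(\<lambda>u\<in>X \<rightarrow>\<^sub>E UNIV. mat B u) (\<lambda>x\<in>X. u x + v x) = (\<lambda>x\<in>X. (\<lambda>u\<in>X \<rightarrow>\<^sub>E UNIV. mat B u) u x + (\<lambda>u\<in>X \<rightarrow>\<^sub>E UNIV. mat B u) v x)"
    if "v \<in> X \<rightarrow>\<^sub>E UNIV" for v using u that by (simp add: mat_add)
  fix r :: "'g \<Rightarrow> int" assume "r \<in> carrier G \<rightarrow>\<^sub>E UNIV"
  have "mat B (\<lambda>x\<in>X. \<Sum>g\<in>carrier G. r g * u (\<phi> (inv\<^bsub>G\<^esub> g) x)) x = (\<Sum>g\<in>carrier G. r g * mat B u (\<phi> (inv\<^bsub>G\<^esub> g) x))"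
    if x: "x \<in> X" for x
  proof -
    have "mat B (\<lambda>x\<in>X. \<Sum>g\<in>carrier G. r g * u (\<phi> (inv\<^bsub>G\<^esub> g) x)) x
        = (\<Sum>y\<in>X. \<Sum>g\<in>carrier G. r g * (B x y * u (\<phi> (inv\<^bsub>G\<^esub> g) y)))"
      using x by (simp add: mat_apply sum_distrib_left mult.left_commute)
    also have "\<dots> = (\<Sum>g\<in>carrier G. \<Sum>y\<in>X. r g * (B x y * u (\<phi> (inv\<^bsub>G\<^esub> g) y)))" by (rule sum.swap)
    also have "\<dots> = (\<Sum>g\<in>carrier G. r g * mat B u (\<phi> (inv\<^bsub>G\<^esub> g) x))"
    proof (rule sum.cong[OF refl])
      fix g assume g: "g \<in> carrier G"
      have "(\<Sum>y\<in>X. B x y * u (\<phi> (inv\<^bsub>G\<^esub> g) y)) = (\<Sum>y\<in>X. B x (\<phi> g y) * u (\<phi> (inv\<^bsub>G\<^esub> g) (\<phi> g y)))"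
        by (rule sum_reindex_action[OF g, symmetric])
      also have "\<dots> = (\<Sum>y\<in>X. B (\<phi> (inv\<^bsub>G\<^esub> g) x) y * u y)"
      proof (rule sum.cong[OF refl])
        fix y assume y: "y \<in> X"
        have "B (\<phi> g (\<phi> (inv\<^bsub>G\<^esub> g) x)) (\<phi> g y) = B (\<phi> (inv\<^bsub>G\<^esub> g) x) y"
          using B g x y unfolding invariant_def by (metis G.inv_closed action_closed)
        then show "B x (\<phi> g y) * u (\<phi> (inv\<^bsub>G\<^esub> g) (\<phi> g y)) = B (\<phi> (inv\<^bsub>G\<^esub> g) x) y * u y"
          using g x y by simp
      qed
      finally show "(\<Sum>y\<in>X. r g * (B x y * u (\<phi> (inv\<^bsub>G\<^esub> g) y))) = r g * mat B u (\<phi> (inv\<^bsub>G\<^esub> g) x)"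
        using g x by (simp add: mat_apply sum_distrib_left[symmetric])
    qed
    finally show ?thesis .
  qed
  then show "(\<lambda>u\<in>X \<rightarrow>\<^sub>E UNIV. mat B u) (\<lambda>x\<in>X. \<Sum>g\<in>carrier G. r g * u (\<phi> (inv\<^bsub>G\<^esub> g) x))
      = (\<lambda>x\<in>X. \<Sum>g\<in>carrier G. r g * (\<lambda>u\<in>X \<rightarrow>\<^sub>E UNIV. mat B u) u (\<phi> (inv\<^bsub>G\<^esub> g) x))"
    using u by (auto simp: fun_eq_iff mat_def)
qed

lemma mat_mat: "x \<in> X \<Longrightarrow> mat B (mat C u) x = (\<Sum>y\<in>X. (\<Sum>z\<in>X. B x z * C z y) * u y)"
proof -
  assume x: "x \<in> X"
  have "mat B (mat C u) x = (\<Sum>z\<in>X. \<Sum>y\<in>X. B x z * (C z y * u y))"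
    using x by (simp add: mat_apply sum_distrib_left)
  also have "\<dots> = (\<Sum>y\<in>X. \<Sum>z\<in>X. B x z * (C z y * u y))" by (rule sum.swap)
  finally show ?thesis by (simp add: sum_distrib_right mult.assoc)
qed

lemma bicentral_mat_commute:
  assumes "bicentral W" "invariant B" shows "mat W (mat B u) = mat B (mat W u)"
proof (rule PiE_ext[OF mat_closed mat_closed])
  fix x assume x: "x \<in> X"
  have "(\<Sum>z\<in>X. W x z * B z y) = (\<Sum>z\<in>X. B x z * W z y)" if "y \<in> X" for y
    using assms x that unfolding bicentral_def by blast
  then show "mat W (mat B u) x = mat B (mat W u) x" using x by (simp add: mat_mat)
qed

text \<open>Additivity makes \<sigma> a matrix. Commutation with the endomorphisms
  \<open>mat B\<close>, tested on basis vectors, is the matrix identity that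
  \<open>bicentral\<close> demands.\<close>

lemma DEnd_ZX_matrix:
  assumes \<sigma>: "\<sigma> \<in> carrier (DEnd_ring ZG ZX)"
  obtains W where "bicentral W" "\<And>u. u \<in> X \<rightarrow>\<^sub>E UNIV \<Longrightarrow> \<sigma> u = mat W u"
proof -
  have fn: "\<sigma> \<in> (X \<rightarrow>\<^sub>E UNIV) \<rightarrow>\<^sub>E (X \<rightarrow>\<^sub>E UNIV)"
    and add: "\<forall>x\<in>X \<rightarrow>\<^sub>E UNIV. \<forall>y\<in>X \<rightarrow>\<^sub>E UNIV. \<sigma> (\<lambda>z\<in>X. x z + y z) = (\<lambda>z\<in>X. \<sigma> x z + \<sigma> y z)"
    and comm: "\<forall>\<alpha>\<in>carrier (End_ring ZG ZX). \<forall>x\<in>X \<rightarrow>\<^sub>E UNIV. \<sigma> (\<alpha> x) = \<alpha> (\<sigma> x)"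
    using \<sigma> unfolding DEnd_ring_mem ZX_simps by blast+
  define W where "W x y = \<sigma> (basis y) x" for x y
  have mat: "\<sigma> u = mat W u" if "u \<in> X \<rightarrow>\<^sub>E UNIV" for u
    unfolding W_def by (rule additive_eq_mat[OF fn add[rule_format] that])
  have "bicentral W"
    unfolding bicentral_def
  proof (intro allI impI ballI)
    fix B x y assume B: "invariant B" and xy: "x \<in> X" "y \<in> X"
    have "mat W (mat B (basis y)) = mat B (mat W (basis y))"
      using comm[rule_format, OF mat_End[OF B] basis_closed[of y]] by (simp add: mat)
    then have "mat W (mat B (basis y)) x = mat B (mat W (basis y)) x" by simp
    then show "(\<Sum>z\<in>X. W x z * B z y) = (\<Sum>z\<in>X. B x z * W z y)"
      using xy by (simp add: mat_apply[of x] mat_basis)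
  qed
  then show ?thesis using mat by (rule that)
qed

lemma group_matrix_mat:
  assumes x: "x \<in> X" shows "mat (group_matrix r) u x = (\<Sum>g\<in>carrier G. r g * u (\<phi> (inv\<^bsub>G\<^esub> g) x))"
proof -
  have "mat (group_matrix r) u x = (\<Sum>y\<in>X. \<Sum>g\<in>carrier G. r g * (perm_matrix g x y * u y))"
    using x by (simp add: mat_apply group_matrix_def sum_distrib_right mult.assoc)
  also have "\<dots> = (\<Sum>g\<in>carrier G. \<Sum>y\<in>X. r g * (perm_matrix g x y * u y))" by (rule sum.swap)
  also have "\<dots> = (\<Sum>g\<in>carrier G. r g * u (\<phi> (inv\<^bsub>G\<^esub> g) x))"
    using x by (simp add: sum_distrib_left[symmetric] perm_matrix_left)
  finally show ?thesis .
qed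

lemma smult_eq_mat: "r \<odot>\<^bsub>ZX\<^esub> u = mat (group_matrix r) u"
  by (rule PiE_ext[of _ X "\<lambda>_. UNIV"]) (simp_all add: group_matrix_mat)

lemma mat_cong: "(\<And>x y. \<lbrakk>x \<in> X; y \<in> X\<rbrakk> \<Longrightarrow> B x y = C x y) \<Longrightarrow> mat B u = mat C u"
  by (auto simp: mat_def fun_eq_iff intro!: sum.cong)

lemma double_centraliser_ZX:
  assumes "\<And>W. bicentral W \<Longrightarrow> \<exists>r. \<forall>x\<in>X. \<forall>y\<in>X. W x y = group_matrix r x y"
  shows "double_centraliser_property ZG ZX"
  unfolding double_centraliser_property_def
proof
  show "homothety ZX ` carrier ZG \<subseteq> carrier (DEnd_ring ZG ZX)"
  proof
    fix \<sigma> assume "\<sigma> \<in> homothety ZX ` carrier ZG"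
    then obtain r where r: "r \<in> carrier ZG" "\<sigma> = homothety ZX r" by blast
    have app: "\<sigma> u = mat (group_matrix r) u" if "u \<in> X \<rightarrow>\<^sub>E UNIV" for u
      using that unfolding r(2) homothety_def smult_eq_mat by simp
    show "\<sigma> \<in> carrier (DEnd_ring ZG ZX)"
      unfolding DEnd_ring_mem
    proof (intro conjI ballI)
      show "\<sigma> \<in> carrier ZX \<rightarrow>\<^sub>E carrier ZX" unfolding r(2) homothety_def smult_eq_mat by simp
      show "\<sigma> (u \<oplus>\<^bsub>ZX\<^esub> v) = \<sigma> u \<oplus>\<^bsub>ZX\<^esub> \<sigma> v" if "u \<in> carrier ZX" "v \<in> carrier ZX" for u v
        using that by (simp add: app mat_add)
      fix \<alpha> u assume \<alpha>: "\<alpha> \<in> carrier (End_ring ZG ZX)" and u: "u \<in> carrier ZX"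
      have "\<alpha> u \<in> carrier ZX" "\<alpha> (r \<odot>\<^bsub>ZX\<^esub> u) = r \<odot>\<^bsub>ZX\<^esub> \<alpha> u"
        using \<alpha> u r(1) unfolding End_ring_mem by blast+
      then show "\<sigma> (\<alpha> u) = \<alpha> (\<sigma> u)" using u unfolding r(2) homothety_def by simp
    qed
  qed
  show "carrier (DEnd_ring ZG ZX) \<subseteq> homothety ZX ` carrier ZG"
  proof
    fix \<sigma> assume \<sigma>: "\<sigma> \<in> carrier (DEnd_ring ZG ZX)"
    obtain W where W: "bicentral W" "\<And>u. u \<in> X \<rightarrow>\<^sub>E UNIV \<Longrightarrow> \<sigma> u = mat W u"
      by (rule DEnd_ZX_matrix[OF \<sigma>]) (rule that)
    obtain r where r: "\<forall>x\<in>X. \<forall>y\<in>X. W x y = group_matrix r x y" using assms[OF W(1)] by blast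
    \<comment> \<open>Elements of the group ring are extensional; values of \<open>r\<close> outside
      G do not enter its matrix.\<close>
    let ?r = "restrict r (carrier G)"
    have gr: "group_matrix ?r x y = group_matrix r x y" for x y by (simp add: group_matrix_def)
    have "\<sigma> = homothety ZX ?r"
    proof (rule PiE_ext)
      show "\<sigma> \<in> carrier ZX \<rightarrow>\<^sub>E carrier ZX" using \<sigma> unfolding DEnd_ring_mem by blast
      show "homothety ZX ?r \<in> carrier ZX \<rightarrow>\<^sub>E carrier ZX" unfolding homothety_def smult_eq_mat by simp
      fix u assume u: "u \<in> carrier ZX"
      then have "\<sigma> u = mat W u" using W(2) by simp
      also have "\<dots> = mat (group_matrix ?r) u" by (rule mat_cong) (use r gr in simp)
      finally show "\<sigma> u = homothety ZX ?r u" using u unfolding homothety_def smult_eq_mat by simp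
    qed
    moreover have "?r \<in> carrier ZG" by simp
    ultimately show "\<sigma> \<in> homothety ZX ` carrier ZG" by blast
  qed
qed

end

section \<open>Reduction of permutation modules modulo p\<close>

locale modular_action = finite_action G X \<phi>
  for G :: "('g, 'h) monoid_scheme" and X :: "'x set" and \<phi> +
  fixes p :: nat
begin

abbreviation F where "F \<equiv> ZFact (int p)"
abbreviation FX where "FX \<equiv> permutation_module F G X \<phi>"
abbreviation FG where "FG \<equiv> group_ring F G"
abbreviation Q where "Q \<equiv> ZMod (int p)"

sublocale F: cring F by (rule ZFact_is_cring)

lemma ring_hom_Q: "Q \<in> ring_hom \<Z> F"
proof -
  interpret I: ideal "Idl\<^bsub>\<Z>\<^esub> {int p}" \<Z> by (rule int.genideal_ideal) simp
  have "(\<lambda>a. ZMod (int p) a) \<in> ring_hom \<Z> F"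
    unfolding ZMod_def ZFact_def by (rule I.rcos_ring_hom)
  then show ?thesis by simp
qed

lemma Q_closed [simp]: "Q a \<in> carrier F"
  using ring_hom_closed[OF ring_hom_Q, of a] by simp

lemma Q_add: "Q a \<oplus>\<^bsub>F\<^esub> Q b = Q (a + b)"
  using ring_hom_add[OF ring_hom_Q, of a b] by simp

lemma Q_mult: "Q a \<otimes>\<^bsub>F\<^esub> Q b = Q (a * b)"
  using ring_hom_mult[OF ring_hom_Q, of a b] by simp

lemma Q_eq_iff: "Q a = Q b \<longleftrightarrow> int p dvd a - b"
  by (simp add: ZMod_eq_mod mod_eq_dvd_iff)

lemma Q_zero: "Q 0 = \<zero>\<^bsub>F\<^esub>"
  using Q_add[of 0 0] F.add.l_cancel_one[of "Q 0" "Q 0"] by simp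

lemma Q_finsum: "finite I \<Longrightarrow> (\<Oplus>\<^bsub>F\<^esub>i\<in>I. Q (f i)) = Q (\<Sum>i\<in>I. f i)"
  by (induction I rule: finite_induct) (simp_all add: Q_zero Q_add)

text \<open>One fixed choice for all purposes: equal residue classes receive the same integer, so
  coincidences between residues lift to equalities.\<close>

definition rep where "rep Y = (SOME a. Q a = Y)"

lemma Q_rep: assumes "Y \<in> carrier F" shows "Q (rep Y) = Y"
proof -
  have "Y \<in> a_rcosets\<^bsub>\<Z>\<^esub> (Idl\<^bsub>\<Z>\<^esub> {int p})" using assms by (simp add: ZFact_def FactRing_def)
  then have "\<exists>a. Q a = Y" by (auto simp: A_RCOSETS_def' ZMod_def)
  then show ?thesis unfolding rep_def by (rule someI_ex)
qed

definition red :: "('x \<Rightarrow> int) \<Rightarrow> 'x \<Rightarrow> int set" where "red u = (\<lambda>x\<in>X. Q (u x))"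

definition lift :: "('x \<Rightarrow> int set) \<Rightarrow> 'x \<Rightarrow> int" where "lift v = (\<lambda>x\<in>X. rep (v x))"

definition red_group :: "('g \<Rightarrow> int) \<Rightarrow> 'g \<Rightarrow> int set" where "red_group r = (\<lambda>g\<in>carrier G. Q (r g))"

lemma FX_simps [simp]:
  "carrier FX = (X \<rightarrow>\<^sub>E carrier F)" "u \<oplus>\<^bsub>FX\<^esub> v = (\<lambda>x\<in>X. u x \<oplus>\<^bsub>F\<^esub> v x)"
  "r \<odot>\<^bsub>FX\<^esub> u = (\<lambda>x\<in>X. \<Oplus>\<^bsub>F\<^esub>g\<in>carrier G. r g \<otimes>\<^bsub>F\<^esub> u (\<phi> (inv\<^bsub>G\<^esub> g) x))"
  by (simp_all add: permutation_module_def)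

lemma FG_carrier [simp]: "carrier FG = (carrier G \<rightarrow>\<^sub>E carrier F)"
  by (simp add: group_ring_def)

lemma red_closed [simp]: "red u \<in> X \<rightarrow>\<^sub>E carrier F"
  by (simp add: red_def)

lemma red_apply: "x \<in> X \<Longrightarrow> red u x = Q (u x)"
  by (simp add: red_def)

lemma lift_closed [simp]: "lift v \<in> X \<rightarrow>\<^sub>E UNIV"
  by (simp add: lift_def)

lemma red_lift:
  assumes v: "v \<in> X \<rightarrow>\<^sub>E carrier F" shows "red (lift v) = v"
proof (rule PiE_ext[OF red_closed v])
  fix x assume "x \<in> X"
  then show "red (lift v) x = v x" using PiE_mem[OF v, of x] by (simp add: red_def lift_def Q_rep)
qed

lemma red_group_closed [simp]: "red_group r \<in> carrier G \<rightarrow>\<^sub>E carrier F"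
  by (simp add: red_group_def)

lemma red_smult: "red_group r \<odot>\<^bsub>FX\<^esub> red u = red (mat (group_matrix r) u)"
proof (rule PiE_ext[of _ X "\<lambda>_. carrier F"])
  have eq: "(\<Oplus>\<^bsub>F\<^esub>g\<in>carrier G. red_group r g \<otimes>\<^bsub>F\<^esub> red u (\<phi> (inv\<^bsub>G\<^esub> g) x)) = Q (mat (group_matrix r) u x)"
    if x: "x \<in> X" for x
  proof -
    have "(\<Oplus>\<^bsub>F\<^esub>g\<in>carrier G. red_group r g \<otimes>\<^bsub>F\<^esub> red u (\<phi> (inv\<^bsub>G\<^esub> g) x)) = (\<Oplus>\<^bsub>F\<^esub>g\<in>carrier G. Q (r g * u (\<phi> (inv\<^bsub>G\<^esub> g) x)))"
      by (rule F.finsum_cong') (use x in \<open>simp_all add: red_group_def red_apply Q_mult\<close>)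
    then show ?thesis using finite_G by (simp add: Q_finsum group_matrix_mat[OF x])
  qed
  then show "red_group r \<odot>\<^bsub>FX\<^esub> red u \<in> X \<rightarrow>\<^sub>E carrier F" by simp
  fix x assume x: "x \<in> X"
  then show "(red_group r \<odot>\<^bsub>FX\<^esub> red u) x = red (mat (group_matrix r) u) x"
    using eq[OF x] by (simp add: red_apply)
qed simp

lemma red_add: "red (\<lambda>x\<in>X. u x + v x) = red u \<oplus>\<^bsub>FX\<^esub> red v"
  by (auto simp: red_def fun_eq_iff Q_add)

text \<open>Invariance over \<open>F\<close> says that certain matrix entries coincide, and the
  fixed choice \<open>rep\<close> turns coinciding residues into equal integers. So the lifted
  matrix is exactly invariant and not only modulo \<open>p\<close>. This does for permutation
  modules what surjectivity of \<open>Psi\<close> does in general.\<close>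

lemma End_FX_matrix:
  assumes \<beta>: "\<beta> \<in> carrier (End_ring FG FX)"
  obtains B where "invariant B" "\<And>u. u \<in> X \<rightarrow>\<^sub>E UNIV \<Longrightarrow> \<beta> (red u) = red (mat B u)"
proof -
  have \<beta>E: "\<beta> v \<in> X \<rightarrow>\<^sub>E carrier F" if "v \<in> X \<rightarrow>\<^sub>E carrier F" for v
    using \<beta> that unfolding End_ring_mem FX_simps by (blast dest: PiE_mem)
  have \<beta>_add: "\<beta> (v \<oplus>\<^bsub>FX\<^esub> w) = \<beta> v \<oplus>\<^bsub>FX\<^esub> \<beta> w" if "v \<in> X \<rightarrow>\<^sub>E carrier F" "w \<in> X \<rightarrow>\<^sub>E carrier F" for v w
    using \<beta> that unfolding End_ring_mem FX_simps(1) by blast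
  have \<beta>_smult: "\<beta> (r \<odot>\<^bsub>FX\<^esub> v) = r \<odot>\<^bsub>FX\<^esub> \<beta> v" if "r \<in> carrier G \<rightarrow>\<^sub>E carrier F" "v \<in> X \<rightarrow>\<^sub>E carrier F" for r v
    using \<beta> that unfolding End_ring_mem FX_simps(1) FG_carrier by blast
  define B where "B x y = lift (\<beta> (red (basis y))) x" for x y
  have B: "red (\<lambda>x\<in>X. B x y) = \<beta> (red (basis y))" for y
  proof -
    have "(\<lambda>x\<in>X. B x y) = lift (\<beta> (red (basis y)))" by (auto simp: B_def lift_def fun_eq_iff)
    then show ?thesis using red_lift[OF \<beta>E[OF red_closed]] by simp
  qed
  have Bx: "Q (B x y) = \<beta> (red (basis y)) x" if "x \<in> X" for x y
    using fun_cong[OF B, of y x] that by (simp add: red_def)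
  have "invariant B"
    unfolding invariant_def
  proof (intro ballI)
    fix g x y assume g: "g \<in> carrier G" and x: "x \<in> X" and y: "y \<in> X"
    \<comment> \<open>The group element \<open>g\<close> as a member of the group ring: linearity of
      \<beta> is applied to it, and it sends the basis vector at \<open>y\<close> to the one at
      \<open>\<phi> g y\<close>.\<close>
    define r where "r h = (if h = g then 1 else 0 :: int)" for h
    have gm: "mat (group_matrix r) u z = u (\<phi> (inv\<^bsub>G\<^esub> g) z)" if "z \<in> X" for u z
    proof -
      have "(\<Sum>h\<in>carrier G. r h * u (\<phi> (inv\<^bsub>G\<^esub> h) z)) = (\<Sum>h\<in>carrier G. if h = g then u (\<phi> (inv\<^bsub>G\<^esub> h) z) else 0)"
        by (rule sum.cong) (auto simp: r_def)
      then show ?thesis using that g finite_G by (simp add: group_matrix_mat)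
    qed
    have "mat (group_matrix r) (basis y) = basis (\<phi> g y)"
    proof (rule PiE_ext[OF mat_closed basis_closed])
      fix z assume z: "z \<in> X"
      have "\<phi> (inv\<^bsub>G\<^esub> g) z = y \<longleftrightarrow> z = \<phi> g y" using g y z by auto
      then show "mat (group_matrix r) (basis y) z = basis (\<phi> g y) z"
        using z g by (simp add: gm basis_def)
    qed
    then have "red (basis (\<phi> g y)) = red_group r \<odot>\<^bsub>FX\<^esub> red (basis y)" by (simp only: red_smult)
    then have "\<beta> (red (basis (\<phi> g y))) = red_group r \<odot>\<^bsub>FX\<^esub> \<beta> (red (basis y))"
      using \<beta>_smult[OF red_group_closed red_closed] by (simp only:)
    also have "\<dots> = red (mat (group_matrix r) (\<lambda>x\<in>X. B x y))" unfolding B[symmetric] by (rule red_smult)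
    finally have "\<beta> (red (basis (\<phi> g y))) (\<phi> g x) = Q (B x y)"
      using g x by (simp add: red_apply gm)
    also have "\<dots> = \<beta> (red (basis y)) x" by (rule Bx[OF x])
    finally show "B (\<phi> g x) (\<phi> g y) = B x y" using x g by (simp add: B_def lift_def)
  qed
  moreover have "\<beta> (red u) = red (mat B u)" if "u \<in> X \<rightarrow>\<^sub>E UNIV" for u
    using that
  proof (rule ZX_induct)
    define oz where "oz = (\<lambda>x\<in>X. 0 :: int)"
    have "(\<lambda>x\<in>X. oz x + oz x) = oz" by (auto simp: oz_def)
    then have "red oz \<oplus>\<^bsub>FX\<^esub> red oz = red oz" using red_add[of oz oz] by (simp only:)
    then have "\<beta> (red oz) \<oplus>\<^bsub>FX\<^esub> \<beta> (red oz) = \<beta> (red oz)"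
      using \<beta>_add[OF red_closed[of oz] red_closed[of oz]] by (simp only:)
    then have z: "\<beta> (red oz) x \<oplus>\<^bsub>F\<^esub> \<beta> (red oz) x = \<beta> (red oz) x" if "x \<in> X" for x
      using that by (auto dest: fun_cong[of _ _ x])
    show "\<beta> (red (\<lambda>x\<in>X. 0)) = red (mat B (\<lambda>x\<in>X. 0))"
      unfolding oz_def[symmetric]
    proof (rule PiE_ext[OF \<beta>E[OF red_closed] red_closed])
      fix x assume x: "x \<in> X"
      have c: "\<beta> (red oz) x \<in> carrier F" using PiE_mem[OF \<beta>E[OF red_closed] x] .
      have "\<beta> (red oz) x = \<zero>\<^bsub>F\<^esub>" using z[OF x] F.add.l_cancel_one[OF c c] by simp
      moreover have "mat B oz x = 0" using x by (simp add: mat_apply oz_def)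
      ultimately show "\<beta> (red oz) x = red (mat B oz) x" using x by (simp add: red_apply Q_zero)
    qed
    show "\<beta> (red (basis y)) = red (mat B (basis y))" if y: "y \<in> X" for y
    proof (rule PiE_ext[OF \<beta>E[OF red_closed] red_closed])
      fix x assume x: "x \<in> X"
      then show "\<beta> (red (basis y)) x = red (mat B (basis y)) x"
        using y Bx[OF x] by (simp add: red_apply mat_basis)
    qed
    fix u v :: "'x \<Rightarrow> int"
    assume uv: "u \<in> X \<rightarrow>\<^sub>E UNIV" "v \<in> X \<rightarrow>\<^sub>E UNIV"
      and IH: "\<beta> (red u) = red (mat B u)" "\<beta> (red v) = red (mat B v)"
    define d where "d = (\<lambda>x\<in>X. u x - v x)"
    have "u = (\<lambda>x\<in>X. d x + v x)" using uv by (auto simp: d_def fun_eq_iff PiE_iff extensional_def)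
    then have eq: "\<beta> (red u) = \<beta> (red d) \<oplus>\<^bsub>FX\<^esub> \<beta> (red v)"
      using red_add[of d v] \<beta>_add[OF red_closed red_closed] by (simp only:)
    show "\<beta> (red (\<lambda>x\<in>X. u x - v x)) = red (mat B (\<lambda>x\<in>X. u x - v x))"
      unfolding d_def[symmetric]
    proof (rule PiE_ext[OF \<beta>E[OF red_closed] red_closed])
      fix x assume x: "x \<in> X"
      obtain k where k: "\<beta> (red d) x = Q k"
        using Q_rep[OF PiE_mem[OF \<beta>E[OF red_closed] x]] by metis
      have "Q (mat B u x) = Q (k + mat B v x)"
        using fun_cong[OF eq, of x] x IH k by (simp add: red_apply Q_add)
      then have "int p dvd mat B u x - (k + mat B v x)" by (simp only: Q_eq_iff)
      \<comment> \<open>The sign is changed to obtain the difference in the order that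
        \<open>Q_eq_iff\<close> expects.\<close>
      then have "int p dvd - (mat B u x - (k + mat B v x))" by (simp only: dvd_minus_iff)
      also have "mat B d x = mat B u x - mat B v x"
        using x by (simp add: mat_apply d_def right_diff_distrib sum_subtractf)
      then have "- (mat B u x - (k + mat B v x)) = k - mat B d x" by simp
      finally have "Q k = Q (mat B d x)" by (simp only: Q_eq_iff)
      then show "\<beta> (red d) x = red (mat B d) x" using x k by (simp add: red_apply)
    qed
  qed
  ultimately show ?thesis by (rule that)
qed

text \<open>The reduction of \<open>W\<close> commutes with all endomorphisms modulo
  \<open>p\<close>, because these lift to invariant matrices. By hypothesis it is then the action of
  an element of the group ring over \<open>F\<close>, and an integral lift of that element has a
  matrix congruent to \<open>W\<close>.\<close>

theorem bicentral_congruent_group_matrix: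
  assumes dcp: "double_centraliser_property FG FX" and W: "bicentral W"
  shows "\<exists>r. \<forall>x\<in>X. \<forall>y\<in>X. int p dvd W x y - group_matrix r x y"
proof -
  define \<tau> where "\<tau> = (\<lambda>v\<in>X \<rightarrow>\<^sub>E carrier F. red (mat W (lift v)))"
  have \<tau>: "\<tau> (red u) = red (mat W u)" if "u \<in> X \<rightarrow>\<^sub>E UNIV" for u
  proof (rule PiE_ext[of _ X "\<lambda>_. carrier F"])
    fix x assume x: "x \<in> X"
    \<comment> \<open>Lifting a reduction changes each entry by a multiple of \<open>p\<close>, and
      an integer matrix preserves this; so \<tau> can be computed from any lift.\<close>
    have "int p dvd lift (red u) y - u y" if "y \<in> X" for y
      using fun_cong[OF red_lift[OF red_closed[of u]], of y] that by (simp add: red_apply Q_eq_iff)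
    then have "int p dvd (\<Sum>y\<in>X. W x y * (lift (red u) y - u y))" by (intro dvd_sum dvd_mult) blast
    then have "int p dvd mat W (lift (red u)) x - mat W u x"
      using x by (simp add: mat_apply right_diff_distrib sum_subtractf)
    then show "\<tau> (red u) x = red (mat W u) x" using x by (simp add: \<tau>_def red_apply Q_eq_iff)
  qed (simp_all add: \<tau>_def)
  have "\<tau> \<in> carrier (DEnd_ring FG FX)"
    unfolding DEnd_ring_mem FX_simps(1)
  proof (intro conjI ballI)
    show "\<tau> \<in> (X \<rightarrow>\<^sub>E carrier F) \<rightarrow>\<^sub>E (X \<rightarrow>\<^sub>E carrier F)" by (simp add: \<tau>_def)
    fix v w assume v: "v \<in> X \<rightarrow>\<^sub>E carrier F" and w: "w \<in> X \<rightarrow>\<^sub>E carrier F"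
    have "v \<oplus>\<^bsub>FX\<^esub> w = red (\<lambda>x\<in>X. lift v x + lift w x)" unfolding red_add red_lift[OF v] red_lift[OF w] ..
    moreover have "(\<lambda>x\<in>X. lift v x + lift w x) \<in> X \<rightarrow>\<^sub>E UNIV" by simp
    ultimately have "\<tau> (v \<oplus>\<^bsub>FX\<^esub> w) = red (mat W (\<lambda>x\<in>X. lift v x + lift w x))" by (simp only: \<tau>)
    also have "\<dots> = red (mat W (lift v)) \<oplus>\<^bsub>FX\<^esub> red (mat W (lift w))" by (simp only: mat_add red_add)
    also have "\<dots> = \<tau> v \<oplus>\<^bsub>FX\<^esub> \<tau> w" using v w by (simp only: \<tau>_def restrict_apply if_True)
    finally show "\<tau> (v \<oplus>\<^bsub>FX\<^esub> w) = \<tau> v \<oplus>\<^bsub>FX\<^esub> \<tau> w" .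
  next
    fix \<beta> v assume \<beta>: "\<beta> \<in> carrier (End_ring FG FX)" and v: "v \<in> X \<rightarrow>\<^sub>E carrier F"
    obtain B where B: "invariant B" "\<And>u. u \<in> X \<rightarrow>\<^sub>E UNIV \<Longrightarrow> \<beta> (red u) = red (mat B u)"
      by (rule End_FX_matrix[OF \<beta>]) (rule that)
    have "\<tau> (\<beta> (red (lift v))) = red (mat W (mat B (lift v)))"
      unfolding B(2)[OF lift_closed] by (rule \<tau>[OF mat_closed])
    also have "\<dots> = red (mat B (mat W (lift v)))" using bicentral_mat_commute[OF W B(1)] by simp
    also have "\<dots> = \<beta> (\<tau> (red (lift v)))"
      unfolding \<tau>[OF lift_closed] by (rule B(2)[OF mat_closed, symmetric])
    finally show "\<tau> (\<beta> v) = \<beta> (\<tau> v)" unfolding red_lift[OF v] .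
  qed
  then obtain z where z: "z \<in> carrier FG" "\<tau> = homothety FX z"
    using dcp unfolding double_centraliser_property_def by blast
  define r where "r g = rep (z g)" for g
  have zr: "z = red_group r"
  proof (rule PiE_ext[of _ "carrier G" "\<lambda>_. carrier F"])
    fix g assume g: "g \<in> carrier G"
    then have "z g \<in> carrier F" using z(1) by auto
    then show "z g = red_group r g" using g by (simp add: red_group_def r_def Q_rep)
  qed (use z(1) in simp_all)
  have "int p dvd W x y - group_matrix r x y" if x: "x \<in> X" and y: "y \<in> X" for x y
  proof -
    have "red (mat W (basis y)) = z \<odot>\<^bsub>FX\<^esub> red (basis y)"
      using \<tau>[OF basis_closed, of y] unfolding z(2) homothety_def by (simp del: FX_simps(3))
    then have "red (mat W (basis y)) x = red (mat (group_matrix r) (basis y)) x"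
      unfolding zr red_smult by (rule fun_cong)
    then show ?thesis using x y by (simp add: red_apply mat_basis Q_eq_iff)
  qed
  then show ?thesis by blast
qed

end

theorem double_centraliser_permutation_module:
  assumes "group_action G X \<phi>" "finite (carrier G)" "finite X"
    and dcp: "\<And>p::nat. Factorial_Ring.prime p \<Longrightarrow>
      double_centraliser_property (group_ring (ZFact (int p)) G) (permutation_module (ZFact (int p)) G X \<phi>)"
  shows "double_centraliser_property (group_ring \<Z> G) (permutation_module \<Z> G X \<phi>)"
proof -
  interpret finite_action G X \<phi>
    using assms(1-3) by (intro finite_action.intro finite_action_axioms.intro)
  show ?thesis
  proof (rule double_centraliser_ZX)
    fix W assume "bicentral W"
    then show "\<exists>r. \<forall>x\<in>X. \<forall>y\<in>X. W x y = group_matrix r x y"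
    proof (rule bicentral_group_matrix_if_residually[rotated])
      fix p :: nat and V assume p: "Factorial_Ring.prime p" and V: "bicentral V"
      interpret modular_action G X \<phi> p
        by (intro modular_action.intro finite_action_axioms)
      show "\<exists>r. \<forall>x\<in>X. \<forall>y\<in>X. int p dvd V x y - group_matrix r x y"
        by (rule bicentral_congruent_group_matrix[OF dcp[OF p] V])
    qed
  qed
qed

theorem proposition3p6:
  fixes A :: "'a ring"
    and R :: "('a, 'r) module"
    and P :: "('r, 'p) module"
    and G :: "'g monoid"
    and X :: "'x set"
    and \<phi> :: "'g \<Rightarrow> 'x \<Rightarrow> 'x"
  shows
    "(dedekind_domain A \<or> field A \<longrightarrow>
      assoc_algebra A R \<longrightarrow>
      left_module R P \<longrightarrow>
      standard_hypotheses TYPE(('a \<times> 'a) set) A R P \<longrightarrow>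
      semisimple_ring (tensor_ring A (fraction_field A) R) \<longrightarrow>
      (\<forall>\<mm>. maximalideal \<mm> A \<longrightarrow>
        double_centraliser_property
          (tensor_ring A (residue_algebra A \<mm>) R)
          (base_change_module A (residue_algebra A \<mm>) R P)) \<longrightarrow>
      double_centraliser_property R P)
     \<and>
     (group G \<longrightarrow> finite (carrier G) \<longrightarrow>
      finite X \<longrightarrow> group_action G X \<phi> \<longrightarrow>
      (\<forall>p::nat. Factorial_Ring.prime p \<longrightarrow>
        double_centraliser_property
          (group_ring (ZFact (int p)) G) (permutation_module (ZFact (int p)) G X \<phi>)) \<longrightarrow>
      double_centraliser_property (group_ring \<Z> G) (permutation_module \<Z> G X \<phi>))"
proof (intro conjI impI)
  assume A: "dedekind_domain A \<or> field A" and R: "assoc_algebra A R" and P: "left_module R P"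
    and std: "standard_hypotheses TYPE(('a \<times> 'a) set) A R P"
    and ss: "semisimple_ring (tensor_ring A (fraction_field A) R)"
    and dcp: "\<forall>\<mm>. maximalideal \<mm> A \<longrightarrow> double_centraliser_property
          (tensor_ring A (residue_algebra A \<mm>) R) (base_change_module A (residue_algebra A \<mm>) R P)"
  show "double_centraliser_property R P"
    by (rule double_centraliser_dedekind[OF A R P std ss]) (rule dcp[rule_format])
next
  assume fin: "finite (carrier G)" "finite X" and act: "group_action G X \<phi>"
    and dcp: "\<forall>p::nat. Factorial_Ring.prime p \<longrightarrow> double_centraliser_property
          (group_ring (ZFact (int p)) G) (permutation_module (ZFact (int p)) G X \<phi>)"
  show "double_centraliser_property (group_ring \<Z> G) (permutation_module \<Z> G X \<phi>)"
    by (rule double_centraliser_permutation_module[OF act fin]) (rule dcp[rule_format])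
qed

end
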